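(* Let $F(z)=\sum_{k=0}^{n}A_kz^{n-k}\in\mathbb C[z]^{p\times p}$ be a monic matrix polynomial ($A_0=I_p$) of degree $n$, with even part $F_e$ and odd part $F_o$. Suppose that $\mathscr S=(\mathbf s_k)_{k=0}^{\infty}$ is the sequence of right (resp. left) Markov parameters of $F$ when $n=2m$, or the sequence of right (resp. left) Markov parameters of second type of $F$ when $n=2m+1$. Assume that every $\mathbf s_k$ is a Hermitian matrix. Let $\widehat F(z)$ be a greatest right common divisor (resp. greatest left common divisor) of $F_e(-z^2)$ and $zF_o(-z^2)$. Then: (i) if $n=2m$, $\gamma'_-(F)=\pi(H_{m-1}^{\langle\mathscr S\rangle})+\pi(H_{1,m-1}^{\langle\mathscr S\rangle})+\gamma_+(\widehat F)$, $\gamma'_+(F)=\nu(H_{m-1}^{\langle\mathscr S\rangle})+\nu(H_{1,m-1}^{\langle\mathscr S\rangle})+\gamma_-(\widehat F)$, $\gamma'_0(F)=\delta(H_{m-1}^{\langle\mathscr S\rangle})+\delta(H_{1,m-1}^{\langle\mathscr S\rangle})-\gamma_+(\widehat F)-\gamma_-(\widehat F)$; (ii) if $n=2m+1$, $\gamma'_-(F)=\pi(H_{m}^{\langle\mathscr S\rangle})+\pi(H_{1,m-1}^{\langle\mathscr S\rangle})+\gamma_+(\widehat F)$, $\gamma'_+(F)=\nu(H_{m}^{\langle\mathscr S\rangle})+\nu(H_{1,m-1}^{\langle\mathscr S\rangle})+\gamma_-(\widehat F)$, $\gamma'_0(F)=\delta(H_{m}^{\langle\mathscr S\rangle})+\delta(H_{1,m-1}^{\langle\mathscr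 S\rangle})-\gamma_+(\widehat F)-\gamma_-(\widehat F)$.
   Context: Even/odd parts: for $F(z)=\sum_{k=0}^nA_kz^{n-k}$, if $n=2m$ then $F_e(z)=\sum_{k=0}^mA_{2k}z^{m-k}$, $F_o(z)=\sum_{k=1}^mA_{2k-1}z^{m-k}$; if $n=2m+1$ then $F_e(z)=\sum_{k=0}^mA_{2k+1}z^{m-k}$, $F_o(z)=\sum_{k=0}^mA_{2k}z^{m-k}$; thus $F(z)=F_e(z^2)+zF_o(z^2)$. Markov parameters: for $n=2m$, the right (resp. left) Markov parameters $(\mathbf s_k)_{k\ge0}$ are defined by the Laurent expansion, valid for large $|z|$, $F_o(z)F_e(z)^{-1}=\sum_{k\ge0}(-1)^kz^{-(k+1)}\mathbf s_k$ (resp. $F_e(z)^{-1}F_o(z)=\sum_{k\ge0}(-1)^kz^{-(k+1)}\mathbf s_k$). For $n=2m+1$, the right (resp. left) Markov parameters of second type are defined by $F_e(z)F_o(z)^{-1}=\sum_{k\ge0}(-1)^kz^{-k}\mathbf s_k$ (resp. $F_o(z)^{-1}F_e(z)=\sum_{k\ge0}(-1)^kz^{-k}\mathbf s_k$) for large $|z|$. Block Hankel matrices: $H_{j,k}^{\langle\mathscr S\rangle}=[\mathbf s_{j+a+b}]_{a,b=0}^{k}$ (a $(k+1)p\times(k+1)p$ matrix) and $H_k^{\langle\mathscr S\rangle}=H_{0,k}^{\langle\mathscr S\rangle}$. For a square matrix $A$, $\pi(A),\nu(A),\delta(A)$ are the numbers of eigenvalues (with algebraic multiplicity) with positive, negative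 and zero real part. For a regular matrix polynomial $L$ (i.e. $\det L\not\equiv0$), a zero is a root of $\det L$, counted with its multiplicity as a root of $\det L$; $\gamma_+(L),\gamma_-(L),\gamma_0(L)$ are the numbers of zeros in the open upper half-plane, open lower half-plane and on the real axis; $\gamma'_+(L),\gamma'_-(L),\gamma'_0(L)$ are the numbers of zeros in the open right half-plane, open left half-plane and on the imaginary axis. $L$ is a right (resp. left) divisor of $F$ if $F=ML$ (resp. $F=LM$) for some matrix polynomial $M$; a greatest right (resp. left) common divisor of $F,\widetilde F$ is a right (resp. left) common divisor of both such that every right (resp. left) common divisor of $F,\widetilde F$ is a right (resp. left) divisor of it. *)

theory Defs
  imports Complex_Main "HOL-Computational_Algebra.Polynomial"
    "Jordan_Normal_Form.Char_Poly" "Jordan_Normal_Form.Determinant"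
begin

definition mcoeff :: "complex poly mat \<Rightarrow> nat \<Rightarrow> complex mat" where
  "mcoeff L k = mat (dim_row L) (dim_col L) (\<lambda>(i,j). coeff (L $$ (i,j)) k)"

definition monic_mpoly :: "nat \<Rightarrow> nat \<Rightarrow> complex poly mat \<Rightarrow> bool" where
  "monic_mpoly p n F \<longleftrightarrow> F \<in> carrier_mat p p \<and>
     (\<forall>i<p. \<forall>j<p. degree (F $$ (i,j)) \<le> n) \<and> mcoeff F n = 1\<^sub>m p"

(* even / odd parts: F(z) = F_e(z^2) + z F_o(z^2) *)
definition even_part_poly :: "complex poly \<Rightarrow> complex poly" where
  "even_part_poly q = (\<Sum>j\<le>degree q. monom (coeff q (2*j)) j)"

definition odd_part_poly :: "complex poly \<Rightarrow> complex poly" where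
  "odd_part_poly q = (\<Sum>j\<le>degree q. monom (coeff q (2*j+1)) j)"

definition mp_even :: "complex poly mat \<Rightarrow> complex poly mat" where
  "mp_even F = map_mat even_part_poly F"

definition mp_odd :: "complex poly mat \<Rightarrow> complex poly mat" where
  "mp_odd F = map_mat odd_part_poly F"

definition mpeval :: "complex poly mat \<Rightarrow> complex \<Rightarrow> complex mat" where
  "mpeval L z = map_mat (\<lambda>q. poly q z) L"

definition minv :: "complex mat \<Rightarrow> complex mat" where
  "minv A = (1 / det A) \<cdot>\<^sub>m adj_mat A"

definition markov1_right :: "nat \<Rightarrow> complex poly mat \<Rightarrow> (nat \<Rightarrow> complex mat) \<Rightarrow> bool" where
  "markov1_right p F s \<longleftrightarrow> (\<forall>k. s k \<in> carrier_mat p p) \<and>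
     (\<exists>R. \<forall>z. R < cmod z \<longrightarrow> det (mpeval (mp_even F) z) \<noteq> 0 \<and>
        (\<forall>i<p. \<forall>j<p. (\<lambda>k. (-1)^k * inverse (z ^ Suc k) * s k $$ (i,j)) sums
           ((mpeval (mp_odd F) z * minv (mpeval (mp_even F) z)) $$ (i,j))))"

definition markov1_left :: "nat \<Rightarrow> complex poly mat \<Rightarrow> (nat \<Rightarrow> complex mat) \<Rightarrow> bool" where
  "markov1_left p F s \<longleftrightarrow> (\<forall>k. s k \<in> carrier_mat p p) \<and>
     (\<exists>R. \<forall>z. R < cmod z \<longrightarrow> det (mpeval (mp_even F) z) \<noteq> 0 \<and>
        (\<forall>i<p. \<forall>j<p. (\<lambda>k. (-1)^k * inverse (z ^ Suc k) * s k $$ (i,j)) sums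
           ((minv (mpeval (mp_even F) z) * mpeval (mp_odd F) z) $$ (i,j))))"

definition markov2_right :: "nat \<Rightarrow> complex poly mat \<Rightarrow> (nat \<Rightarrow> complex mat) \<Rightarrow> bool" where
  "markov2_right p F s \<longleftrightarrow> (\<forall>k. s k \<in> carrier_mat p p) \<and>
     (\<exists>R. \<forall>z. R < cmod z \<longrightarrow> det (mpeval (mp_odd F) z) \<noteq> 0 \<and>
        (\<forall>i<p. \<forall>j<p. (\<lambda>k. (-1)^k * inverse (z ^ k) * s k $$ (i,j)) sums
           ((mpeval (mp_even F) z * minv (mpeval (mp_odd F) z)) $$ (i,j))))"

definition markov2_left :: "nat \<Rightarrow> complex poly mat \<Rightarrow> (nat \<Rightarrow> complex mat) \<Rightarrow> bool" where
  "markov2_left p F s \<longleftrightarrow> (\<forall>k. s k \<in> carrier_mat p p) \<and>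
     (\<exists>R. \<forall>z. R < cmod z \<longrightarrow> det (mpeval (mp_odd F) z) \<noteq> 0 \<and>
        (\<forall>i<p. \<forall>j<p. (\<lambda>k. (-1)^k * inverse (z ^ k) * s k $$ (i,j)) sums
           ((minv (mpeval (mp_odd F) z) * mpeval (mp_even F) z) $$ (i,j))))"

definition markov_right :: "nat \<Rightarrow> nat \<Rightarrow> complex poly mat \<Rightarrow> (nat \<Rightarrow> complex mat) \<Rightarrow> bool" where
  "markov_right p n F s \<longleftrightarrow> (if even n then markov1_right p F s else markov2_right p F s)"

definition markov_left :: "nat \<Rightarrow> nat \<Rightarrow> complex poly mat \<Rightarrow> (nat \<Rightarrow> complex mat) \<Rightarrow> bool" where
  "markov_left p n F s \<longleftrightarrow> (if even n then markov1_left p F s else markov2_left p F s)"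

definition hermitian_mat :: "nat \<Rightarrow> complex mat \<Rightarrow> bool" where
  "hermitian_mat p A \<longleftrightarrow> A \<in> carrier_mat p p \<and> (\<forall>i<p. \<forall>j<p. A $$ (i,j) = cnj (A $$ (j,i)))"

(* block Hankel matrix H_{j,k} = [s_{j+a+b}]_{a,b=0}^k, of size (k+1)p;
   k is an integer so that k = -1 gives the empty matrix *)
definition hankel :: "nat \<Rightarrow> (nat \<Rightarrow> complex mat) \<Rightarrow> nat \<Rightarrow> int \<Rightarrow> complex mat" where
  "hankel p s j k = mat (nat (k+1) * p) (nat (k+1) * p)
     (\<lambda>(a,b). s (j + a div p + b div p) $$ (a mod p, b mod p))"

definition roots_in :: "complex poly \<Rightarrow> complex set \<Rightarrow> nat" where
  "roots_in q S = (\<Sum>z\<in>{z. poly q z = 0 \<and> z \<in> S}. order z q)"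

definition inertia_pos :: "complex mat \<Rightarrow> nat" where
  "inertia_pos A = roots_in (char_poly A) {z. Re z > 0}"
definition inertia_neg :: "complex mat \<Rightarrow> nat" where
  "inertia_neg A = roots_in (char_poly A) {z. Re z < 0}"
definition inertia_zero :: "complex mat \<Rightarrow> nat" where
  "inertia_zero A = roots_in (char_poly A) {z. Re z = 0}"

definition gamma_upper :: "complex poly mat \<Rightarrow> nat" where
  "gamma_upper L = roots_in (det L) {z. Im z > 0}"
definition gamma_lower :: "complex poly mat \<Rightarrow> nat" where
  "gamma_lower L = roots_in (det L) {z. Im z < 0}"
definition gamma_real :: "complex poly mat \<Rightarrow> nat" where
  "gamma_real L = roots_in (det L) {z. Im z = 0}"
definition gamma_right :: "complex poly mat \<Rightarrow> nat" where
  "gamma_right L = roots_in (det L) {z. Re z > 0}"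
definition gamma_left :: "complex poly mat \<Rightarrow> nat" where
  "gamma_left L = roots_in (det L) {z. Re z < 0}"
definition gamma_imag :: "complex poly mat \<Rightarrow> nat" where
  "gamma_imag L = roots_in (det L) {z. Re z = 0}"

definition right_divisor :: "nat \<Rightarrow> complex poly mat \<Rightarrow> complex poly mat \<Rightarrow> bool" where
  "right_divisor p L F \<longleftrightarrow> L \<in> carrier_mat p p \<and> (\<exists>M \<in> carrier_mat p p. F = M * L)"
definition left_divisor :: "nat \<Rightarrow> complex poly mat \<Rightarrow> complex poly mat \<Rightarrow> bool" where
  "left_divisor p L F \<longleftrightarrow> L \<in> carrier_mat p p \<and> (\<exists>M \<in> carrier_mat p p. F = L * M)"

definition is_gcrd :: "nat \<Rightarrow> complex poly mat \<Rightarrow> complex poly mat \<Rightarrow> complex poly mat \<Rightarrow> bool" where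
  "is_gcrd p G F1 F2 \<longleftrightarrow> right_divisor p G F1 \<and> right_divisor p G F2 \<and>
     (\<forall>L. right_divisor p L F1 \<and> right_divisor p L F2 \<longrightarrow> right_divisor p L G)"
definition is_gcld :: "nat \<Rightarrow> complex poly mat \<Rightarrow> complex poly mat \<Rightarrow> complex poly mat \<Rightarrow> bool" where
  "is_gcld p G F1 F2 \<longleftrightarrow> left_divisor p G F1 \<and> left_divisor p G F2 \<and>
     (\<forall>L. left_divisor p L F1 \<and> left_divisor p L F2 \<longrightarrow> left_divisor p L G)"

definition even_negsq :: "complex poly mat \<Rightarrow> complex poly mat" where
  "even_negsq F = map_mat (\<lambda>q. pcompose q [:0, 0, -1:]) (mp_even F)"
definition odd_negsq :: "complex poly mat \<Rightarrow> complex poly mat" where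
  "odd_negsq F = map_mat (\<lambda>q. [:0, 1:] * pcompose q [:0, 0, -1:]) (mp_odd F)"

end

theory Submission
  imports Defs "Jordan_Normal_Form.Schur_Decomposition"
begin

text \<open>
  Write \<open>F(\<i>z) = N(z) + \<i> D(z)\<close> up to a unit, where \<open>N\<close> has degree \<open>n\<close> and a scalar leading coefficient
  and \<open>- D N\<^sup>-\<^sup>1 = \<Sum> t\<^sub>k z\<^sup>-\<^sup>k\<^sup>-\<^sup>1\<close> with Hermitian \<open>t\<^sub>k\<close>, namely \<open>t\<^sub>2\<^sub>k = s\<^sub>k\<close> and \<open>t\<^sub>k = 0\<close> for odd \<open>k\<close>.
  The block Hankel matrix \<open>X = [t\<^sub>a\<^sub>+\<^sub>b]\<close> is permutation similar to the direct sum of the two Hankel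
  matrices of the theorem. Let \<open>C\<close> be the block companion matrix of \<open>N\<close>, \<open>\<beta>\<close> the first block
  column of the identity and \<open>\<gamma>\<close> the first block row of \<open>X\<close>. Then \<open>A = C + \<i> \<beta> \<gamma>\<close> is a
  linearization of \<open>F(\<i>z)\<close>, and since \<open>X C\<close> is Hermitian and \<open>X \<beta> = \<gamma>\<^sup>*\<close>, we have
  \<open>X A - A\<^sup>* X = 2 \<i> \<gamma>\<^sup>* \<gamma>\<close>. The kernel of \<open>X\<close> is the unobservable subspace of \<open>(\<gamma>, A)\<close>; the
  restriction of \<open>A\<close> to it has characteristic polynomial \<open>det Fh\<close> up to a constant, and modulo the
  kernel \<open>A\<close> has no real eigenvalues, so that the numbers of its eigenvalues in the upper and the
  lower half-plane are the numbers of positive and negative eigenvalues of \<open>X\<close>. The left case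
  follows by transposition.
\<close>

section \<open>Matrix algebra\<close>

text \<open>The obstacle is that \<open>X\<close> may be singular: its kernel carries the zeros of
  \<open>Fh\<close>, about whose position the Hankel matrices say nothing. The inertia argument
  needs an invertible Hermitian form, hence the compression modulo the kernel. There it is
  elementary: the eigenvalues in the upper half-plane belong to an invariant subspace on which the
  form is nonnegative, so their number is bounded by that of the positive eigenvalues. Negating both
  matrices bounds the other half-plane, and since nothing is neutral the bounds add up to
  equalities. The two characteristic polynomials are never computed. Polynomial solutions of
  equations with the pencil \<open>zI - A\<close> only show divisibility, and the degree
  \<open>n * p\<close> of \<open>det F\<close> leaves no room for further factors. The equation for
  the compression needs observability, the one for the kernel needs coprimality of the two cofactors
  of \<open>Fh\<close>, which is where the greatest common divisor enters. The substitution of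
  \<open>\<i> z\<close> turns the left half-plane into the upper one and makes the perturbation of
  the companion matrix purely imaginary, so that the Hermitian part of \<open>X * A\<close> drops
  out of the Lyapunov identity.\<close>

text \<open>These variants have premises about dimensions instead of carriers, so that the simplifier can discharge them.\<close>

lemma mat_assoc: "dim_col A = dim_row B \<Longrightarrow> dim_col B = dim_row C \<Longrightarrow> A * B * C = A * (B * (C :: 'a :: comm_ring_1 mat))"
  by (rule assoc_mult_mat[of A "dim_row A" "dim_col A" B "dim_col B" C "dim_col C"]) auto

lemma mat_distrib_left: "dim_col A = dim_row B \<Longrightarrow> dim_row B = dim_row C \<Longrightarrow> dim_col B = dim_col C \<Longrightarrow> A * (B + C) = A * B + A * (C :: 'a :: comm_ring_1 mat)"
  by (rule mult_add_distrib_mat[of A "dim_row A" "dim_col A" B "dim_col B" C]) auto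

lemma mat_distrib_right: "dim_col A = dim_row C \<Longrightarrow> dim_row A = dim_row B \<Longrightarrow> dim_col A = dim_col B \<Longrightarrow> (A + B) * C = A * C + B * (C :: 'a :: comm_ring_1 mat)"
  by (rule add_mult_distrib_mat[of A "dim_row A" "dim_col A" B C "dim_col C"]) auto

lemma mat_diff_distrib_left: "dim_col A = dim_row B \<Longrightarrow> dim_row B = dim_row C \<Longrightarrow> dim_col B = dim_col C \<Longrightarrow> A * (B - C) = A * B - A * (C :: 'a :: comm_ring_1 mat)"
  by (rule mult_minus_distrib_mat[of A "dim_row A" "dim_col A" B "dim_col B" C]) auto

lemma mat_diff_distrib_right: "dim_col A = dim_row C \<Longrightarrow> dim_row A = dim_row B \<Longrightarrow> dim_col A = dim_col B \<Longrightarrow> (A - B) * C = A * C - B * (C :: 'a :: comm_ring_1 mat)"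
  by (rule minus_mult_distrib_mat[of A "dim_row A" "dim_col A" B C "dim_col C"]) auto

lemma mat_smult_left: "dim_col A = dim_row B \<Longrightarrow> (k \<cdot>\<^sub>m A) * B = k \<cdot>\<^sub>m (A * (B :: 'a :: comm_ring_1 mat))"
  by (rule mult_smult_assoc_mat[of A "dim_row A" "dim_col A" B "dim_col B"]) auto

lemma mat_smult_right: "dim_col A = dim_row B \<Longrightarrow> A * (k \<cdot>\<^sub>m B) = k \<cdot>\<^sub>m (A * (B :: 'a :: comm_ring_1 mat))"
  by (rule mult_smult_distrib[of A "dim_row A" "dim_col A" B "dim_col B"]) auto

lemmas mat_algebra = mat_assoc mat_distrib_left mat_distrib_right mat_diff_distrib_left mat_diff_distrib_right mat_smult_left mat_smult_right

definition cadj :: "complex mat \<Rightarrow> complex mat" where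
  "cadj A = mat (dim_col A) (dim_row A) (\<lambda>(i,j). cnj (A $$ (j,i)))"

lemma cadj_dim[simp]: "dim_row (cadj A) = dim_col A" "dim_col (cadj A) = dim_row A"
  by (auto simp: cadj_def)

lemma cadj_carrier[simp]: "cadj A \<in> carrier_mat n m \<longleftrightarrow> A \<in> carrier_mat m n"
  unfolding carrier_mat_def by auto

lemma cadj_index[simp]: "i < dim_col A \<Longrightarrow> j < dim_row A \<Longrightarrow> cadj A $$ (i,j) = cnj (A $$ (j,i))"
  by (simp add: cadj_def)

lemma cadj_cadj[simp]: "cadj (cadj A) = A"
  by (auto simp: cadj_def)

lemma cadj_mult: "dim_col A = dim_row B \<Longrightarrow> cadj (A * B) = cadj B * cadj A"
  by (rule eq_matI) (auto simp: scalar_prod_def mult.commute)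

lemma cadj_one[simp]: "cadj (1\<^sub>m n) = 1\<^sub>m n"
  by (rule eq_matI) auto

lemma cadj_smult: "cadj (c \<cdot>\<^sub>m A) = cnj c \<cdot>\<^sub>m cadj A"
  by (rule eq_matI) auto

lemma cadj_add: "dim_row A = dim_row B \<Longrightarrow> dim_col A = dim_col B \<Longrightarrow> cadj (A + B) = cadj A + cadj B"
  by (rule eq_matI) auto

lemma cadj_minus: "dim_row A = dim_row B \<Longrightarrow> dim_col A = dim_col B \<Longrightarrow> cadj (A - B) = cadj A - cadj B"
  by (rule eq_matI) auto

definition list_diag :: "complex list \<Rightarrow> complex mat" where
  "list_diag es = mat (length es) (length es) (\<lambda>(i,j). if i = j then es ! i else 0)"

lemma list_diag_dim[simp]: "dim_row (list_diag es) = length es" "dim_col (list_diag es) = length es"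
  by (auto simp: list_diag_def)

lemma mult_entry: "i < dim_row A \<Longrightarrow> j < dim_col B \<Longrightarrow> dim_col A = dim_row B \<Longrightarrow> 
   (A * B) $$ (i,j) = (\<Sum>k<dim_row B. A $$ (i,k) * B $$ (k,j))"
  by (simp add: scalar_prod_def lessThan_atLeast0)

lemma list_diag_mult_entry:
  assumes "dim_row B = length es" "i < length es" "j < dim_col B"
  shows "(list_diag es * B) $$ (i,j) = es ! i * B $$ (i,j)"
proof -
  have "(list_diag es * B) $$ (i,j) = (\<Sum>k<length es. list_diag es $$ (i,k) * B $$ (k,j))"
    using assms by (simp add: mult_entry del: index_mult_mat(1))
  also have "\<dots> = (\<Sum>k<length es. (if i = k then es ! i * B $$ (k,j) else 0))"
    by (rule sum.cong) (use assms in \<open>auto simp: list_diag_def\<close>)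
  finally show ?thesis using assms by (simp add: sum.delta)
qed

lemma cadj_mult_self_entry:
  assumes u: "dim_col u = 1"
  shows "(cadj u * u) $$ (0,0) = of_real (\<Sum>i<dim_row u. (cmod (u $$ (i,0)))^2)"
  using u by (subst mult_entry) (auto simp: complex_norm_square mult.commute simp del: of_real_power intro!: sum.cong)

lemma list_diag_form:
  assumes u: "u \<in> carrier_mat (length es) 1"
  shows "(cadj u * (list_diag es * u)) $$ (0,0) = (\<Sum>i<length es. es ! i * of_real ((cmod (u $$ (i,0)))^2))"
proof -
  have "(cadj u * (list_diag es * u)) $$ (0,0) = (\<Sum>k<length es. cnj (u $$ (k,0)) * (es ! k * u $$ (k,0)))"
    using u by (subst mult_entry) (auto simp: list_diag_mult_entry intro!: sum.cong simp del: index_mult_mat(1))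
  also have "\<dots> = (\<Sum>i<length es. es ! i * of_real ((cmod (u $$ (i,0)))^2))"
    by (rule sum.cong) (auto simp: complex_norm_square ac_simps simp del: of_real_power)
  finally show ?thesis .
qed

lemma nonzero_col_entry:
  assumes "u \<in> carrier_mat n 1" "u \<noteq> 0\<^sub>m n 1"
  obtains i where "i < n" "u $$ (i,0) \<noteq> 0"
proof (rule ccontr)
  assume "\<not> thesis"
  hence "\<And>i. i < n \<Longrightarrow> u $$ (i,0) = 0" using that by blast
  hence "u = 0\<^sub>m n 1" using assms(1) by (intro eq_matI) auto
  thus False using assms(2) by simp
qed

lemma cadj_self_pos:
  assumes u: "u \<in> carrier_mat n 1" "u \<noteq> 0\<^sub>m n 1"
  shows "(\<Sum>i<n. (cmod (u $$ (i,0)))^2) > 0"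
proof -
  obtain i where "i < n" "u $$ (i,0) \<noteq> 0" using nonzero_col_entry[OF u] .
  thus ?thesis by (intro sum_pos2[of _ i]) auto
qed

section \<open>Unitary diagonalization of Hermitian matrices\<close>

lemma one_by_one_mat: "(A :: complex mat) \<in> carrier_mat 1 1 \<Longrightarrow> A = A $$ (0,0) \<cdot>\<^sub>m 1\<^sub>m 1"
  by (rule eq_matI) auto

definition unit0 :: "nat \<Rightarrow> complex mat" where
  "unit0 n = mat n 1 (\<lambda>(i,j). if i = 0 then 1 else 0)"

lemma unit0_dim[simp]: "dim_row (unit0 n) = n" "dim_col (unit0 n) = 1"
  by (auto simp: unit0_def)

lemma mult_unit0:
  assumes "i < dim_row A" "0 < dim_col A" 
  shows "(A * unit0 (dim_col A)) $$ (i,0) = A $$ (i,0)"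
proof -
  have "(A * unit0 (dim_col A)) $$ (i,0) = (\<Sum>k<dim_col A. A $$ (i,k) * unit0 (dim_col A) $$ (k,0))"
    using assms by (simp add: mult_entry del: index_mult_mat(1))
  also have "\<dots> = (\<Sum>k<dim_col A. (if k = 0 then A $$ (i,k) else 0))"
    by (rule sum.cong) (use assms in \<open>auto simp: unit0_def\<close>)
  finally show ?thesis using assms by (simp add: sum.delta)
qed

text \<open>Reflection in the hyperplane orthogonal to \<open>w = e - x\<close>, which exchanges the
  unit vectors \<open>e\<close> and \<open>x\<close>. Over the complex numbers this needs a real
  inner product of \<open>e\<close> and \<open>x\<close>, hence the assumption on the first entry of
  \<open>x\<close>.\<close>

lemma householder:
  assumes x: "x \<in> carrier_mat n 1" and n: "0 < n"
    and nrm: "cadj x * x = 1\<^sub>m 1" and re: "cnj (x $$ (0,0)) = x $$ (0,0)"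
  shows "\<exists>H\<in>carrier_mat n n. cadj H = H \<and> H * H = 1\<^sub>m n \<and> H * unit0 n = x"
proof (cases "x = unit0 n")
  case True
  thus ?thesis by (intro bexI[of _ "1\<^sub>m n"]) (auto intro!: carrier_matI)
next
  case False
  define e where "e = unit0 n"
  define w where "w = e - x"
  define c where "c = (cadj w * w) $$ (0,0)"
  have d[simp]: "dim_row x = n" "dim_col x = 1" "dim_row e = n" "dim_col e = 1" "dim_row w = n" "dim_col w = 1"
    using x by (auto simp: e_def w_def)
  have wn0: "w \<noteq> 0\<^sub>m n 1"
  proof
    assume "w = 0\<^sub>m n 1"
    hence "x = e" using x unfolding w_def
      by (intro eq_matI) (auto dest!: arg_cong[where f = "\<lambda>A. A $$ (_, 0)"] simp: mat_eq_iff)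
    thus False using False e_def by simp
  qed
  have ww: "cadj w * w = c \<cdot>\<^sub>m 1\<^sub>m 1" unfolding c_def by (rule one_by_one_mat) (auto intro!: carrier_matI)
  have c0: "c \<noteq> 0"
  proof -
    have "w \<in> carrier_mat n 1" by (intro carrier_matI) auto
    from cadj_self_pos[OF this wn0] have "(\<Sum>i<n. (cmod (w $$ (i,0)))\<^sup>2) \<noteq> 0" by simp
    thus ?thesis using cadj_mult_self_entry[of w] unfolding c_def by (simp del: index_mult_mat(1) of_real_sum of_real_power)
  qed
  have e0: "(cadj y * e) $$ (0,0) = cnj (y $$ (0,0))" if "dim_row y = n" "dim_col y = 1" for y
    using mult_unit0[of 0 "cadj y"] that n by (simp add: e_def)
  have e1: "(cadj e * y) $$ (0,0) = y $$ (0,0)" if "dim_row y = n" "dim_col y = 1" for y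
    using arg_cong[OF cadj_mult[of "cadj y" e], of "\<lambda>A. A $$ (0,0)"] e0[OF that] that
    by (auto simp del: index_mult_mat(1))
  \<comment> \<open>Expanding \<open>w\<close> gives \<open>c\<close> as 2 minus twice the real part
    of this entry. As the entry is real, this determines it, and \<open>cadj w * e\<close> becomes
    \<open>c / 2\<close>, so that the reflection subtracts exactly \<open>w\<close> from
    \<open>e\<close>.\<close>
  have x00: "x $$ (0,0) = 1 - c / 2"
  proof -
    have "cadj w * w = cadj e * e - cadj e * x - (cadj x * e - cadj x * x)"
      unfolding w_def by (subst cadj_minus) (auto simp: mat_algebra)
    hence "c = 1 - x $$ (0,0) - (cnj (x $$ (0,0)) - 1)"
      unfolding c_def using e0[of e] e0[of x] e1[of x] n by (simp add: nrm del: index_mult_mat(1)) (simp add: e_def unit0_def)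
    thus ?thesis using re by (simp add: field_simps)
  qed
  have cc: "cnj c = c" using x00 re by (metis (no_types, opaque_lifting) complex_cnj_diff complex_cnj_divide complex_cnj_numeral complex_cnj_one diff_diff_eq2 diff_minus_eq_add divide_cancel_right zero_neq_numeral add_diff_cancel_left')
  define H where "H = 1\<^sub>m n - (2 / c) \<cdot>\<^sub>m (w * cadj w)"
  have dH[simp]: "dim_row H = n" "dim_col H = n" by (auto simp: H_def)
  have "cadj H = H"
    unfolding H_def using cc by (simp add: cadj_minus cadj_smult cadj_mult)
  moreover have "H * H = 1\<^sub>m n"
  proof -
    define W where "W = w * cadj w"
    have dW[simp]: "dim_row W = n" "dim_col W = n" by (auto simp: W_def)
    have "W * W = w * ((cadj w * w) * cadj w)" unfolding W_def by (simp add: mat_algebra)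
    also have "\<dots> = c \<cdot>\<^sub>m W" unfolding ww W_def by (simp add: mat_algebra)
    finally have WW: "W * W = c \<cdot>\<^sub>m W" .
    have "H * H = 1\<^sub>m n - (2/c) \<cdot>\<^sub>m W - (2/c) \<cdot>\<^sub>m (W - (2/c) \<cdot>\<^sub>m (W * W))"
      unfolding H_def W_def[symmetric] by (simp add: mat_algebra)
    also have "\<dots> = 1\<^sub>m n" unfolding WW using c0
      by (intro eq_matI) (auto simp: field_simps)
    finally show ?thesis .
  qed
  moreover have "H * e = x"
  proof -
    have "(cadj w * e) $$ (0,0) = c / 2"
      using e0[of w] x00 re n by (simp add: w_def del: index_mult_mat(1)) (simp add: e_def unit0_def)
    moreover have "cadj w * e \<in> carrier_mat 1 1" by (intro carrier_matI) auto
    ultimately have "cadj w * e = (c/2) \<cdot>\<^sub>m 1\<^sub>m 1"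
      using one_by_one_mat[of "cadj w * e"] by (simp only:)
    hence "w * (cadj w * e) = (c/2) \<cdot>\<^sub>m w" by (simp add: mat_algebra)
    hence "H * e = e - (2/c) \<cdot>\<^sub>m ((c/2) \<cdot>\<^sub>m w)" unfolding H_def by (simp add: mat_algebra)
    also have "\<dots> = x" unfolding w_def using c0 by (intro eq_matI) (auto simp: diff_divide_distrib)
    finally show ?thesis .
  qed
  ultimately show ?thesis unfolding e_def by (intro bexI[of _ H]) auto
qed

text \<open>Besides unit length the scaling achieves a real first entry, the normalization that
  \<open>householder\<close> asks for.\<close>

lemma unit_eigenvector:
  fixes X :: "complex mat"
  assumes X: "X \<in> carrier_mat n n" and e: "eigenvalue X e"
  shows "\<exists>x\<in>carrier_mat n 1. cadj x * x = 1\<^sub>m 1 \<and> cnj (x $$ (0,0)) = x $$ (0,0) \<and> X * x = e \<cdot>\<^sub>m x"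
proof -
  obtain v where v: "v \<in> carrier_vec n" "v \<noteq> 0\<^sub>v n" "X *\<^sub>v v = e \<cdot>\<^sub>v v"
    using e X unfolding eigenvalue_def eigenvector_def by auto
  define y where "y = mat n 1 (\<lambda>(i,j). v $ i)"
  have y: "y \<in> carrier_mat n 1" unfolding y_def by simp
  have n: "0 < n" using v by (cases n) auto
  have yn: "y \<noteq> 0\<^sub>m n 1"
  proof
    assume "y = 0\<^sub>m n 1"
    hence "v $ i = 0" if "i < n" for i using that unfolding y_def by (auto simp: mat_eq_iff)
    thus False using v by auto
  qed
  have Xy: "X * y = e \<cdot>\<^sub>m y"
  proof (rule eq_matI)
    fix i j assume ij: "i < dim_row (e \<cdot>\<^sub>m y)" "j < dim_col (e \<cdot>\<^sub>m y)"
    hence i: "i < n" and j: "j = 0" by (auto simp: y_def)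
    have "(X * y) $$ (i,j) = (X *\<^sub>v v) $ i"
      using i j X v(1) by (auto simp: y_def scalar_prod_def intro!: sum.cong)
    thus "(X * y) $$ (i,j) = (e \<cdot>\<^sub>m y) $$ (i,j)" unfolding v(3) using i j v(1) by (simp add: y_def)
  qed (use X y in auto)
  define S where "S = (\<Sum>i<n. (cmod (y $$ (i,0)))^2)"
  have S: "S > 0" unfolding S_def by (rule cadj_self_pos[OF y yn])
  \<comment> \<open>The phase of \<open>a\<close> turns the first entry of \<open>y\<close> into its
    modulus; if that entry vanishes, any phase will do and 1 is taken. The division by
    \<open>sqrt S\<close> normalizes the length.\<close>
  define a where "a = (if y $$ (0,0) = 0 then 1 else cnj (y $$ (0,0)) / of_real (cmod (y $$ (0,0)))) / of_real (sqrt S)"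
  have a1: "cnj a * a = 1 / of_real S"
    using S unfolding a_def
    by (auto simp: complex_norm_square[symmetric] simp del: of_real_power)
       (auto simp: of_real_mult[symmetric] field_simps power2_eq_square simp del: of_real_mult)
  have a2: "cnj (a * y $$ (0,0)) = a * y $$ (0,0)"
    unfolding a_def by (auto simp: mult.commute)
  have yy: "cadj y * y = of_real S \<cdot>\<^sub>m 1\<^sub>m 1"
    using one_by_one_mat[of "cadj y * y"] cadj_mult_self_entry[of y] y unfolding S_def by (auto intro!: carrier_matI)
  show ?thesis
  proof (intro bexI[of _ "a \<cdot>\<^sub>m y"] conjI)
    have "cadj (a \<cdot>\<^sub>m y) * (a \<cdot>\<^sub>m y) = (cnj a * a) \<cdot>\<^sub>m (cadj y * y)"
      using y by (intro eq_matI) (auto simp: cadj_smult mat_algebra mult.assoc simp del: index_mult_mat(1))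
    also have "\<dots> = 1\<^sub>m 1" unfolding yy a1 using S by (intro eq_matI) auto
    finally show "cadj (a \<cdot>\<^sub>m y) * (a \<cdot>\<^sub>m y) = 1\<^sub>m 1" .
    show "X * (a \<cdot>\<^sub>m y) = e \<cdot>\<^sub>m (a \<cdot>\<^sub>m y)" using X y Xy
      by (intro eq_matI) (auto simp: mat_algebra ac_simps simp del: index_mult_mat(1))
  qed (use y a2 n in auto)
qed

lemma cadj_four_block:
  assumes "A \<in> carrier_mat n1 m1" "B \<in> carrier_mat n1 m2" "C \<in> carrier_mat n2 m1" "D \<in> carrier_mat n2 m2"
  shows "cadj (four_block_mat A B C D) = four_block_mat (cadj A) (cadj C) (cadj B) (cadj D)"
  using assms by (intro eq_matI) auto

text \<open>Deflation: conjugation by a reflection that maps \<open>unit0 n\<close> to an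
  eigenvector makes the first column a multiple of \<open>unit0 n\<close>, and Hermitian symmetry
  clears the first row as well. The eigenvalues appear in the order of \<open>es\<close>, which
  later allows the zero eigenvalues to be put in front.\<close>

lemma hermitian_diagonalize:
  assumes "X \<in> carrier_mat n n" "cadj X = X" "char_poly X = (\<Prod>a\<leftarrow>es. [:-a,1:])"
  shows "\<exists>U\<in>carrier_mat n n. cadj U * U = 1\<^sub>m n \<and> U * cadj U = 1\<^sub>m n \<and> cadj U * (X * U) = list_diag es"
  using assms
proof (induction es arbitrary: n X)
  case Nil
  have "n = 0" using degree_monic_char_poly[OF Nil(1)] Nil(3) by auto
  thus ?case using Nil by (intro bexI[of _ "1\<^sub>m 0"]) (auto simp: list_diag_def)
next
  case (Cons e es)
  note X = Cons.prems(1)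
  have "degree (char_poly X) = Suc (length es)" unfolding Cons.prems(3) 
    by (subst degree_linear_factors) simp
  then obtain m where n: "n = Suc m" "length es = m" using degree_monic_char_poly[OF X] by auto
  have "eigenvalue X e" using eigenvalue_root_char_poly[OF X, of e] Cons.prems(3) by simp
  from unit_eigenvector[OF X this] obtain x where x: "x \<in> carrier_mat n 1" "cadj x * x = 1\<^sub>m 1"
    "cnj (x $$ (0,0)) = x $$ (0,0)" "X * x = e \<cdot>\<^sub>m x" by blast
  obtain H where H: "H \<in> carrier_mat n n" "cadj H = H" "H * H = 1\<^sub>m n" "H * unit0 n = x"
    using householder[OF x(1) _ x(2,3)] n by auto
  have dims[simp]: "dim_row X = n" "dim_col X = n" "dim_row H = n" "dim_col H = n" "dim_row x = n" "dim_col x = 1"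
    using X H x by auto
  define X' where "X' = H * (X * H)"
  have dX'[simp]: "dim_row X' = n" "dim_col X' = n" by (auto simp: X'_def)
  have "X' * unit0 n = H * (X * (H * unit0 n))" unfolding X'_def by (simp add: mat_algebra)
  also have "\<dots> = e \<cdot>\<^sub>m (H * x)" unfolding H(4) x(4) by (simp add: mat_algebra)
  also have "H * x = (H * H) * unit0 n" unfolding H(4)[symmetric] by (simp add: mat_algebra)
  also have "\<dots> = unit0 n" unfolding H(3) by (auto intro!: carrier_matI)
  finally have col: "X' * unit0 n = e \<cdot>\<^sub>m unit0 n" .
  have c0: "X' $$ (i,0) = (if i = 0 then e else 0)" if "i < n" for i
  proof -
    have "(X' * unit0 n) $$ (i,0) = X' $$ (i,0)" using mult_unit0[of i X'] that n by simp
    thus ?thesis unfolding col using that by (auto simp: unit0_def split: if_splits)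
  qed
  have herm: "cadj X' = X'" unfolding X'_def by (simp add: cadj_mult Cons.prems(2) H(2) mat_algebra)
  have hentry: "X' $$ (i,j) = cnj (X' $$ (j,i))" if "i < n" "j < n" for i j
    using arg_cong[OF herm, of "\<lambda>A. A $$ (i,j)"] that by simp
  define X4 where "X4 = mat m m (\<lambda>(i,j). X' $$ (i+1,j+1))"
  have X4: "X4 \<in> carrier_mat m m" unfolding X4_def by simp
  define E where "E = mat 1 1 (\<lambda>_::nat\<times>nat. e)"
  have E: "E \<in> carrier_mat 1 1" unfolding E_def by simp
  have blk: "X' = four_block_mat E (0\<^sub>m 1 m) (0\<^sub>m m 1) X4"
  proof (rule eq_matI)
    fix i j assume "i < dim_row (four_block_mat E (0\<^sub>m 1 m) (0\<^sub>m m 1) X4)" "j < dim_col (four_block_mat E (0\<^sub>m 1 m) (0\<^sub>m m 1) X4)"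
    hence ij: "i < n" "j < n" using n X4 E by auto
    show "X' $$ (i,j) = four_block_mat E (0\<^sub>m 1 m) (0\<^sub>m m 1) X4 $$ (i,j)"
      using ij n X4 E c0[of i] c0[of j] hentry[of i j]
      by (cases i; cases j) (auto simp: E_def X4_def)
  qed (use n X4 E in auto)
  have sim: "similar_mat X X'"
  proof (rule similar_matI)
    have "H * X' * H = (H * H) * (X * (H * H))" unfolding X'_def by (simp add: mat_algebra)
    thus "X = H * X' * H" unfolding H(3) using X by simp
  qed (use X H in \<open>auto simp: X'_def\<close>)
  have "char_poly X = char_poly X'" using char_poly_similar[OF sim] .
  also have "\<dots> = char_poly E * char_poly X4" unfolding blk
    by (rule char_poly_four_block_zeros_col[OF E _ X4]) auto
  also have "char_poly E = [:-e,1:]"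
    by (subst char_poly_upper_triangular[OF E]) (auto simp: E_def diag_mat_def upper_triangular_def)
  finally have "[:-e,1:] * char_poly X4 = [:-e,1:] * (\<Prod>a\<leftarrow>es. [:-a,1:])" using Cons.prems(3) by simp
  hence cp: "char_poly X4 = (\<Prod>a\<leftarrow>es. [:-a,1:])" by (subst (asm) mult_cancel_left) simp
  have "cadj X4 = X4"
  proof (rule eq_matI)
    fix i j assume "i < dim_row X4" "j < dim_col X4"
    thus "cadj X4 $$ (i,j) = X4 $$ (i,j)" using hentry[of "Suc i" "Suc j"] n by (simp add: X4_def)
  qed (auto simp: X4_def)
  from Cons.IH[OF X4 this cp] obtain V where V: "V \<in> carrier_mat m m" "cadj V * V = 1\<^sub>m m" "V * cadj V = 1\<^sub>m m"
     "cadj V * (X4 * V) = list_diag es" by blast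
  define B where "B = four_block_mat (1\<^sub>m 1) (0\<^sub>m 1 m) (0\<^sub>m m 1) V"
  have B: "B \<in> carrier_mat n n" using V n unfolding B_def by auto
  have cB: "cadj B = four_block_mat (1\<^sub>m 1) (0\<^sub>m 1 m) (0\<^sub>m m 1) (cadj V)"
    using V unfolding B_def by (subst cadj_four_block[of _ 1 1 _ m _ m]) (auto intro!: cong_four_block_mat eq_matI)
  have V': "cadj V \<in> carrier_mat m m" using V by simp
  have z[simp]: "(0\<^sub>m 1 m :: complex mat) \<in> carrier_mat 1 m" "(0\<^sub>m m 1 :: complex mat) \<in> carrier_mat m 1" by auto
  have B1: "cadj B * B = 1\<^sub>m n" unfolding cB unfolding B_def n
    by (subst mult_four_block_mat[of _ 1 1 _ m _ m _ _ 1 _ m], insert V V', auto)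
  have B2: "B * cadj B = 1\<^sub>m n" unfolding cB unfolding B_def n
    by (subst mult_four_block_mat[of _ 1 1 _ m _ m _ _ 1 _ m], insert V V', auto)
  have dm: "list_diag (e # es) = four_block_mat E (0\<^sub>m 1 m) (0\<^sub>m m 1) (list_diag es)"
    using n(2) E by (intro eq_matI) (auto simp: list_diag_def E_def nth_Cons')
  have X'B: "X' * B = four_block_mat E (0\<^sub>m 1 m) (0\<^sub>m m 1) (X4 * V)"
    unfolding blk B_def
    by (subst mult_four_block_mat[of _ 1 1 _ m _ m _ _ 1 _ m], insert V V' X4 E, auto)
  have ds: "list_diag es \<in> carrier_mat m m" using n(2) by (intro carrier_matI) auto
  have B3: "cadj B * (X' * B) = list_diag (e # es)" unfolding X'B dm cB
    by (subst mult_four_block_mat[of _ 1 1 _ m _ m _ _ 1 _ m], insert V V' X4 E ds, auto)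
  have dB[simp]: "dim_row B = n" "dim_col B = n" using B by auto
  show ?case
  proof (intro bexI[of _ "H * B"] conjI)
    have "cadj (H * B) * (H * B) = cadj B * ((H * H) * B)" by (simp add: cadj_mult H(2) mat_algebra)
    thus "cadj (H * B) * (H * B) = 1\<^sub>m n" unfolding H(3) using B1 B by simp
    have "(H * B) * cadj (H * B) = H * ((B * cadj B) * H)" by (simp add: cadj_mult H(2) mat_algebra)
    thus "(H * B) * cadj (H * B) = 1\<^sub>m n" unfolding B2 using H by simp
    have "cadj (H * B) * (X * (H * B)) = cadj B * (X' * B)" by (simp add: cadj_mult H(2) mat_algebra X'_def)
    thus "cadj (H * B) * (X * (H * B)) = list_diag (e # es)" using B3 by simp
  qed (use H B in auto)
qed

section \<open>Inertia of dissipative pairs\<close>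

text \<open>Fewer than \<open>k\<close> homogeneous equations in \<open>k\<close> unknowns: the rows
  indexed by \<open>I\<close> are padded with zero rows to a square matrix, whose last row is then
  zero and whose determinant vanishes.\<close>

lemma exists_kernel_on_rows:
  fixes C :: "complex mat"
  assumes C: "C \<in> carrier_mat n k" and I: "I \<subseteq> {..<n}" "card I < k"
  shows "\<exists>u\<in>carrier_mat k 1. u \<noteq> 0\<^sub>m k 1 \<and> (\<forall>i\<in>I. (C * u) $$ (i,0) = 0)"
proof -
  have "finite I" using I finite_subset by blast
  then obtain xs where xs: "set xs = I" "distinct xs" using finite_distinct_list by blast
  have len: "length xs < k" using I xs distinct_card[OF xs(2)] by simp
  define K where "K = mat k k (\<lambda>(a,j). if a < length xs then C $$ (xs ! a, j) else 0)"
  have K: "K \<in> carrier_mat k k" unfolding K_def by simp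
  have "det K = (\<Sum>j<k. K $$ (k-1,j) * cofactor K (k-1) j)"
    by (rule laplace_expansion_row[OF K]) (use len in auto)
  also have "\<dots> = 0" by (rule sum.neutral) (use len in \<open>auto simp: K_def\<close>)
  finally have "det K = 0" .
  then obtain v where v: "v \<in> carrier_vec k" "v \<noteq> 0\<^sub>v k" "K *\<^sub>v v = 0\<^sub>v k"
    using det_0_iff_vec_prod_zero[OF K] by auto
  define u where "u = mat k 1 (\<lambda>(i,j). v $ i)"
  have "(C * u) $$ (i,0) = 0" if "i \<in> I" for i
  proof -
    have "i \<in> set xs" using that xs(1) by simp
    then obtain a where a: "a < length xs" "xs ! a = i" by (auto simp: in_set_conv_nth)
    have i: "i < n" using that I by auto
    have "(C * u) $$ (i,0) = (K *\<^sub>v v) $ a"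
    proof -
      have "(C * u) $$ (i,0) = (\<Sum>j<k. C $$ (i,j) * v $ j)"
        using C i by (subst mult_entry) (auto simp: u_def)
      moreover have "(K *\<^sub>v v) $ a = (\<Sum>j<k. row K a $ j * v $ j)"
        using a len K v(1) by (simp add: scalar_prod_def lessThan_atLeast0)
      moreover have "row K a $ j = C $$ (i,j)" if "j < k" for j
        using a len that by (simp add: K_def)
      ultimately show ?thesis by simp
    qed
    thus ?thesis unfolding v(3) using a len by simp
  qed
  moreover have "u \<noteq> 0\<^sub>m k 1"
  proof
    assume "u = 0\<^sub>m k 1"
    hence "v $ i = 0" if "i < k" for i using that unfolding u_def by (auto simp: mat_eq_iff)
    thus False using v by auto
  qed
  ultimately show ?thesis by (intro bexI[of _ u]) (auto simp: u_def)
qed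

lemma form_entry:
  assumes "T \<in> carrier_mat k k" "u \<in> carrier_mat k 1"
  shows "(cadj u * (T * u)) $$ (0,0) = (\<Sum>i<k. \<Sum>j<k. cnj (u $$ (i,0)) * (T $$ (i,j) * u $$ (j,0)))"
proof -
  have "(cadj u * (T * u)) $$ (0,0) = (\<Sum>i<k. cadj u $$ (0,i) * (T * u) $$ (i,0))"
    using assms by (subst mult_entry) auto
  also have "\<dots> = (\<Sum>i<k. cnj (u $$ (i,0)) * (\<Sum>j<k. T $$ (i,j) * u $$ (j,0)))"
    by (rule sum.cong) (use assms in \<open>auto simp: mult_entry simp del: index_mult_mat(1)\<close>)
  finally show ?thesis by (simp add: sum_distrib_left)
qed

text \<open>The scaled matrix is the conjugate of \<open>T\<close> by the diagonal matrix with
  entries \<open>r^i\<close>; as \<open>r\<close> tends to 0 only the diagonal survives, and its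
  imaginary part is bounded below by some \<open>\<mu> > 0\<close>.\<close>

lemma upper_triangular_scaled_form_pos:
  assumes T: "T \<in> carrier_mat k k" "upper_triangular T" and pos: "\<And>i. i < k \<Longrightarrow> Im (T $$ (i,i)) > 0"
  shows "\<exists>r>0. \<forall>u\<in>carrier_mat k 1. u \<noteq> 0\<^sub>m k 1 \<longrightarrow> 
     Im ((cadj u * (mat k k (\<lambda>(i,j). if i \<le> j then of_real (r^(j-i)) * T $$ (i,j) else 0) * u)) $$ (0,0)) > 0"
proof -
  define \<mu> where "\<mu> = Min (insert 1 ((\<lambda>i. Im (T $$ (i,i))) ` {..<k}))"
  have \<mu>: "\<mu> > 0" "\<And>i. i < k \<Longrightarrow> \<mu> \<le> Im (T $$ (i,i))" unfolding \<mu>_def using pos by (auto simp: Min_gr_iff)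
  define K where "K = (\<Sum>i<k. \<Sum>j<k. cmod (T $$ (i,j)))"
  have K0: "K \<ge> 0" unfolding K_def by (auto intro!: sum_nonneg)
  have K: "cmod (T $$ (i,j)) \<le> K" if "i < k" "j < k" for i j
  proof -
    have "cmod (T $$ (i,j)) \<le> (\<Sum>j<k. cmod (T $$ (i,j)))" using that
      by (intro member_le_sum) auto
    also have "\<dots> \<le> K" unfolding K_def using that by (intro member_le_sum[of i "{..<k}" "\<lambda>i. \<Sum>j<k. cmod (T $$ (i,j))"]) (auto intro: sum_nonneg)
    finally show ?thesis .
  qed
  \<comment> \<open>Chosen so that \<open>r * K * k < \<mu>\<close>, because the entries above the
    diagonal contribute at most \<open>r * K * k\<close> times the squared norm. The summand 1 keeps
    the denominator positive.\<close>
  define r where "r = min 1 (\<mu> / (K * k + 1))"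
  have Kk: "K * k + 1 > 0" using K0 by (simp add: add_nonneg_pos)
  have r: "r > 0" "r \<le> 1" "r \<le> \<mu> / (K * k + 1)" unfolding r_def using \<mu>(1) Kk by auto
  have rK: "r * K * k < \<mu>"
  proof -
    have "r * (K * k + 1) \<le> \<mu>" using r(3) Kk by (simp add: pos_le_divide_eq)
    thus ?thesis using r(1) by (simp add: algebra_simps)
  qed
  define T' where "T' = mat k k (\<lambda>(i,j). if i \<le> j then of_real (r^(j-i)) * T $$ (i,j) else 0)"
  have T': "T' \<in> carrier_mat k k" unfolding T'_def by simp
  have "Im ((cadj u * (T' * u)) $$ (0,0)) > 0" if u: "u \<in> carrier_mat k 1" "u \<noteq> 0\<^sub>m k 1" for u
  proof -
    define a where "a i = cmod (u $$ (i,0))" for i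
    define S where "S = (\<Sum>i<k. (a i)^2)"
    have S: "S > 0" unfolding S_def a_def by (rule cadj_self_pos[OF u])
    \<comment> \<open>Above the diagonal this is
      \<open>2 * a i * a j \<le> (a i)^2 + (a j)^2\<close>. The same error term is subtracted on and
      below the diagonal, where it only weakens the bound, so that the double sum has a uniform
      shape.\<close>
    have summand: "(if i = j then \<mu> * (a i)^2 else 0) - r * K * ((a i)^2 + (a j)^2) / 2 
       \<le> Im (cnj (u $$ (i,0)) * (T' $$ (i,j) * u $$ (j,0)))" if ij: "i < k" "j < k" for i j
    proof -
      have nn: "r * K * ((a i)^2 + (a j)^2) / 2 \<ge> 0" using r K0 by auto
      consider "i = j" | "i < j" | "j < i" by linarith
      thus ?thesis
      proof cases
        case 1
        have "cnj (u $$ (i,0)) * (T' $$ (i,j) * u $$ (j,0)) = T $$ (i,i) * of_real ((a i)^2)"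
          using 1 ij unfolding T'_def a_def by (simp add: complex_norm_square ac_simps del: of_real_power)
        hence "Im (cnj (u $$ (i,0)) * (T' $$ (i,j) * u $$ (j,0))) = Im (T $$ (i,i)) * (a i)^2"
          by (simp del: of_real_power)
        moreover have "\<mu> * (a i)^2 \<le> Im (T $$ (i,i)) * (a i)^2" using \<mu>(2)[OF ij(1)] by (simp add: mult_right_mono)
        ultimately show ?thesis using nn 1 by simp
      next
        case 2
        have p: "r^(j-i) \<le> r" using r 2 by (metis power_decreasing power_one_right Suc_leI zero_less_diff One_nat_def less_imp_le)
        have "cmod (cnj (u $$ (i,0)) * (T' $$ (i,j) * u $$ (j,0))) = r^(j-i) * cmod (T $$ (i,j)) * (a i * a j)"
          using 2 ij r unfolding T'_def a_def by (simp add: norm_mult norm_power)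
        also have "\<dots> \<le> (r * K) * (((a i)^2 + (a j)^2) / 2)"
        proof (intro mult_mono)
          have "(a i - a j)^2 \<ge> 0" by simp
          thus "a i * a j \<le> ((a i)^2 + (a j)^2) / 2" by (simp add: power2_eq_square algebra_simps)
        qed (use p r K[OF ij] K0 in \<open>auto simp: a_def\<close>)
        finally have "cmod (cnj (u $$ (i,0)) * (T' $$ (i,j) * u $$ (j,0))) \<le> r * K * ((a i)^2 + (a j)^2) / 2" by simp
        with abs_Im_le_cmod[of "cnj (u $$ (i,0)) * (T' $$ (i,j) * u $$ (j,0))"] show ?thesis
          unfolding if_not_P[OF less_imp_neq[OF 2]] by linarith
      next
        case 3
        thus ?thesis using nn ij by (simp add: T'_def)
      qed
    qed
    have "(\<Sum>i<k. \<Sum>j<k. (if i = j then \<mu> * (a i)^2 else 0) - r * K * ((a i)^2 + (a j)^2) / 2) 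
       \<le> (\<Sum>i<k. \<Sum>j<k. Im (cnj (u $$ (i,0)) * (T' $$ (i,j) * u $$ (j,0))))"
      by (intro sum_mono) (use summand in auto)
    also have "\<dots> = Im ((cadj u * (T' * u)) $$ (0,0))" by (subst form_entry[OF T' u(1)]) simp
    also have "(\<Sum>i<k. \<Sum>j<k. (if i = j then \<mu> * (a i)^2 else 0) - r * K * ((a i)^2 + (a j)^2) / 2) = \<mu> * S - r * K * k * S"
    proof -
      have "(\<Sum>i<k. \<Sum>j<k. (if i = j then \<mu> * (a i)^2 else 0)) = \<mu> * S"
        unfolding S_def by (simp add: sum.delta sum_distrib_left)
      moreover have "(\<Sum>i<k. \<Sum>j<k. r * K * ((a i)^2 + (a j)^2) / 2) = r * K / 2 * (\<Sum>i<k. \<Sum>j<k. ((a i)^2 + (a j)^2))"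
        unfolding sum_distrib_left by (intro sum.cong refl) simp
      moreover have "(\<Sum>i<k. \<Sum>j<k. ((a i)^2 + (a j)^2)) = 2 * k * S"
        unfolding S_def by (simp add: sum.distrib sum_distrib_left mult.assoc)
      ultimately show ?thesis unfolding sum_subtractf by (simp only:) (simp add: algebra_simps)
    qed
    also have "\<mu> * S - r * K * k * S = (\<mu> - r * K * k) * S" by (simp add: algebra_simps)
    finally have "(\<mu> - r * K * k) * S \<le> Im ((cadj u * (T' * u)) $$ (0,0))" .
    moreover have "(\<mu> - r * K * k) * S > 0" using rK S by simp
    ultimately show ?thesis by linarith
  qed
  thus ?thesis using r(1) unfolding T'_def by blast
qed

lemma list_diag_cadj: "(\<And>e. e \<in> set es \<Longrightarrow> cnj e = e) \<Longrightarrow> cadj (list_diag es) = list_diag es"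
  by (rule eq_matI) (auto simp: list_diag_def)

text \<open>Otherwise the form has a negative eigenvector; after a diagonal scaling that makes the strictly
  upper part of \<open>T\<close> negligible, this eigenvector violates the dissipativity hypothesis.\<close>

lemma form_nonneg_of_upper_eigenvalues:
  assumes T: "T \<in> carrier_mat k k" "upper_triangular T" and pos: "\<And>i. i < k \<Longrightarrow> Im (T $$ (i,i)) > 0"
    and Y: "Y \<in> carrier_mat k k" "cadj Y = Y"
    and dis: "\<And>u. u \<in> carrier_mat k 1 \<Longrightarrow> Im ((cadj u * (Y * (T * u))) $$ (0,0)) \<ge> 0"
    and u: "u \<in> carrier_mat k 1"
  shows "Re ((cadj u * (Y * u)) $$ (0,0)) \<ge> 0"
proof -
  obtain r where r: "r > 0" and rpos: "\<And>u. u \<in> carrier_mat k 1 \<Longrightarrow> u \<noteq> 0\<^sub>m k 1 \<Longrightarrow>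
     Im ((cadj u * (mat k k (\<lambda>(i,j). if i \<le> j then of_real (r^(j-i)) * T $$ (i,j) else 0) * u)) $$ (0,0)) > 0"
    using upper_triangular_scaled_form_pos[OF T pos] by blast
  define T' where "T' = mat k k (\<lambda>(i,j). if i \<le> j then of_real (r^(j-i)) * T $$ (i,j) else 0)"
  define S where "S = list_diag (map (\<lambda>i. of_real (r^i)) [0..<k])"
  define Si where "Si = list_diag (map (\<lambda>i. of_real (1 / r^i)) [0..<k])"
  have d[simp]: "dim_row T = k" "dim_col T = k" "dim_row Y = k" "dim_col Y = k" "dim_row T' = k" "dim_col T' = k"
    "dim_row S = k" "dim_col S = k" "dim_row Si = k" "dim_col Si = k" "dim_row u = k" "dim_col u = 1"
    using T Y u by (auto simp: T'_def S_def Si_def)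
  have cS: "cadj S = S" unfolding S_def by (rule list_diag_cadj) auto
  have SSi: "S * Si = 1\<^sub>m k"
    using r by (intro eq_matI) (auto simp: S_def list_diag_mult_entry simp del: index_mult_mat(1), auto simp: Si_def list_diag_def)
  \<comment> \<open>\<open>T'\<close> is \<open>T\<close> in the scaled basis, so replacing
    \<open>Y\<close> by the congruent form \<open>S * (Y * S)\<close> keeps the dissipativity
    hypothesis; \<open>S\<close> is its own adjoint because the scaling is real.\<close>
  have TS: "T * S = S * T'"
  proof (rule eq_matI)
    fix i j assume "i < dim_row (S * T')" "j < dim_col (S * T')"
    hence ij: "i < k" "j < k" by auto
    have "(T * S) $$ (i,j) = (\<Sum>l<k. T $$ (i,l) * S $$ (l,j))" using ij by (subst mult_entry) auto
    also have "\<dots> = (\<Sum>l<k. if l = j then T $$ (i,j) * of_real (r^j) else 0)"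
      by (rule sum.cong) (use ij in \<open>auto simp: S_def list_diag_def\<close>)
    also have "\<dots> = T $$ (i,j) * of_real (r^j)" using ij by (simp add: sum.delta)
    also have "\<dots> = of_real (r^i) * T' $$ (i,j)"
    proof (cases "i \<le> j")
      case True
      have "r^j = r^i * r^(j-i)" using True by (simp add: power_add[symmetric])
      thus ?thesis using True ij unfolding T'_def by simp
    next
      case False
      thus ?thesis using ij T(2) unfolding T'_def by (simp add: upper_triangular_def)
    qed
    also have "\<dots> = (S * T') $$ (i,j)" using ij unfolding S_def
      by (subst list_diag_mult_entry) auto
    finally show "(T * S) $$ (i,j) = (S * T') $$ (i,j)" .
  qed auto
  define Y' where "Y' = S * (Y * S)"
  have Y': "Y' \<in> carrier_mat k k" unfolding Y'_def by (intro carrier_matI) auto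
  have dY'[simp]: "dim_row Y' = k" "dim_col Y' = k" using Y' by auto
  have hY': "cadj Y' = Y'" unfolding Y'_def by (simp add: cadj_mult cS Y mat_algebra)
  have dis': "Im ((cadj v * (Y' * (T' * v))) $$ (0,0)) \<ge> 0" if v: "v \<in> carrier_mat k 1" for v
  proof -
    have [simp]: "dim_row v = k" "dim_col v = 1" using v by auto
    have "cadj v * (Y' * (T' * v)) = cadj v * (S * (Y * ((S * T') * v)))" unfolding Y'_def by (simp add: mat_algebra)
    also have "\<dots> = cadj (S * v) * (Y * (T * (S * v)))" unfolding TS[symmetric] by (simp add: cadj_mult cS mat_algebra)
    finally have "cadj v * (Y' * (T' * v)) = cadj (S * v) * (Y * (T * (S * v)))" .
    moreover have "S * v \<in> carrier_mat k 1" by (intro carrier_matI) auto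
    ultimately show ?thesis using dis[of "S * v"] by (simp only:)
  qed
  obtain es where es: "char_poly Y' = (\<Prod>a\<leftarrow>es. [:-a,1:])" using char_poly_factorized[OF Y'] by blast
  obtain V where V: "V \<in> carrier_mat k k" "cadj V * V = 1\<^sub>m k" "V * cadj V = 1\<^sub>m k" "cadj V * (Y' * V) = list_diag es"
    using hermitian_diagonalize[OF Y' hY' es] by blast
  have dV[simp]: "dim_row V = k" "dim_col V = k" using V by auto
  have len: "length es = k" using arg_cong[OF V(4), of dim_row] by simp
  have Y'V: "Y' * V = V * list_diag es"
  proof -
    have "V * (cadj V * (Y' * V)) = (V * cadj V) * (Y' * V)" by (simp add: mat_algebra)
    thus ?thesis unfolding V(3,4) by (simp add: left_mult_one_mat')
  qed
  have hd: "cadj (list_diag es) = list_diag es" unfolding V(4)[symmetric] by (simp add: cadj_mult hY' mat_algebra)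
  have real: "Im (es ! i) = 0" if "i < k" for i
  proof -
    have "cnj (es ! i) = es ! i" using arg_cong[OF hd, of "\<lambda>A. A $$ (i,i)"] that len by (simp add: list_diag_def)
    thus ?thesis by (simp add: complex_eq_iff)
  qed
  have nonneg: "Re (es ! i) \<ge> 0" if i: "i < k" for i
  proof (rule ccontr)
    assume neg: "\<not> Re (es ! i) \<ge> 0"
    define e where "e = mat k 1 (\<lambda>(l,_). if l = i then 1 else (0::complex))"
    have de[simp]: "dim_row e = k" "dim_col e = 1" by (auto simp: e_def)
    define v where "v = V * e"
    have v: "v \<in> carrier_mat k 1" unfolding v_def by (intro carrier_matI) auto
    have dv[simp]: "dim_row v = k" "dim_col v = 1" using v by auto
    have De: "list_diag es * e = (es ! i) \<cdot>\<^sub>m e"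
      using len i by (intro eq_matI) (auto simp: list_diag_mult_entry simp del: index_mult_mat(1), auto simp: e_def)
    have Yv: "Y' * v = (es ! i) \<cdot>\<^sub>m v"
    proof -
      have "Y' * v = (Y' * V) * e" unfolding v_def by (simp add: mat_algebra)
      also have "\<dots> = V * (list_diag es * e)" unfolding Y'V using len by (simp add: mat_algebra)
      finally show ?thesis unfolding De v_def by (simp add: mat_algebra)
    qed
    have v0: "v \<noteq> 0\<^sub>m k 1"
    proof
      assume "v = 0\<^sub>m k 1"
      hence "cadj V * v = 0\<^sub>m k 1" by simp
      hence "(cadj V * V) * e = 0\<^sub>m k 1" unfolding v_def by (simp add: mat_algebra)
      hence "e = 0\<^sub>m k 1" unfolding V(2) by (simp add: left_mult_one_mat')
      hence "e $$ (i,0) = 0" using i by simp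
      thus False using i by (simp add: e_def)
    qed
    \<comment> \<open>Moved to the left factor, \<open>Y'\<close> acts on its eigenvector: the form
      becomes the real eigenvalue times the form of \<open>T'\<close>, whose imaginary part is
      positive. A negative eigenvalue would make the product negative.\<close>
    have "cadj v * (Y' * (T' * v)) = cadj (Y' * v) * (T' * v)" by (simp add: cadj_mult hY' mat_algebra)
    also have "\<dots> = cnj (es ! i) \<cdot>\<^sub>m (cadj v * (T' * v))" unfolding Yv by (simp add: cadj_smult mat_algebra)
    finally have "Im ((cadj v * (Y' * (T' * v))) $$ (0,0)) = Im (cnj (es ! i) * (cadj v * (T' * v)) $$ (0,0))"
      by (simp del: index_mult_mat(1))
    also have "\<dots> = Re (es ! i) * Im ((cadj v * (T' * v)) $$ (0,0))" using real[OF i] by simp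
    also have "\<dots> < 0" using neg rpos[OF v v0] unfolding T'_def by (intro mult_neg_pos) auto
    finally show False using dis'[OF v] by simp
  qed
  \<comment> \<open>The coordinates of \<open>u\<close> in the scaled eigenbasis: the form of
    \<open>Y\<close> at \<open>u\<close> becomes a sum of squares weighted by the nonnegative
    eigenvalues of \<open>Y'\<close>.\<close>
  define w where "w = cadj V * (Si * u)"
  have dw[simp]: "dim_row w = k" "dim_col w = 1" unfolding w_def by auto
  have "S * (V * w) = S * ((V * cadj V) * (Si * u))" unfolding w_def by (simp add: mat_algebra)
  also have "\<dots> = (S * Si) * u" unfolding V(3) by (simp add: mat_algebra left_mult_one_mat')
  also have "\<dots> = u" unfolding SSi using u by simp
  finally have u_eq: "u = S * (V * w)" ..
  have "cadj u * (Y * u) = cadj w * ((cadj V * (Y' * V)) * w)"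
    unfolding u_eq Y'_def by (simp add: cadj_mult cS mat_algebra)
  also have "\<dots> = cadj w * (list_diag es * w)" unfolding V(4) ..
  finally have "(cadj u * (Y * u)) $$ (0,0) = (\<Sum>i<k. es ! i * of_real ((cmod (w $$ (i,0)))^2))"
    using list_diag_form[of w es] len carrier_matI[of w k 1] by (simp del: index_mult_mat(1))
  hence "Re ((cadj u * (Y * u)) $$ (0,0)) = (\<Sum>i<k. Re (es ! i) * (cmod (w $$ (i,0)))^2)"
    by (simp del: of_real_power index_mult_mat(1))
  also have "\<dots> \<ge> 0" by (intro sum_nonneg mult_nonneg_nonneg) (use nonneg in auto)
  finally show ?thesis .
qed

text \<open>The \<open>k\<close> eigenvalues in the upper half-plane belong to an invariant subspace
  of dimension \<open>k\<close>, on which the form of \<open>list_diag es\<close> is nonnegative.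
  Were \<open>k\<close> larger than the number of positive entries of \<open>es\<close>, some
  nonzero vector of the subspace would vanish in all positive coordinates, and the form would be
  negative there because no entry of \<open>es\<close> is zero.\<close>

lemma upper_eigenvalues_le_positive:
  assumes A: "A \<in> carrier_mat n n" and as: "char_poly A = (\<Prod>a\<leftarrow>as. [:-a,1:])"
    and es: "length es = n" "\<And>e. e \<in> set es \<Longrightarrow> Im e = 0 \<and> Re e \<noteq> 0"
    and dis: "\<And>u. u \<in> carrier_mat n 1 \<Longrightarrow> Im ((cadj u * (list_diag es * (A * u))) $$ (0,0)) \<ge> 0"
  shows "length (filter (\<lambda>a. Im a > 0) as) \<le> length (filter (\<lambda>e. Re e > 0) es)"
proof (rule ccontr)
  assume contra: "\<not> ?thesis"
  define bs where "bs = filter (\<lambda>a. Im a > 0) as"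
  define k where "k = length bs"
  \<comment> \<open>The Schur form keeps the order of the given eigenvalue list. With the upper
    eigenvalues in front, the leading \<open>k\<close> columns of \<open>P\<close> span their
    invariant subspace; these are the columns of \<open>B\<close> below, and \<open>T1\<close> is
    the action of \<open>A\<close> on them.\<close>
  define cs where "cs = bs @ filter (\<lambda>a. \<not> Im a > 0) as"
  have "mset cs = mset as" unfolding cs_def bs_def by (simp add: multiset_partition[symmetric])
  hence cs: "char_poly A = (\<Prod>a\<leftarrow>cs. [:-a,1:])"
    unfolding as by (metis mset_map prod_mset_prod_list)
  obtain T P Q where sch: "schur_decomposition A cs = (T,P,Q)" by (cases "schur_decomposition A cs") auto
  from schur_decomposition[OF A cs sch] have sim: "similar_mat_wit A T P Q" and ut: "upper_triangular T"
    and dg: "diag_mat T = cs" by auto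
  from similar_mat_witD2[OF A sim] have PQ: "P * Q = 1\<^sub>m n" "Q * P = 1\<^sub>m n" "A = P * T * Q"
    and T: "T \<in> carrier_mat n n" and P: "P \<in> carrier_mat n n" and Q: "Q \<in> carrier_mat n n" by auto
  have len: "length cs = n" using dg T by (auto simp: diag_mat_def)
  have kn: "k \<le> n" using len unfolding cs_def k_def by simp
  have d[simp]: "dim_row A = n" "dim_col A = n" "dim_row T = n" "dim_col T = n" "dim_row P = n" "dim_col P = n"
    "dim_row Q = n" "dim_col Q = n" using A T P Q by auto
  have Tii: "T $$ (i,i) = cs ! i" if "i < n" for i using that dg by (auto simp: diag_mat_def)
  define E where "E = mat n k (\<lambda>(i,j). if i = j then 1 else (0::complex))"
  define T1 where "T1 = mat k k (\<lambda>(i,j). T $$ (i,j))"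
  have dE[simp]: "dim_row E = n" "dim_col E = k" "dim_row T1 = k" "dim_col T1 = k" by (auto simp: E_def T1_def)
  have multE: "(E * W) $$ (i,j) = (if i < k then W $$ (i,j) else 0)" if "i < n" "j < dim_col W" "dim_row W = k" for W i j
  proof -
    have "(E * W) $$ (i,j) = (\<Sum>l<k. E $$ (i,l) * W $$ (l,j))" using that by (subst mult_entry) auto
    also have "\<dots> = (\<Sum>l<k. if i = l then W $$ (l,j) else 0)"
      by (rule sum.cong) (use that in \<open>auto simp: E_def\<close>)
    finally show ?thesis by (simp add: sum.delta)
  qed
  have TE: "T * E = E * T1"
  proof (rule eq_matI)
    fix i j assume "i < dim_row (E * T1)" "j < dim_col (E * T1)"
    hence ij: "i < n" "j < k" by auto
    have "(T * E) $$ (i,j) = (\<Sum>l<n. T $$ (i,l) * E $$ (l,j))" using ij by (subst mult_entry) auto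
    also have "\<dots> = (\<Sum>l<n. if l = j then T $$ (i,l) else 0)"
      by (rule sum.cong) (use ij in \<open>auto simp: E_def\<close>)
    also have "\<dots> = T $$ (i,j)" using ij kn by (simp add: sum.delta)
    also have "\<dots> = (E * T1) $$ (i,j)" using ij multE[of i j T1] ut kn
      by (auto simp: T1_def upper_triangular_def)
    finally show "(T * E) $$ (i,j) = (E * T1) $$ (i,j)" .
  qed auto
  define B where "B = P * E"
  have dB[simp]: "dim_row B = n" "dim_col B = k" unfolding B_def by auto
  have AB: "A * B = B * T1"
  proof -
    have "A * B = P * (T * ((Q * P) * E))" unfolding PQ(3) B_def by (simp add: mat_algebra)
    also have "\<dots> = P * (T * E)" unfolding PQ(2) by (simp add: left_mult_one_mat')
    also have "\<dots> = B * T1" unfolding TE B_def by (simp add: mat_algebra)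
    finally show ?thesis .
  qed
  have cd: "cadj (list_diag es) = list_diag es" by (rule list_diag_cadj) (use es in \<open>auto simp: complex_eq_iff\<close>)
  have form: "Re ((cadj (B * u) * (list_diag es * (B * u))) $$ (0,0)) \<ge> 0" if u: "u \<in> carrier_mat k 1" for u
  proof -
    have [simp]: "dim_row u = k" "dim_col u = 1" using u by auto
    have "Re ((cadj u * ((cadj B * (list_diag es * B)) * u)) $$ (0,0)) \<ge> 0"
    proof (rule form_nonneg_of_upper_eigenvalues[of T1 k])
      show "upper_triangular T1" using ut kn unfolding T1_def upper_triangular_def by auto
      show "Im (T1 $$ (i,i)) > 0" if "i < k" for i
      proof -
        have "cs ! i \<in> set bs" using that unfolding cs_def k_def by (simp add: nth_append)
        thus ?thesis using that kn Tii[of i] unfolding T1_def bs_def by auto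
      qed
      show "cadj (cadj B * (list_diag es * B)) = cadj B * (list_diag es * B)" using es(1) by (simp add: cadj_mult cd mat_algebra)
      fix v :: "complex mat" assume v: "v \<in> carrier_mat k 1"
      have [simp]: "dim_row v = k" "dim_col v = 1" using v by auto
      have Bv: "B * v \<in> carrier_mat n 1" by (intro carrier_matI) auto
      have "cadj v * (cadj B * (list_diag es * B) * (T1 * v)) = cadj (B * v) * (list_diag es * ((B * T1) * v))"
        using es(1) by (simp add: cadj_mult mat_algebra)
      also have "\<dots> = cadj (B * v) * (list_diag es * (A * (B * v)))" unfolding AB[symmetric] using es(1) by (simp add: mat_algebra)
      finally show "Im ((cadj v * (cadj B * (list_diag es * B) * (T1 * v))) $$ (0,0)) \<ge> 0"
        using dis[OF Bv] by (simp only:)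
    qed (use u es(1) in \<open>auto intro!: carrier_matI\<close>)
    moreover have "cadj u * ((cadj B * (list_diag es * B)) * u) = cadj (B * u) * (list_diag es * (B * u))"
      using es(1) by (simp add: cadj_mult mat_algebra)
    ultimately show ?thesis by (simp only:)
  qed
  define I where "I = {i. i < n \<and> Re (es ! i) > 0}"
  have cI: "card I = length (filter (\<lambda>e. Re e > 0) es)" unfolding I_def length_filter_conv_card using es(1) by simp
  have I: "I \<subseteq> {..<n}" "card I < k" using cI contra unfolding I_def k_def bs_def by auto
  have B: "B \<in> carrier_mat n k" by (intro carrier_matI) auto
  from exists_kernel_on_rows[OF B I] obtain u where u: "u \<in> carrier_mat k 1" "u \<noteq> 0\<^sub>m k 1"
     "\<forall>i\<in>I. (B * u) $$ (i,0) = 0" by (elim bexE conjE)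
  have du[simp]: "dim_row u = k" "dim_col u = 1" using u by auto
  define y where "y = B * u"
  have y: "y \<in> carrier_mat n 1" unfolding y_def by (intro carrier_matI) auto
  have "y \<noteq> 0\<^sub>m n 1"
  proof
    assume "y = 0\<^sub>m n 1"
    hence "Q * y = 0\<^sub>m n 1" by simp
    moreover have "Q * y = (Q * P) * (E * u)" unfolding y_def B_def by (simp add: mat_algebra)
    ultimately have E0: "E * u = 0\<^sub>m n 1" unfolding PQ(2) by (simp add: left_mult_one_mat')
    have "u $$ (i,0) = 0" if "i < k" for i
      using multE[of i 0 u] that kn unfolding E0 by simp
    hence "u = 0\<^sub>m k 1" by (intro eq_matI) auto
    thus False using u by simp
  qed
  then obtain i0 where i0: "i0 < n" "y $$ (i0,0) \<noteq> 0" using nonzero_col_entry[OF y] by blast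
  have "(cadj y * (list_diag es * y)) $$ (0,0) = (\<Sum>i<n. es ! i * of_real ((cmod (y $$ (i,0)))^2))"
    using list_diag_form[of y es] y es(1) by simp
  hence "Re ((cadj y * (list_diag es * y)) $$ (0,0)) = (\<Sum>i<n. Re (es ! i) * (cmod (y $$ (i,0)))^2)"
    by (simp del: of_real_power index_mult_mat(1))
  also have "\<dots> = - (\<Sum>i<n. - Re (es ! i) * (cmod (y $$ (i,0)))^2)" by (simp add: sum_negf)
  also have "\<dots> < 0"
  proof -
    have "(\<Sum>i<n. - Re (es ! i) * (cmod (y $$ (i,0)))^2) > 0"
    proof (rule sum_pos2[of _ i0])
      have "i0 \<notin> I" using u(3) i0 unfolding y_def by blast
      hence "Re (es ! i0) < 0" using i0 es unfolding I_def by (metis (mono_tags, lifting) mem_Collect_eq not_less_iff_gr_or_eq nth_mem)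
      thus "0 < - Re (es ! i0) * (cmod (y $$ (i0,0)))^2" using i0 by (intro mult_pos_pos) auto
      fix i assume "i \<in> {..<n}"
      thus "0 \<le> - Re (es ! i) * (cmod (y $$ (i,0)))^2" using u(3)[rule_format, of i] unfolding y_def I_def
        by (cases "Re (es ! i) > 0") (auto simp: mult_nonneg_nonneg mult_nonpos_nonneg)
    qed (use i0 in auto)
    thus ?thesis by simp
  qed
  finally show False using form[OF u(1)] unfolding y_def by simp
qed

section \<open>Polynomial matrices and pencils\<close>

definition const_mat :: "complex mat \<Rightarrow> complex poly mat" where
  "const_mat A = map_mat (\<lambda>a. [:a:]) A"

lemma const_mat_dim[simp]: "dim_row (const_mat A) = dim_row A" "dim_col (const_mat A) = dim_col A"
  by (auto simp: const_mat_def)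

lemma const_mat_carrier[simp]: "const_mat A \<in> carrier_mat n m \<longleftrightarrow> A \<in> carrier_mat n m"
  unfolding const_mat_def by simp

lemma const_mat_index[simp]: "i < dim_row A \<Longrightarrow> j < dim_col A \<Longrightarrow> const_mat A $$ (i,j) = [:A $$ (i,j):]"
  by (simp add: const_mat_def)

lemma const_poly_sum: "[:sum f S:] = (\<Sum>x\<in>S. [:f x:])"
  by (rule poly_eqI) (simp add: coeff_sum coeff_pCons sum.neutral split: nat.split)

lemma const_mat_mult: "dim_col A = dim_row B \<Longrightarrow> const_mat (A * B) = const_mat A * const_mat B"
  by (rule eq_matI) (auto simp: mult_entry const_poly_sum mult.commute simp del: index_mult_mat(1))

lemma const_mat_one[simp]: "const_mat (1\<^sub>m n) = 1\<^sub>m n"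
  by (rule eq_matI) (auto simp: one_pCons)

lemma const_mat_zero[simp]: "const_mat (0\<^sub>m n m) = 0\<^sub>m n m"
  by (rule eq_matI) auto

lemma const_mat_add: "dim_row A = dim_row B \<Longrightarrow> dim_col A = dim_col B \<Longrightarrow> const_mat (A + B) = const_mat A + const_mat B"
  by (rule eq_matI) auto

lemma const_mat_minus: "dim_row A = dim_row B \<Longrightarrow> dim_col A = dim_col B \<Longrightarrow> const_mat (A - B) = const_mat A - const_mat B"
  by (rule eq_matI) auto

lemma const_mat_smult: "const_mat (c \<cdot>\<^sub>m A) = [:c:] \<cdot>\<^sub>m const_mat A"
  by (rule eq_matI) auto

definition pencil :: "complex mat \<Rightarrow> complex poly mat" where
  "pencil A = [:0,1:] \<cdot>\<^sub>m 1\<^sub>m (dim_row A) - const_mat A"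

lemma pencil_dim[simp]: "dim_row (pencil A) = dim_row A" "dim_col (pencil A) = dim_col A"
  by (auto simp: pencil_def)

lemma pencil_carrier[simp]: "A \<in> carrier_mat n m \<Longrightarrow> pencil A \<in> carrier_mat n m"
  by (intro carrier_matI) auto

lemma det_pencil: "A \<in> carrier_mat n n \<Longrightarrow> det (pencil A) = char_poly A"
  unfolding char_poly_def char_poly_matrix_def pencil_def
  by (rule arg_cong[where f = det]) (auto intro!: eq_matI)

lemma char_poly_nonzero: "(A :: complex mat) \<in> carrier_mat n n \<Longrightarrow> char_poly A \<noteq> 0"
  using degree_monic_char_poly[of A n] by auto

lemma pencil_mult_const_mat:
  assumes "dim_row A = dim_row B" "dim_col A = dim_row B" "dim_row T = dim_col B" "dim_col T = dim_col B" "A * B = B * T"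
  shows "pencil A * const_mat B = const_mat B * pencil T"
proof -
  have "pencil A * const_mat B = [:0,1:] \<cdot>\<^sub>m const_mat B - const_mat (A * B)"
    using assms(1-4) unfolding pencil_def by (simp add: mat_algebra const_mat_mult left_mult_one_mat')
  moreover have "const_mat B * pencil T = [:0,1:] \<cdot>\<^sub>m const_mat B - const_mat (B * T)"
    using assms(1-4) unfolding pencil_def by (simp add: mat_algebra const_mat_mult right_mult_one_mat')
  ultimately show ?thesis by (simp only: assms(5))
qed

lemma left_cancel_mat:
  fixes M Y :: "'a :: idom mat"
  assumes M: "M \<in> carrier_mat n n" "det M \<noteq> 0" and Y: "Y \<in> carrier_mat n k" and 0: "M * Y = 0\<^sub>m n k"
  shows "Y = 0\<^sub>m n k"
proof -
  have "adj_mat M * (M * Y) = (adj_mat M * M) * Y" using adj_mat(1)[OF M(1)] M(1) Y by (intro mat_assoc[symmetric]) auto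
  hence "det M \<cdot>\<^sub>m Y = 0\<^sub>m n k" unfolding adj_mat(3)[OF M(1)] 0 using adj_mat[OF M(1)] Y by (simp add: mat_algebra)
  hence "det M * Y $$ (i,j) = 0" if "i < n" "j < k" for i j
    using that Y by (metis carrier_matD index_smult_mat(1) index_zero_mat(1))
  thus ?thesis using M(2) Y by (intro eq_matI) auto
qed

lemma right_cancel_mat:
  fixes M Y :: "'a :: idom mat"
  assumes M: "M \<in> carrier_mat n n" "det M \<noteq> 0" and Y: "Y \<in> carrier_mat k n" and 0: "Y * M = 0\<^sub>m k n"
  shows "Y = 0\<^sub>m k n"
proof -
  have "(Y * M) * adj_mat M = Y * (M * adj_mat M)" using adj_mat(1)[OF M(1)] M(1) Y by (intro mat_assoc) auto
  hence "det M \<cdot>\<^sub>m Y = 0\<^sub>m k n" unfolding adj_mat(2)[OF M(1)] 0 using adj_mat[OF M(1)] Y by (simp add: mat_algebra)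
  hence "det M * Y $$ (i,j) = 0" if "i < k" "j < n" for i j
    using that Y by (metis carrier_matD index_smult_mat(1) index_zero_mat(1))
  thus ?thesis using M(2) Y by (intro eq_matI) auto
qed

lemma right_cancel_mat_eq:
  fixes M Y :: "'a :: idom mat"
  assumes M: "M \<in> carrier_mat n n" "det M \<noteq> 0" and Y: "Y \<in> carrier_mat k n" "Z \<in> carrier_mat k n" and eq: "Y * M = Z * M"
  shows "Y = Z"
proof -
  have "(Y - Z) * M = 0\<^sub>m k n" using M Y eq by (simp add: mat_algebra)
  from right_cancel_mat[OF M minus_carrier_mat[OF Y(2)] this]
  have 0: "Y - Z = 0\<^sub>m k n" .
  show ?thesis
  proof (rule eq_matI)
    fix i j assume ij: "i < dim_row Z" "j < dim_col Z"
    hence "(Y - Z) $$ (i,j) = 0" unfolding 0 using Y by simp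
    thus "Y $$ (i,j) = Z $$ (i,j)" using ij Y by simp
  qed (use Y in auto)
qed

lemma pCons_poly_shift: "p = pCons (coeff p 0) (poly_shift 1 p)"
  by (rule poly_eqI) (simp add: coeff_pCons coeff_poly_shift split: nat.split)

text \<open>Left division by the monic linear polynomial \<open>pencil T\<close>. In the induction
  \<open>Q = Q0 + z Q'\<close> with \<open>Q' = pencil T * Y + K\<close>, and
  \<open>z K = pencil T * K + T * K\<close> puts the constant \<open>T * K\<close> into the new
  remainder.\<close>

lemma left_remainder_exists:
  assumes T: "T \<in> carrier_mat n n" and Q: "Q \<in> carrier_mat n k"
  shows "\<exists>Y\<in>carrier_mat n k. \<exists>K\<in>carrier_mat n k. Q = pencil T * Y + const_mat K"
proof -
  have "\<exists>Y\<in>carrier_mat n k. \<exists>K\<in>carrier_mat n k. Q = pencil T * Y + const_mat K"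
    if "Q \<in> carrier_mat n k" "\<And>i j. i < n \<Longrightarrow> j < k \<Longrightarrow> degree (Q $$ (i,j)) \<le> d" for d Q
    using that
  proof (induction d arbitrary: Q)
    case 0
    have "Q = pencil T * 0\<^sub>m n k + const_mat (map_mat (\<lambda>p. coeff p 0) Q)"
      using 0 T by (intro eq_matI) (auto simp: degree_0_id elim!: degree_eq_zeroE)
    thus ?case using 0 by (intro bexI[of _ "0\<^sub>m n k"] bexI[of _ "map_mat (\<lambda>p. coeff p 0) Q"]) auto
  next
    case (Suc d)
    define Q' where "Q' = map_mat (poly_shift 1) Q"
    define Q0 where "Q0 = map_mat (\<lambda>p. coeff p 0) Q"
    have Q': "Q' \<in> carrier_mat n k" and Q0: "Q0 \<in> carrier_mat n k" using Suc(2) unfolding Q'_def Q0_def by auto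
    have "degree (Q' $$ (i,j)) \<le> d" if "i < n" "j < k" for i j
    proof (rule degree_le, intro allI impI)
      fix l assume "d < l"
      hence "degree (Q $$ (i,j)) < Suc l" using Suc(3)[OF that] by simp
      thus "coeff (Q' $$ (i,j)) l = 0" using that Suc(2)
        by (simp add: Q'_def coeff_poly_shift coeff_eq_0)
    qed
    from Suc.IH[OF Q' this] obtain Y K where YK: "Y \<in> carrier_mat n k" "K \<in> carrier_mat n k" "Q' = pencil T * Y + const_mat K" by blast
    have d[simp]: "dim_row Y = n" "dim_col Y = k" "dim_row K = n" "dim_col K = k" "dim_row Q0 = n" "dim_col Q0 = k" "dim_row T = n" "dim_col T = n"
      using YK Q0 T by auto
    have Qeq: "Q = const_mat Q0 + [:0,1:] \<cdot>\<^sub>m Q'"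
    proof (rule eq_matI)
      fix i j assume "i < dim_row (const_mat Q0 + [:0,1:] \<cdot>\<^sub>m Q')" "j < dim_col (const_mat Q0 + [:0,1:] \<cdot>\<^sub>m Q')"
      hence ij: "i < n" "j < k" using Q' by auto
      have "Q $$ (i,j) = pCons (coeff (Q $$ (i,j)) 0) (poly_shift 1 (Q $$ (i,j)))" by (rule pCons_poly_shift)
      thus "Q $$ (i,j) = (const_mat Q0 + [:0,1:] \<cdot>\<^sub>m Q') $$ (i,j)"
        using ij Suc(2) by (simp add: Q'_def Q0_def)
    qed (use Suc(2) Q' in auto)
    have zK: "[:0,1:] \<cdot>\<^sub>m const_mat K = pencil T * const_mat K + const_mat (T * K)"
      unfolding pencil_def by (simp add: mat_algebra const_mat_mult left_mult_one_mat') (intro eq_matI, auto)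
    have "Q = pencil T * ([:0,1:] \<cdot>\<^sub>m Y + const_mat K) + const_mat (Q0 + T * K)"
    proof -
      have "[:0,1:] \<cdot>\<^sub>m Q' = pencil T * ([:0,1:] \<cdot>\<^sub>m Y) + ([:0,1:] \<cdot>\<^sub>m const_mat K)" unfolding YK(3)
        by (simp add: mat_algebra) (intro eq_matI, auto simp: algebra_simps)
      hence "Q = const_mat Q0 + (pencil T * ([:0,1:] \<cdot>\<^sub>m Y) + (pencil T * const_mat K + const_mat (T * K)))" unfolding Qeq zK by simp
      thus ?thesis by (simp add: mat_algebra const_mat_add) (intro eq_matI, auto simp: algebra_simps)
    qed
    thus ?case by (intro bexI[of _ "[:0,1:] \<cdot>\<^sub>m Y + const_mat K"] bexI[of _ "Q0 + T * K"]) (use YK Q0 T in auto)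
  qed
  from this[OF Q, of "\<Sum>i<n. \<Sum>j<k. degree (Q $$ (i,j))"] show ?thesis
  proof -
    have "degree (Q $$ (i,j)) \<le> (\<Sum>i<n. \<Sum>j<k. degree (Q $$ (i,j)))" if "i < n" "j < k" for i j
    proof -
      have "degree (Q $$ (i,j)) \<le> (\<Sum>j<k. degree (Q $$ (i,j)))" using that by (intro member_le_sum) auto
      also have "\<dots> \<le> (\<Sum>i<n. \<Sum>j<k. degree (Q $$ (i,j)))" using that
        by (intro member_le_sum[of i "{..<n}" "\<lambda>i. \<Sum>j<k. degree (Q $$ (i,j))"]) auto
      finally show ?thesis .
    qed
    thus ?thesis using \<open>(\<And>i j. i < n \<Longrightarrow> j < k \<Longrightarrow> degree (Q $$ (i,j)) \<le> (\<Sum>i<n. \<Sum>j<k. degree (Q $$ (i,j)))) \<Longrightarrow> \<exists>Y\<in>carrier_mat n k. \<exists>K\<in>carrier_mat n k. Q = pencil T * Y + const_mat K\<close> by blast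
  qed
qed

text \<open>Compare determinants in \<open>[zI - T, \<kappa>; 0, I] [P, - Y; R, G] = [I, 0; R, G]\<close>.\<close>

lemma char_poly_dvd_det:
  assumes T: "T \<in> carrier_mat d d" and \<kappa>: "\<kappa> \<in> carrier_mat d p" and G: "G \<in> carrier_mat p p"
    and Y: "Y \<in> carrier_mat d p" and P: "P \<in> carrier_mat d d" and R: "R \<in> carrier_mat p d"
    and eq: "const_mat \<kappa> * G = pencil T * Y" and unit: "pencil T * P + const_mat \<kappa> * R = 1\<^sub>m d"
  shows "char_poly T dvd det G"
proof -
  define L where "L = four_block_mat (pencil T) (const_mat \<kappa>) (0\<^sub>m p d) (1\<^sub>m p)"
  define W where "W = four_block_mat P (- Y) R G"
  have L: "L \<in> carrier_mat (d+p) (d+p)" and W: "W \<in> carrier_mat (d+p) (d+p)"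
    unfolding L_def W_def using T G P by auto
  have "L * W = four_block_mat (pencil T * P + const_mat \<kappa> * R) (pencil T * (- Y) + const_mat \<kappa> * G) (0\<^sub>m p d * P + 1\<^sub>m p * R) (0\<^sub>m p d * (- Y) + 1\<^sub>m p * G)"
    unfolding L_def W_def
    by (rule mult_four_block_mat[of _ d d _ p _ p _ _ d _ p]) (use T \<kappa> G Y P R in auto)
  also have "pencil T * (- Y) + const_mat \<kappa> * G = 0\<^sub>m d p"
  proof -
    have "pencil T * (- Y) = - (pencil T * Y)" using T Y by simp
    moreover have "pencil T * Y \<in> carrier_mat d p" using T Y by (intro mult_carrier_mat[of _ d d] pencil_carrier)
    ultimately show ?thesis unfolding eq by simp
  qed
  also have "0\<^sub>m p d * P + 1\<^sub>m p * R = R" using P R by simp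
  also have "0\<^sub>m p d * (- Y) + 1\<^sub>m p * G = G"
  proof -
    have "- 0\<^sub>m p p + G = G" using G by (intro eq_matI) auto
    thus ?thesis using Y G by simp
  qed
  finally have LW: "L * W = four_block_mat (1\<^sub>m d) (0\<^sub>m d p) R G" unfolding unit .
  have "det L * det W = det (L * W)" using det_mult[OF L W] by simp
  also have "\<dots> = det (1\<^sub>m d) * det G" unfolding LW
    by (rule det_four_block_mat_upper_right_zero[of _ d _ p]) (use R G in auto)
  also have "det L = det (pencil T) * det (1\<^sub>m p)" unfolding L_def
    by (rule det_four_block_mat_lower_left_zero[of _ d _ p]) (use T \<kappa> in auto)
  finally have "char_poly T * det W = det G" using det_pencil[OF T] by simp
  thus ?thesis by (metis dvd_triv_left)
qed

text \<open>The entries of the adjugate are, up to sign, minors of order \<open>r\<close> of a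
  matrix of polynomials of degree at most 1. This is the degree gap that makes the resolvent of
  \<open>A\<close> strictly proper.\<close>

lemma degree_adj_pencil_le:
  assumes A: "A \<in> carrier_mat (Suc r) (Suc r)" and ij: "i < Suc r" "j < Suc r"
  shows "degree (adj_mat (pencil A) $$ (i,j)) \<le> r"
proof -
  have zA: "pencil A \<in> carrier_mat (Suc r) (Suc r)" using A by simp
  have deg1: "degree (pencil A $$ (a,b)) \<le> 1" if "a < Suc r" "b < Suc r" for a b
    using that A by (auto simp: pencil_def intro!: degree_diff_le)
  have "degree (det (mat_delete (pencil A) j i)) \<le> 1 * r"
  proof (rule degree_det_le)
    show "mat_delete (pencil A) j i \<in> carrier_mat r r" using zA by (rule mat_delete_carrier[of _ "Suc r" "Suc r", simplified])
    show "degree (mat_delete (pencil A) j i $$ (a,b)) \<le> 1" if "a < r" "b < r" for a b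
      using that A ij deg1 by (auto simp: mat_delete_def)
  qed
  moreover have "degree ((-1) ^ (j + i) * q) = degree q" for q :: "complex poly"
    by (cases "even (j + i)") auto
  ultimately show ?thesis using A ij by (simp add: adj_mat_def cofactor_def)
qed

text \<open>By hypothesis the strictly proper rational matrix
  \<open>\<gamma> (zI - A)^-1 \<kappa>\<close> equals the polynomial matrix \<open>W\<close>. A
  nonzero entry of \<open>W\<close> would give the numerator at least the degree of
  \<open>char_poly A\<close>.\<close>

lemma strictly_proper_multiple_zero:
  assumes A: "A \<in> carrier_mat r r" and \<gamma>: "\<gamma> \<in> carrier_mat p r" and \<kappa>: "\<kappa> \<in> carrier_mat r q"
    and W: "W \<in> carrier_mat p q"
    and eq: "const_mat \<gamma> * (adj_mat (pencil A) * const_mat \<kappa>) = char_poly A \<cdot>\<^sub>m W"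
  shows "const_mat \<gamma> * (adj_mat (pencil A) * const_mat \<kappa>) = 0\<^sub>m p q" "W = 0\<^sub>m p q"
proof -
  have W0: "W $$ (i,j) = 0" if ij: "i < p" "j < q" for i j
  proof (rule ccontr)
    assume nz: "W $$ (i,j) \<noteq> 0"
    have aj: "adj_mat (pencil A) \<in> carrier_mat r r" using adj_mat[of "pencil A" r] A by simp
    have e: "char_poly A * W $$ (i,j) = (\<Sum>a<r. \<Sum>b<r. [:\<gamma> $$ (i,a):] * (adj_mat (pencil A) $$ (a,b) * [:\<kappa> $$ (b,j):]))"
    proof -
      have "char_poly A * W $$ (i,j) = (const_mat \<gamma> * (adj_mat (pencil A) * const_mat \<kappa>)) $$ (i,j)" unfolding eq using W ij by simp
      also have "\<dots> = (\<Sum>a<r. const_mat \<gamma> $$ (i,a) * (adj_mat (pencil A) * const_mat \<kappa>) $$ (a,j))"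
        using \<gamma> \<kappa> aj ij by (subst mult_entry) auto
      also have "\<dots> = (\<Sum>a<r. [:\<gamma> $$ (i,a):] * (\<Sum>b<r. adj_mat (pencil A) $$ (a,b) * [:\<kappa> $$ (b,j):]))"
        by (rule sum.cong) (use \<gamma> \<kappa> aj ij in \<open>auto simp: mult_entry simp del: index_mult_mat(1)\<close>)
      finally show ?thesis by (simp add: sum_distrib_left)
    qed
    show False
    proof (cases r)
      \<comment> \<open>For \<open>r = 0\<close> the characteristic polynomial is constant and there
        is no degree gap, but the numerator is an empty sum.\<close>
      case 0
      thus False using e nz char_poly_nonzero[OF A] by simp
    next
      case (Suc r')
      have "degree (char_poly A * W $$ (i,j)) \<le> r'" unfolding e
      proof (intro degree_sum_le finite_lessThan)
        fix a b assume ab: "a \<in> {..<r}" "b \<in> {..<r}"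
        have "degree (adj_mat (pencil A) $$ (a,b)) \<le> r'" using degree_adj_pencil_le[of A r' a b] A ab Suc by simp
        thus "degree ([:\<gamma> $$ (i,a):] * (adj_mat (pencil A) $$ (a,b) * [:\<kappa> $$ (b,j):])) \<le> r'"
            using degree_mult_le[of "[:\<gamma> $$ (i,a):]" "adj_mat (pencil A) $$ (a,b) * [:\<kappa> $$ (b,j):]"]
            degree_mult_le[of "adj_mat (pencil A) $$ (a,b)" "[:\<kappa> $$ (b,j):]"] by simp
      qed
      moreover have "degree (char_poly A * W $$ (i,j)) \<ge> degree (char_poly A)"
        using nz char_poly_nonzero[OF A] by (simp add: degree_mult_eq)
      moreover have "degree (char_poly A) = Suc r'" using degree_monic_char_poly[OF A] Suc by simp
      ultimately show False by simp
    qed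
  qed
  show "W = 0\<^sub>m p q" using W0 W by (intro eq_matI) auto
  thus "const_mat \<gamma> * (adj_mat (pencil A) * const_mat \<kappa>) = 0\<^sub>m p q" unfolding eq by (auto intro!: eq_matI)
qed

text \<open>Let \<open>J\<close> be the adjugate of \<open>pencil A\<close>. If
  \<open>\<gamma> J \<kappa> = 0\<close>, then sandwiching \<open>J * pencil A\<close>, which is
  \<open>char_poly A\<close> times the identity, gives
  \<open>\<gamma> J A \<kappa> = - char_poly A \<gamma> \<kappa>\<close>. Strict properness makes
  both sides vanish, and the argument repeats with \<open>A * \<kappa>\<close> in place of
  \<open>\<kappa>\<close>.\<close>

lemma unobservable_of_resolvent_zero:
  assumes A: "A \<in> carrier_mat r r" and \<gamma>: "\<gamma> \<in> carrier_mat p r" and \<kappa>: "\<kappa> \<in> carrier_mat r q"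
    and 0: "const_mat \<gamma> * (adj_mat (pencil A) * const_mat \<kappa>) = 0\<^sub>m p q"
  shows "\<gamma> * (((*) A ^^ k) \<kappa>) = 0\<^sub>m p q"
proof -
  have aj: "adj_mat (pencil A) \<in> carrier_mat r r" "adj_mat (pencil A) * pencil A = char_poly A \<cdot>\<^sub>m 1\<^sub>m r"
    using adj_mat[of "pencil A" r] A det_pencil[OF A] by auto
  have d[simp]: "dim_row A = r" "dim_col A = r" "dim_row \<gamma> = p" "dim_col \<gamma> = r"
    "dim_row (adj_mat (pencil A)) = r" "dim_col (adj_mat (pencil A)) = r" using A \<gamma> aj by auto
  have step: "\<gamma> * \<kappa> = 0\<^sub>m p q \<and> const_mat \<gamma> * (adj_mat (pencil A) * const_mat (A * \<kappa>)) = 0\<^sub>m p q"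
    if \<kappa>: "\<kappa> \<in> carrier_mat r q" and 0: "const_mat \<gamma> * (adj_mat (pencil A) * const_mat \<kappa>) = 0\<^sub>m p q" for \<kappa>
  proof -
    have [simp]: "dim_row \<kappa> = r" "dim_col \<kappa> = q" using \<kappa> by auto
    have "char_poly A \<cdot>\<^sub>m const_mat (\<gamma> * \<kappa>) = const_mat \<gamma> * ((adj_mat (pencil A) * pencil A) * const_mat \<kappa>)"
      unfolding aj by (simp add: mat_algebra const_mat_mult left_mult_one_mat')
    also have "\<dots> = const_mat \<gamma> * (adj_mat (pencil A) * (pencil A * const_mat \<kappa>))" by (simp add: mat_algebra)
    also have "pencil A * const_mat \<kappa> = [:0,1:] \<cdot>\<^sub>m const_mat \<kappa> - const_mat (A * \<kappa>)"
      by (simp add: pencil_def mat_algebra const_mat_mult left_mult_one_mat')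
    also have "const_mat \<gamma> * (adj_mat (pencil A) * ([:0,1:] \<cdot>\<^sub>m const_mat \<kappa> - const_mat (A * \<kappa>))) =
       [:0,1:] \<cdot>\<^sub>m (const_mat \<gamma> * (adj_mat (pencil A) * const_mat \<kappa>)) - const_mat \<gamma> * (adj_mat (pencil A) * const_mat (A * \<kappa>))"
      by (simp add: mat_algebra)
    finally have e: "char_poly A \<cdot>\<^sub>m const_mat (\<gamma> * \<kappa>) = 0\<^sub>m p q - const_mat \<gamma> * (adj_mat (pencil A) * const_mat (A * \<kappa>))"
      unfolding 0 by simp
    have "const_mat \<gamma> * (adj_mat (pencil A) * const_mat (A * \<kappa>)) = char_poly A \<cdot>\<^sub>m (- const_mat (\<gamma> * \<kappa>))"
    proof (rule eq_matI)
      fix i j assume "i < dim_row (char_poly A \<cdot>\<^sub>m (- const_mat (\<gamma> * \<kappa>)))" "j < dim_col (char_poly A \<cdot>\<^sub>m (- const_mat (\<gamma> * \<kappa>)))"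
      thus "(const_mat \<gamma> * (adj_mat (pencil A) * const_mat (A * \<kappa>))) $$ (i,j) = (char_poly A \<cdot>\<^sub>m (- const_mat (\<gamma> * \<kappa>))) $$ (i,j)"
        using arg_cong[OF e, of "\<lambda>M. M $$ (i,j)"] by (simp del: index_mult_mat(1))
    qed auto
    from strictly_proper_multiple_zero[OF A \<gamma> _ _ this, of q]
    have "const_mat \<gamma> * (adj_mat (pencil A) * const_mat (A * \<kappa>)) = 0\<^sub>m p q" "- const_mat (\<gamma> * \<kappa>) = 0\<^sub>m p q"
      using A \<kappa> \<gamma> by auto
    moreover from this(2) have "\<gamma> * \<kappa> = 0\<^sub>m p q"
    proof (intro eq_matI)
      fix i j assume e: "- const_mat (\<gamma> * \<kappa>) = 0\<^sub>m p q" and ij: "i < dim_row (0\<^sub>m p q :: complex mat)" "j < dim_col (0\<^sub>m p q :: complex mat)"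
      have "(- const_mat (\<gamma> * \<kappa>)) $$ (i,j) = 0" unfolding e using ij by simp
      thus "(\<gamma> * \<kappa>) $$ (i,j) = 0\<^sub>m p q $$ (i,j)" using ij by (simp del: index_mult_mat(1))
    qed auto
    ultimately show ?thesis by blast
  qed
  have "((*) A ^^ k) \<kappa> \<in> carrier_mat r q \<and> const_mat \<gamma> * (adj_mat (pencil A) * const_mat (((*) A ^^ k) \<kappa>)) = 0\<^sub>m p q"
    by (induction k) (use \<kappa> 0 step A in \<open>auto simp del: index_mult_mat(1)\<close>)
  thus ?thesis using step by blast
qed

section \<open>Zeros in a region, counted with multiplicity\<close>

lemma roots_in_superset:
  assumes "p \<noteq> 0" "finite T" "{z. poly p z = 0 \<and> z \<in> S} \<subseteq> T" "T \<subseteq> S"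
  shows "roots_in p S = (\<Sum>z\<in>T. Polynomial.order z p)"
  unfolding roots_in_def using assms by (intro sum.mono_neutral_left) (auto simp: order_root)

lemma roots_in_mult:
  assumes "p \<noteq> 0" "q \<noteq> 0"
  shows "roots_in (p * q) S = roots_in p S + roots_in q S"
proof -
  define T where "T = {z. poly (p * q) z = 0 \<and> z \<in> S}"
  have f: "finite T" unfolding T_def using poly_roots_finite[of "p * q"] assms by (auto intro: finite_subset)
  have "roots_in (p * q) S = (\<Sum>z\<in>T. Polynomial.order z (p * q))" "roots_in p S = (\<Sum>z\<in>T. Polynomial.order z p)" "roots_in q S = (\<Sum>z\<in>T. Polynomial.order z q)"
    by (rule roots_in_superset; use assms f in \<open>auto simp: T_def\<close>)+
  thus ?thesis using assms by (simp add: order_mult sum.distrib)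
qed

lemma roots_in_const: "c \<noteq> 0 \<Longrightarrow> roots_in [:c:] S = 0"
  unfolding roots_in_def by simp

lemma roots_in_smult: "c \<noteq> 0 \<Longrightarrow> p \<noteq> 0 \<Longrightarrow> roots_in (Polynomial.smult c p) S = roots_in p S"
  using roots_in_mult[of "[:c:]" p S] roots_in_const[of c S] by simp

lemma roots_in_linear: "roots_in [:-a,1:] S = (if a \<in> S then 1 else 0)"
proof -
  have "roots_in [:-a,1:] S = (\<Sum>z\<in>(if a \<in> S then {a} else {}). Polynomial.order z [:-a,1:])"
    by (rule roots_in_superset) (auto split: if_splits)
  thus ?thesis using order_power_n_n[of a 1] by simp
qed

lemma roots_in_linear_factors: "roots_in (\<Prod>a\<leftarrow>as. [:-a,1:]) S = length (filter (\<lambda>a. a \<in> S) as)"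
proof (induction as)
  case Nil
  show ?case using roots_in_const[of 1 S] by (simp add: one_pCons)
next
  case (Cons a as)
  have "(\<Prod>a\<leftarrow>as. [:-a,1:]) \<noteq> (0 :: complex poly)" by (auto simp: prod_list_zero_iff)
  thus ?case using Cons roots_in_mult[of "[:-a,1:]" "\<Prod>a\<leftarrow>as. [:-a,1:]" S] roots_in_linear[of a S] by simp
qed

lemma roots_in_partition:
  assumes "p \<noteq> 0" and "\<And>z. z \<in> S \<or> z \<in> T \<or> z \<in> V" and "S \<inter> T = {}" "S \<inter> V = {}" "T \<inter> V = {}"
  shows "roots_in p S + roots_in p T + roots_in p V = degree p"
proof -
  obtain as where as: "Polynomial.smult (lead_coeff p) (\<Prod>a\<leftarrow>as. [:-a,1:]) = p" "length as = degree p"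
    using fundamental_theorem_algebra_factorized[of p] by blast
  have c: "lead_coeff p \<noteq> 0" using assms by simp
  have nz: "(\<Prod>a\<leftarrow>as. [:-a,1:]) \<noteq> (0 :: complex poly)" by (auto simp: prod_list_zero_iff)
  have r: "roots_in p S = length (filter (\<lambda>a. a \<in> S) as)" for S
    using roots_in_smult[OF c nz, of S] unfolding as roots_in_linear_factors .
  have "length (filter (\<lambda>a. a \<in> S) as) + length (filter (\<lambda>a. a \<in> T) as) + length (filter (\<lambda>a. a \<in> V) as) = length as"
    using assms(2-5) by (induction as) auto
  thus ?thesis unfolding r as(2) .
qed

text \<open>Stated for lists of roots, where no sign \<open>(-1)^n\<close> occurs; a triangular form
  of \<open>A\<close> is negated.\<close>

lemma char_poly_uminus:
  fixes A :: "complex mat"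
  assumes A: "A \<in> carrier_mat n n" and as: "char_poly A = (\<Prod>a\<leftarrow>as. [:-a,1:])"
  shows "char_poly (- A) = (\<Prod>a\<leftarrow>map uminus as. [:-a,1:])"
proof -
  obtain T P Q where sch: "schur_decomposition A as = (T,P,Q)" by (cases "schur_decomposition A as") auto
  from schur_decomposition[OF A as sch] have sim: "similar_mat_wit A T P Q" and ut: "upper_triangular T"
    and dg: "diag_mat T = as" by auto
  from similar_mat_witD2[OF A sim] have w: "P * Q = 1\<^sub>m n" "Q * P = 1\<^sub>m n" "A = P * T * Q"
    "T \<in> carrier_mat n n" "P \<in> carrier_mat n n" "Q \<in> carrier_mat n n" by auto
  have "similar_mat (- A) (- T)"
  proof (rule similar_matI)
    show "- A = P * (- T) * Q" using w by simp
  qed (use w A in auto)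
  hence "char_poly (- A) = char_poly (- T)" by (rule char_poly_similar)
  also have "\<dots> = (\<Prod>a\<leftarrow>diag_mat (- T). [:-a,1:])"
    by (rule char_poly_upper_triangular[of _ n]) (use w ut in \<open>auto simp: upper_triangular_def\<close>)
  also have "diag_mat (- T) = map uminus as" unfolding dg[symmetric] diag_mat_def using w(4) by auto
  finally show ?thesis .
qed

section \<open>Kernel splitting, inertia and coprime fractions\<close>

lemma cadj_mult_self_zero:
  assumes "G \<in> carrier_mat n k" "cadj G * G = 0\<^sub>m k k"
  shows "G = 0\<^sub>m n k"
proof (rule eq_matI)
  fix i j assume "i < dim_row (0\<^sub>m n k :: complex mat)" "j < dim_col (0\<^sub>m n k :: complex mat)"
  hence ij: "i < n" "j < k" by auto
  have "(cadj G * G) $$ (j,j) = (\<Sum>i<n. cnj (G $$ (i,j)) * G $$ (i,j))"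
    using assms(1) ij by (subst mult_entry) auto
  hence "(\<Sum>i<n. cnj (G $$ (i,j)) * G $$ (i,j)) = 0" unfolding assms(2) using ij by simp
  moreover have "(\<Sum>i<n. cnj (G $$ (i,j)) * G $$ (i,j)) = of_real (\<Sum>i<n. (cmod (G $$ (i,j)))\<^sup>2)"
    unfolding of_real_sum by (intro sum.cong refl) (simp add: complex_norm_square mult.commute del: of_real_power)
  ultimately have "(\<Sum>i<n. (cmod (G $$ (i,j)))\<^sup>2) = 0" by (simp del: of_real_sum)
  hence "(cmod (G $$ (i,j)))\<^sup>2 = 0" using ij by (subst (asm) sum_nonneg_eq_0_iff) auto
  thus "G $$ (i,j) = 0\<^sub>m n k $$ (i,j)" using ij by simp
qed (use assms in auto)

lemma sum_lessThan_plus: "(\<Sum>k<d+r. f k) = (\<Sum>k<d. f k) + (\<Sum>k<r. f (d + k :: nat) :: 'a :: comm_monoid_add)"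
  by (induction r) (auto simp: add.assoc)

text \<open>\<open>U1\<close> and \<open>U2\<close> are the leading and trailing columns of a
  unitary diagonalizer whose eigenvalue list starts with the zeros; they are orthonormal bases of
  the kernel and of the range of \<open>X\<close>.\<close>

lemma hermitian_kernel_split:
  assumes X: "X \<in> carrier_mat N N" "cadj X = X" and es: "char_poly X = (\<Prod>a\<leftarrow>es. [:-a,1:])"
  obtains d r U1 U2 fs where "N = d + r" "fs = filter (\<lambda>e. e \<noteq> 0) es" "length fs = r" "\<And>e. e \<in> set fs \<Longrightarrow> Im e = 0 \<and> Re e \<noteq> 0"
    "U1 \<in> carrier_mat N d" "U2 \<in> carrier_mat N r"
    "cadj U1 * U1 = 1\<^sub>m d" "cadj U2 * U2 = 1\<^sub>m r" "cadj U2 * U1 = 0\<^sub>m r d"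
    "U1 * cadj U1 + U2 * cadj U2 = 1\<^sub>m N" "X * U1 = 0\<^sub>m N d" "X * U2 = U2 * list_diag fs"
proof -
  define fs where "fs = filter (\<lambda>e. e \<noteq> 0) es"
  define zs where "zs = filter (\<lambda>e. \<not> e \<noteq> 0) es"
  define gs where "gs = zs @ fs"
  define d where "d = length zs"
  define r where "r = length fs"
  have "mset gs = mset es" unfolding gs_def zs_def fs_def by (simp add: multiset_partition[symmetric] add.commute)
  hence gs: "char_poly X = (\<Prod>a\<leftarrow>gs. [:-a,1:])" unfolding es by (metis mset_map prod_mset_prod_list)
  obtain W where W: "W \<in> carrier_mat N N" "cadj W * W = 1\<^sub>m N" "W * cadj W = 1\<^sub>m N" "cadj W * (X * W) = list_diag gs"
    using hermitian_diagonalize[OF X gs] by blast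
  have d[simp]: "dim_row X = N" "dim_col X = N" "dim_row W = N" "dim_col W = N" using X W by auto
  have len: "length gs = N" using arg_cong[OF W(4), of dim_row] by simp
  have N: "N = d + r" using len unfolding gs_def d_def r_def by simp
  have XW: "X * W = W * list_diag gs"
  proof -
    have "W * (cadj W * (X * W)) = (W * cadj W) * (X * W)" by (simp add: mat_algebra)
    thus ?thesis unfolding W(3,4) by (simp add: left_mult_one_mat')
  qed
  have hd: "cadj (list_diag gs) = list_diag gs" unfolding W(4)[symmetric] by (simp add: cadj_mult X mat_algebra)
  have real: "Im e = 0" if "e \<in> set gs" for e
  proof -
    obtain i where i: "i < length gs" "gs ! i = e" using \<open>e \<in> set gs\<close> by (auto simp: in_set_conv_nth)
    have "cnj e = e" using arg_cong[OF hd, of "\<lambda>A. A $$ (i,i)"] i by (simp add: list_diag_def)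
    thus ?thesis by (simp add: complex_eq_iff)
  qed
  have gsn: "gs ! (d + j) = fs ! j" if "j < r" for j using that unfolding gs_def d_def by (simp add: nth_append)
  have gsz: "gs ! j = 0" if "j < d" for j
  proof -
    have "gs ! j \<in> set zs" using that unfolding gs_def d_def by (simp add: nth_append)
    thus ?thesis unfolding zs_def by auto
  qed
  define U1 where "U1 = mat N d (\<lambda>(i,j). W $$ (i,j))"
  define U2 where "U2 = mat N r (\<lambda>(i,j). W $$ (i,d+j))"
  have dU[simp]: "dim_row U1 = N" "dim_col U1 = d" "dim_row U2 = N" "dim_col U2 = r" unfolding U1_def U2_def by auto
  have i1: "U1 $$ (i,j) = W $$ (i,j)" if "i < N" "j < d" for i j using that unfolding U1_def by simp
  have i2: "U2 $$ (i,j) = W $$ (i,d+j)" if "i < N" "j < r" for i j using that unfolding U2_def by simp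
  have WW: "(\<Sum>k<N. cnj (W $$ (k,i)) * W $$ (k,j)) = (if i = j then 1 else 0)" if "i < N" "j < N" for i j
  proof -
    have "(cadj W * W) $$ (i,j) = (\<Sum>k<N. cnj (W $$ (k,i)) * W $$ (k,j))" using that by (subst mult_entry) auto
    thus ?thesis unfolding W(2) using that by simp
  qed
  have WX: "(\<Sum>k<N. X $$ (i,k) * W $$ (k,j)) = W $$ (i,j) * gs ! j" if "i < N" "j < N" for i j
  proof -
    have "(\<Sum>k<N. X $$ (i,k) * W $$ (k,j)) = (X * W) $$ (i,j)" using that by (subst mult_entry) auto
    also have "\<dots> = (\<Sum>k<N. W $$ (i,k) * list_diag gs $$ (k,j))" unfolding XW using that len by (subst mult_entry) auto
    also have "\<dots> = (\<Sum>k<N. if k = j then W $$ (i,j) * gs ! j else 0)"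
      by (rule sum.cong) (use that len in \<open>auto simp: list_diag_def\<close>)
    finally show ?thesis using that by (simp add: sum.delta)
  qed
  show thesis
  proof (rule that[OF N fs_def])
    show "length fs = r" unfolding r_def ..
    show "Im e = 0 \<and> Re e \<noteq> 0" if "e \<in> set fs" for e
      using real[of e] that unfolding gs_def fs_def by (auto simp: complex_eq_iff)
    show "U1 \<in> carrier_mat N d" "U2 \<in> carrier_mat N r" by (auto intro!: carrier_matI)
    show "cadj U1 * U1 = 1\<^sub>m d"
      by (rule eq_matI) (use N WW in \<open>auto simp: mult_entry i1 simp del: index_mult_mat(1)\<close>)
    show "cadj U2 * U2 = 1\<^sub>m r"
      by (rule eq_matI) (use N WW in \<open>auto simp: mult_entry i2 simp del: index_mult_mat(1)\<close>)
    show "cadj U2 * U1 = 0\<^sub>m r d"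
      by (rule eq_matI) (use N WW in \<open>auto simp: mult_entry i1 i2 simp del: index_mult_mat(1)\<close>)
    show "X * U1 = 0\<^sub>m N d"
      by (rule eq_matI) (use N WX gsz in \<open>auto simp: mult_entry i1 simp del: index_mult_mat(1)\<close>)
    show "X * U2 = U2 * list_diag fs"
    proof (rule eq_matI)
      fix i j assume "i < dim_row (U2 * list_diag fs)" "j < dim_col (U2 * list_diag fs)"
      hence ij: "i < N" "j < r" by (auto simp: r_def)
      have "(U2 * list_diag fs) $$ (i,j) = (\<Sum>k<r. U2 $$ (i,k) * list_diag fs $$ (k,j))" using ij by (subst mult_entry) (auto simp: r_def)
      also have "\<dots> = (\<Sum>k<r. if k = j then U2 $$ (i,j) * fs ! j else 0)"
        by (rule sum.cong) (use ij in \<open>auto simp: list_diag_def r_def\<close>)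
      also have "\<dots> = W $$ (i,d+j) * gs ! (d + j)" using ij gsn[of j] i2 by (simp add: sum.delta)
      also have "\<dots> = (X * U2) $$ (i,j)" using WX[of i "d+j"] ij N by (subst mult_entry) (auto simp: i2)
      finally show "(X * U2) $$ (i,j) = (U2 * list_diag fs) $$ (i,j)" ..
    qed (auto simp: r_def)
    show "U1 * cadj U1 + U2 * cadj U2 = 1\<^sub>m N"
    proof (rule eq_matI)
      fix i j assume "i < dim_row (1\<^sub>m N :: complex mat)" "j < dim_col (1\<^sub>m N :: complex mat)"
      hence ij: "i < N" "j < N" by auto
      have "(W * cadj W) $$ (i,j) = (\<Sum>k<d+r. W $$ (i,k) * cnj (W $$ (j,k)))" using ij N by (subst mult_entry) auto
      also have "\<dots> = (\<Sum>k<d. W $$ (i,k) * cnj (W $$ (j,k))) + (\<Sum>k<r. W $$ (i,d+k) * cnj (W $$ (j,d+k)))"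
        by (rule sum_lessThan_plus)
      also have "\<dots> = (U1 * cadj U1 + U2 * cadj U2) $$ (i,j)"
        using ij by (simp add: mult_entry i1 i2 del: index_mult_mat(1))
      finally show "(U1 * cadj U1 + U2 * cadj U2) $$ (i,j) = 1\<^sub>m N $$ (i,j)" unfolding W(3) by simp
    qed auto
  qed
qed

text \<open>The preceding bound applies to \<open>A\<close> and \<open>list_diag es\<close> and also
  to their negatives, which define the same form. In each list the two sign counts add up to
  \<open>n\<close>, so both inequalities are equalities.\<close>

lemma inertia_of_dissipative_pair:
  assumes A: "A \<in> carrier_mat n n" and as: "char_poly A = (\<Prod>a\<leftarrow>as. [:-a,1:])"
    and es: "length es = n" "\<And>e. e \<in> set es \<Longrightarrow> Im e = 0 \<and> Re e \<noteq> 0"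
    and dis: "\<And>u. u \<in> carrier_mat n 1 \<Longrightarrow> Im ((cadj u * (list_diag es * (A * u))) $$ (0,0)) \<ge> 0"
    and nonreal: "\<And>a. a \<in> set as \<Longrightarrow> Im a \<noteq> 0"
  shows "length (filter (\<lambda>a. Im a > 0) as) = length (filter (\<lambda>e. Re e > 0) es)"
    "length (filter (\<lambda>a. Im a < 0) as) = length (filter (\<lambda>e. Re e < 0) es)"
proof -
  have 1: "length (filter (\<lambda>a. Im a > 0) as) \<le> length (filter (\<lambda>e. Re e > 0) es)"
    by (rule upper_eigenvalues_le_positive[OF A as es dis])
  have dm: "list_diag (map uminus es) = - list_diag es" by (rule eq_matI) (auto simp: list_diag_def)
  have "length (filter (\<lambda>a. Im a > 0) (map uminus as)) \<le> length (filter (\<lambda>e. Re e > 0) (map uminus es))"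
  proof (rule upper_eigenvalues_le_positive[OF _ char_poly_uminus[OF A as]])
    fix u :: "complex mat" assume u: "u \<in> carrier_mat n 1"
    have "cadj u * (list_diag (map uminus es) * ((- A) * u)) = cadj u * (list_diag es * (A * u))"
      unfolding dm using A u es(1) by simp
    thus "Im ((cadj u * (list_diag (map uminus es) * ((- A) * u))) $$ (0,0)) \<ge> 0" using dis[OF u] by simp
  qed (use A es in auto)
  hence 2: "length (filter (\<lambda>a. Im a < 0) as) \<le> length (filter (\<lambda>e. Re e < 0) es)"
    by (simp add: filter_map o_def)
  have "degree (char_poly A) = length as" unfolding as by (subst degree_linear_factors) simp
  hence "length as = n" using degree_monic_char_poly[OF A] by simp
  moreover have "length (filter (\<lambda>a. Im a > 0) as) + length (filter (\<lambda>a. Im a < 0) as) = length as"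
    using nonreal by (induction as) (auto simp: neq_iff)
  moreover have "length (filter (\<lambda>e. Re e > 0) es) + length (filter (\<lambda>e. Re e < 0) es) = length es"
    using es(2) by (induction es) (auto simp: neq_iff)
  ultimately show "length (filter (\<lambda>a. Im a > 0) as) = length (filter (\<lambda>e. Re e > 0) es)"
    "length (filter (\<lambda>a. Im a < 0) as) = length (filter (\<lambda>e. Re e < 0) es)" using 1 2 es(1) by linarith+
qed

lemma obtain_eigencolumn:
  fixes A :: "complex mat"
  assumes A: "A \<in> carrier_mat n n" and a: "poly (char_poly A) a = 0"
  obtains w where "w \<in> carrier_mat n 1" "w \<noteq> 0\<^sub>m n 1" "A * w = a \<cdot>\<^sub>m w"
proof -
  have "eigenvalue A a" using eigenvalue_root_char_poly[OF A] a by simp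
  from unit_eigenvector[OF A this] obtain w where w: "w \<in> carrier_mat n 1" "cadj w * w = 1\<^sub>m 1" "A * w = a \<cdot>\<^sub>m w" by blast
  have "w \<noteq> 0\<^sub>m n 1"
  proof
    assume w0: "w = 0\<^sub>m n 1"
    have "cadj w * w = 0\<^sub>m 1 1" using w(1) unfolding w0 by simp
    hence "(1\<^sub>m 1 :: complex mat) $$ (0,0) = 0\<^sub>m 1 1 $$ (0,0)" unfolding w(2) by simp
    thus False by simp
  qed
  thus thesis using that w by blast
qed

lemma add_eq_zero_mat:
  fixes A B :: "'a :: ab_group_add mat"
  assumes "A + B = 0\<^sub>m n m" "A \<in> carrier_mat n m" "B \<in> carrier_mat n m"
  shows "A = - B"
proof (rule eq_matI)
  fix i j assume ij: "i < dim_row (- B)" "j < dim_col (- B)"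
  have "(A + B) $$ (i,j) = 0" unfolding assms(1) using ij assms by simp
  thus "A $$ (i,j) = (- B) $$ (i,j)" using ij assms(2,3) by (simp add: eq_neg_iff_add_eq_0)
qed (use assms in auto)

lemma minus_eq_zero_mat:
  fixes A B :: "'a :: ab_group_add mat"
  assumes "A - B = 0\<^sub>m n m" "A \<in> carrier_mat n m" "B \<in> carrier_mat n m"
  shows "A = B"
proof (rule eq_matI)
  fix i j assume ij: "i < dim_row B" "j < dim_col B"
  have "(A - B) $$ (i,j) = 0" unfolding assms(1) using ij assms by simp
  thus "A $$ (i,j) = B $$ (i,j)" using ij assms(2,3) by simp
qed (use assms in auto)

lemma smult_cancel_mat:
  fixes A B :: "'a :: idom mat"
  assumes "c \<cdot>\<^sub>m A = c \<cdot>\<^sub>m B" "c \<noteq> 0" "A \<in> carrier_mat n m" "B \<in> carrier_mat n m"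
  shows "A = B"
proof (rule eq_matI)
  fix i j assume ij: "i < dim_row B" "j < dim_col B"
  have "(c \<cdot>\<^sub>m A) $$ (i,j) = (c \<cdot>\<^sub>m B) $$ (i,j)" using assms(1) by simp
  thus "A $$ (i,j) = B $$ (i,j)" using ij assms(2-4) by simp
qed (use assms in auto)

text \<open>The hypotheses say that \<open>- M2 M^-1 = \<tau> / \<chi>\<close> and that
  \<open>w = - M2 M^-1 R1\<close> is polynomial. Since \<open>M1 = M - \<i> M2\<close>, also
  \<open>M1 M^-1 R1 = R1 + \<i> w\<close> is polynomial, and the Bezout identity recovers
  \<open>M^-1 R1\<close> from these two.\<close>

lemma left_fraction_factor:
  fixes M M1 M2 U V \<tau> :: "complex poly mat"
  assumes c: "M1 \<in> carrier_mat p p" "M2 \<in> carrier_mat p p" "U \<in> carrier_mat p p" "V \<in> carrier_mat p p"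
      "\<tau> \<in> carrier_mat p p" "w \<in> carrier_mat p q" "R1 \<in> carrier_mat p q"
    and M: "M = M1 + [:\<i>:] \<cdot>\<^sub>m M2" "det M \<noteq> 0" and chi: "\<chi> \<noteq> 0"
    and bez: "U * M1 + V * M2 = 1\<^sub>m p"
    and \<tau>: "\<tau> * M = \<chi> \<cdot>\<^sub>m (- M2)" and w: "\<tau> * R1 = \<chi> \<cdot>\<^sub>m w"
  shows "\<exists>r\<in>carrier_mat p q. R1 = M * r"
proof -
  have Mc: "M \<in> carrier_mat p p" unfolding M using c by auto
  note aj = adj_mat[OF Mc]
  \<comment> \<open>Stands for \<open>det M\<close> times \<open>M^-1 R1\<close>, which avoids
    fractions.\<close>
  define a where "a = adj_mat M * R1"
  have d[simp]: "dim_row M1 = p" "dim_col M1 = p" "dim_row M2 = p" "dim_col M2 = p" "dim_row U = p" "dim_col U = p"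
    "dim_row V = p" "dim_col V = p" "dim_row \<tau> = p" "dim_col \<tau> = p" "dim_row w = p" "dim_col w = q"
    "dim_row R1 = p" "dim_col R1 = q" "dim_row M = p" "dim_col M = p" "dim_row (adj_mat M) = p" "dim_col (adj_mat M) = p"
    "dim_row a = p" "dim_col a = q"
    using c Mc aj unfolding a_def by auto
  have Ma: "M * a = det M \<cdot>\<^sub>m R1"
  proof -
    have "M * a = (M * adj_mat M) * R1" unfolding a_def by (simp add: mat_assoc)
    thus ?thesis unfolding aj(2) by (simp add: mat_algebra left_mult_one_mat')
  qed
  have "(\<tau> * M) * a = \<tau> * (M * a)" by (simp add: mat_assoc)
  hence "\<chi> \<cdot>\<^sub>m (- (M2 * a)) = \<chi> \<cdot>\<^sub>m (det M \<cdot>\<^sub>m w)"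
    unfolding \<tau> Ma by (simp add: mat_algebra w) (intro eq_matI; simp add: w mult.left_commute del: index_mult_mat(1))
  hence "- (M2 * a) = det M \<cdot>\<^sub>m w" by (rule smult_cancel_mat[OF _ chi, where n = p and m = q]) (auto intro!: carrier_matI)
  hence M2a: "M2 * a = - (det M \<cdot>\<^sub>m w)" by (metis uminus_uminus_mat)
  have "M1 * a = M * a - [:\<i>:] \<cdot>\<^sub>m (M2 * a)"
    unfolding M by (simp add: mat_algebra) (intro eq_matI; simp del: index_mult_mat(1))
  also have "\<dots> = det M \<cdot>\<^sub>m (R1 + [:\<i>:] \<cdot>\<^sub>m w)"
    unfolding Ma M2a by (intro eq_matI) (auto simp: algebra_simps)
  finally have M1a: "M1 * a = det M \<cdot>\<^sub>m (R1 + [:\<i>:] \<cdot>\<^sub>m w)" .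
  define r where "r = U * (R1 + [:\<i>:] \<cdot>\<^sub>m w) - V * w"
  have r: "r \<in> carrier_mat p q" unfolding r_def by (intro carrier_matI) auto
  have "a = (U * M1 + V * M2) * a" unfolding bez by (simp add: left_mult_one_mat')
  also have "\<dots> = U * (M1 * a) + V * (M2 * a)" by (simp add: mat_algebra)
  also have "\<dots> = det M \<cdot>\<^sub>m r" unfolding M1a M2a r_def
    by (simp add: mat_algebra) (intro eq_matI; simp add: algebra_simps del: index_mult_mat(1))
  finally have ar: "a = det M \<cdot>\<^sub>m r" .
  have "det M \<cdot>\<^sub>m R1 = det M \<cdot>\<^sub>m (M * r)" unfolding Ma[symmetric] ar using r by (simp add: mat_algebra)
  hence "R1 = M * r" by (rule smult_cancel_mat[OF _ M(2), where n = p and m = q]) (use r in \<open>auto intro!: carrier_matI\<close>)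
  thus ?thesis using r by blast
qed

lemma funpow_mult_carrier: "A \<in> carrier_mat r r \<Longrightarrow> u \<in> carrier_mat r q \<Longrightarrow> ((*) A ^^ k) u \<in> carrier_mat r q"
  by (induction k) auto

section \<open>Realizations\<close>

lemma add_zero_mat_dim[simp]:
  fixes W :: "'a :: comm_monoid_add mat"
  assumes "dim_row W = n" "dim_col W = m"
  shows "W + 0\<^sub>m n m = W" "0\<^sub>m n m + W = W"
  using assms by (auto intro!: eq_matI)

text \<open>The characteristic polynomial of the restriction of \<open>A\<close> to the kernel of \<open>X\<close> divides \<open>det Fh\<close>, and that
  of the compression to the range of \<open>X\<close> divides \<open>det (M1 + \<i> M2)\<close>. By degrees both divisors are exact up to
  constants, and the inertia theorem applies to the compression.\<close>

lemma realization_root_count: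
  fixes A X \<beta> \<gamma> :: "complex mat"
  assumes A: "A \<in> carrier_mat N N" and X: "X \<in> carrier_mat N N" "cadj X = X"
    and \<beta>: "\<beta> \<in> carrier_mat N p" and \<gamma>: "\<gamma> \<in> carrier_mat p N"
    and lyap: "X * A - cadj A * X = (2 * \<i>) \<cdot>\<^sub>m (cadj \<gamma> * \<gamma>)"
    and obs: "\<And>u q. u \<in> carrier_mat N q \<Longrightarrow> (\<And>k. \<gamma> * ((*) A ^^ k) u = 0\<^sub>m p q) \<Longrightarrow> X * u = 0\<^sub>m N q"
    and Y: "Y \<in> carrier_mat N p" and P: "P \<in> carrier_mat N N" and R: "R \<in> carrier_mat p N"
    and \<Phi>: "\<Phi> \<in> carrier_mat p p" and Fh: "Fh \<in> carrier_mat p p"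
    and M1: "M1 \<in> carrier_mat p p" and M2: "M2 \<in> carrier_mat p p"
    and U: "U \<in> carrier_mat p p" and V: "V \<in> carrier_mat p p"
    and zY: "pencil A * Y = const_mat \<beta> * \<Phi>" and gY: "const_mat \<gamma> * Y = - (M2 * Fh)"
    and unit: "pencil A * P + const_mat \<beta> * R = 1\<^sub>m N"
    and \<Phi>_eq: "\<Phi> = (M1 + [:\<i>:] \<cdot>\<^sub>m M2) * Fh" and bez: "U * M1 + V * M2 = 1\<^sub>m p"
    and det\<Phi>: "det \<Phi> \<noteq> 0" "degree (det \<Phi>) \<le> N"
    and es: "char_poly X = (\<Prod>a\<leftarrow>es. [:-a,1:])"
  shows "roots_in (det \<Phi>) {z. Im z > 0} = length (filter (\<lambda>e. Re e > 0) es) + roots_in (det Fh) {z. Im z > 0}"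
    "roots_in (det \<Phi>) {z. Im z < 0} = length (filter (\<lambda>e. Re e < 0) es) + roots_in (det Fh) {z. Im z < 0}"
proof -
  obtain d r U1 U2 fs where N: "N = d + r" and fs: "fs = filter (\<lambda>e. e \<noteq> 0) es" "length fs = r"
    "\<And>e. e \<in> set fs \<Longrightarrow> Im e = 0 \<and> Re e \<noteq> 0"
    and U1: "U1 \<in> carrier_mat N d" and U2: "U2 \<in> carrier_mat N r"
    and u11: "cadj U1 * U1 = 1\<^sub>m d" and u22: "cadj U2 * U2 = 1\<^sub>m r" and u21: "cadj U2 * U1 = 0\<^sub>m r d"
    and uu: "U1 * cadj U1 + U2 * cadj U2 = 1\<^sub>m N" and XU1: "X * U1 = 0\<^sub>m N d" and XU2: "X * U2 = U2 * list_diag fs"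
    by (rule hermitian_kernel_split[OF X es]) (rule that)
  define D where "D = list_diag fs"
  have dD[simp]: "dim_row D = r" "dim_col D = r" using fs(2) by (auto simp: D_def)
  have hD: "cadj D = D" unfolding D_def by (rule list_diag_cadj) (use fs(3) in \<open>auto simp: complex_eq_iff\<close>)
  have dims[simp]: "dim_row A = N" "dim_col A = N" "dim_row X = N" "dim_col X = N" "dim_row \<beta> = N" "dim_col \<beta> = p"
    "dim_row \<gamma> = p" "dim_col \<gamma> = N" "dim_row Y = N" "dim_col Y = p" "dim_row P = N" "dim_col P = N" "dim_row R = p" "dim_col R = N"
    "dim_row \<Phi> = p" "dim_col \<Phi> = p" "dim_row Fh = p" "dim_col Fh = p" "dim_row M1 = p" "dim_col M1 = p" "dim_row M2 = p" "dim_col M2 = p"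
    "dim_row U1 = N" "dim_col U1 = d" "dim_row U2 = N" "dim_col U2 = r"
    using A X \<beta> \<gamma> Y P R \<Phi> Fh M1 M2 U1 U2 by auto
  define A1 where "A1 = cadj U1 * (A * U1)"
  define A4 where "A4 = cadj U2 * (A * U2)"
  have A1: "A1 \<in> carrier_mat d d" and A4: "A4 \<in> carrier_mat r r" unfolding A1_def A4_def by (auto intro!: carrier_matI)
  have dA[simp]: "dim_row A1 = d" "dim_col A1 = d" "dim_row A4 = r" "dim_col A4 = r" using A1 A4 by auto
  define \<beta>2 where "\<beta>2 = cadj U2 * \<beta>"
  define \<gamma>2 where "\<gamma>2 = \<gamma> * U2"
  have db[simp]: "dim_row \<beta>2 = r" "dim_col \<beta>2 = p" "dim_row \<gamma>2 = p" "dim_col \<gamma>2 = r" unfolding \<beta>2_def \<gamma>2_def by auto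
  have U2X: "cadj U2 * X = D * cadj U2"
    using arg_cong[OF XU2, of cadj] by (simp add: cadj_mult X D_def[symmetric] hD)
  have split_left: "W = U1 * (cadj U1 * W) + U2 * (cadj U2 * W)" if "dim_row W = N" for W
  proof -
    have "W = (U1 * cadj U1 + U2 * cadj U2) * W" unfolding uu using that by (simp add: left_mult_one_mat')
    thus ?thesis using that by (simp add: mat_algebra)
  qed
  \<comment> \<open>Between \<open>cadj U1\<close> and \<open>U1\<close> the left side of the
    Lyapunov identity vanishes, so the columns of \<open>\<gamma> * U1\<close> have norm
    zero.\<close>
  have \<gamma>U1: "\<gamma> * U1 = 0\<^sub>m p d"
  proof -
    have "cadj U1 * ((X * A - cadj A * X) * U1) = cadj (X * U1) * (A * U1) - cadj U1 * (cadj A * (X * U1))"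
      by (simp add: mat_algebra cadj_mult X)
    also have "\<dots> = 0\<^sub>m d d" unfolding XU1
    proof -
      have "cadj (0\<^sub>m N d) * (A * U1) = 0\<^sub>m d d" by (intro eq_matI) (auto simp: mult_entry simp del: index_mult_mat(1))
      thus "cadj (0\<^sub>m N d) * (A * U1) - cadj U1 * (cadj A * 0\<^sub>m N d) = 0\<^sub>m d d" by simp
    qed
    finally have "(2 * \<i>) \<cdot>\<^sub>m (cadj (\<gamma> * U1) * (\<gamma> * U1)) = (2 * \<i>) \<cdot>\<^sub>m 0\<^sub>m d d"
      unfolding lyap by (simp add: mat_algebra cadj_mult)
    hence z: "cadj (\<gamma> * U1) * (\<gamma> * U1) = 0\<^sub>m d d"
      by (rule smult_cancel_mat[where n = d and m = d]) (auto intro!: carrier_matI)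
    have "\<gamma> * U1 \<in> carrier_mat p d" by (intro carrier_matI) auto
    from cadj_mult_self_zero[OF this z] show ?thesis .
  qed
  \<comment> \<open>Applied to \<open>U1\<close>, the Lyapunov identity leaves only
    \<open>X * (A * U1)\<close>: the kernel of \<open>X\<close> is invariant under
    \<open>A\<close>.\<close>
  have XAU1: "X * (A * U1) = 0\<^sub>m N d"
  proof -
    have "(X * A - cadj A * X) * U1 = X * (A * U1) - cadj A * (X * U1)" by (simp add: mat_algebra)
    moreover have "(X * A - cadj A * X) * U1 = (2 * \<i>) \<cdot>\<^sub>m (cadj \<gamma> * (\<gamma> * U1))" unfolding lyap by (simp add: mat_algebra)
    ultimately have "X * (A * U1) - 0\<^sub>m N d = 0\<^sub>m N d" unfolding XU1 \<gamma>U1 by simp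
    thus ?thesis by (rule minus_eq_zero_mat) (auto intro!: carrier_matI)
  qed
  have Dc: "D \<in> carrier_mat r r" by (intro carrier_matI) auto
  have detD: "det D \<noteq> 0"
  proof
    assume "det D = 0"
    then obtain v where v: "v \<in> carrier_vec r" "v \<noteq> 0\<^sub>v r" "D *\<^sub>v v = 0\<^sub>v r"
      using det_0_iff_vec_prod_zero[OF Dc] by auto
    define y where "y = mat r 1 (\<lambda>(i,j). v $ i)"
    have "v $ i = 0" if i: "i < r" for i
    proof -
      have "(D *\<^sub>v v) $ i = (D * y) $$ (i,0)"
        using i v(1) by (simp add: scalar_prod_def y_def)
      also have "\<dots> = fs ! i * v $ i" unfolding D_def using i fs(2) by (subst list_diag_mult_entry) (auto simp: y_def)
      finally have "fs ! i * v $ i = 0" unfolding v(3) using i by simp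
      thus ?thesis using i fs(2) fs(3)[of "fs ! i"] by auto
    qed
    thus False using v by auto
  qed
  have U2AU1: "cadj U2 * (A * U1) = 0\<^sub>m r d"
  proof (rule left_cancel_mat[OF Dc detD])
    have "D * (cadj U2 * (A * U1)) = (D * cadj U2) * (A * U1)" by (simp add: mat_assoc)
    also have "\<dots> = cadj U2 * (X * (A * U1))" unfolding U2X[symmetric] by (simp add: mat_assoc)
    finally show "D * (cadj U2 * (A * U1)) = 0\<^sub>m r d" unfolding XAU1 by simp
  qed (auto intro!: carrier_matI)
  have AU1: "A * U1 = U1 * A1"
    using split_left[of "A * U1"] unfolding U2AU1 A1_def[symmetric] by simp
  have U2A: "cadj U2 * A = A4 * cadj U2"
  proof -
    have "cadj U2 * A = cadj U2 * (A * (U1 * cadj U1 + U2 * cadj U2))" unfolding uu by (simp add: right_mult_one_mat')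
    also have "\<dots> = (cadj U2 * (A * U1)) * cadj U1 + A4 * cadj U2" unfolding A4_def by (simp add: mat_algebra)
    finally show ?thesis unfolding U2AU1 by simp
  qed
  have \<gamma>_eq: "\<gamma> = \<gamma>2 * cadj U2"
  proof -
    have "\<gamma> = \<gamma> * (U1 * cadj U1 + U2 * cadj U2)" unfolding uu by (simp add: right_mult_one_mat')
    also have "\<dots> = (\<gamma> * U1) * cadj U1 + \<gamma>2 * cadj U2" unfolding \<gamma>2_def by (simp add: mat_algebra)
    finally show ?thesis unfolding \<gamma>U1 by simp
  qed
  \<comment> \<open>\<open>A4\<close> is \<open>A\<close> modulo the kernel of \<open>X\<close>, and
    \<open>\<gamma>\<close> vanishes on that kernel. An unobservable \<open>\<kappa>\<close> thus
    gives an unobservable \<open>U2 * \<kappa>\<close>, which lies both in the kernel and in the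
    range of \<open>X\<close> and is zero.\<close>
  have obs2: "\<kappa> = 0\<^sub>m r q" if \<kappa>: "\<kappa> \<in> carrier_mat r q" and 0: "\<And>k. \<gamma>2 * ((*) A4 ^^ k) \<kappa> = 0\<^sub>m p q" for \<kappa> q
  proof -
    have dk[simp]: "dim_row \<kappa> = r" "dim_col \<kappa> = q" using \<kappa> by auto
    define u where "u = U2 * \<kappa>"
    have u: "u \<in> carrier_mat N q" unfolding u_def by (intro carrier_matI) auto
    have it: "cadj U2 * ((*) A ^^ k) u = ((*) A4 ^^ k) \<kappa>" for k
    proof (induction k)
      case 0
      have "cadj U2 * u = (cadj U2 * U2) * \<kappa>" unfolding u_def by (simp add: mat_assoc)
      thus ?case unfolding u22 by (simp add: left_mult_one_mat')
    next
      case (Suc k)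
      have c: "((*) A ^^ k) u \<in> carrier_mat N q" by (rule funpow_mult_carrier[OF A u])
      have "cadj U2 * (A * ((*) A ^^ k) u) = (cadj U2 * A) * ((*) A ^^ k) u" using c by (simp add: mat_assoc)
      also have "\<dots> = A4 * (cadj U2 * ((*) A ^^ k) u)" unfolding U2A using c by (simp add: mat_assoc)
      finally show ?case unfolding Suc by simp
    qed
    have "\<gamma> * ((*) A ^^ k) u = 0\<^sub>m p q" for k
    proof -
      have c: "((*) A ^^ k) u \<in> carrier_mat N q" by (rule funpow_mult_carrier[OF A u])
      have "\<gamma> * ((*) A ^^ k) u = \<gamma>2 * (cadj U2 * ((*) A ^^ k) u)" using c by (subst \<gamma>_eq) (simp add: mat_assoc)
      thus ?thesis unfolding it 0 .
    qed
    from obs[OF u this] have Xu: "X * u = 0\<^sub>m N q" .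
    have "D * \<kappa> = (cadj U2 * U2) * (D * \<kappa>)" unfolding u22 by (simp add: left_mult_one_mat')
    also have "\<dots> = cadj U2 * ((U2 * D) * \<kappa>)" by (simp add: mat_assoc)
    also have "\<dots> = cadj U2 * (X * u)" unfolding D_def XU2[symmetric] u_def by (simp add: mat_assoc)
    finally have "D * \<kappa> = 0\<^sub>m r q" unfolding Xu by simp
    thus ?thesis by (rule left_cancel_mat[OF Dc detD \<kappa>])
  qed
  have DA4: "D * A4 = cadj U2 * (X * (A * U2))"
  proof -
    have "D * A4 = (D * cadj U2) * (A * U2)" unfolding A4_def by (simp add: mat_assoc)
    thus ?thesis unfolding U2X[symmetric] by (simp add: mat_assoc)
  qed
  have diss: "2 * Im ((cadj u * (D * (A4 * u))) $$ (0,0)) = 2 * Re ((cadj (\<gamma>2 * u) * (\<gamma>2 * u)) $$ (0,0))" if u: "u \<in> carrier_mat r 1" for u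
  proof -
    have du[simp]: "dim_row u = r" "dim_col u = 1" using u by auto
    define v where "v = U2 * u"
    have dv[simp]: "dim_row v = N" "dim_col v = 1" unfolding v_def by auto
    define q where "q = (cadj v * (X * (A * v))) $$ (0,0)"
    have e1: "cadj u * (D * (A4 * u)) = cadj v * (X * (A * v))"
    proof -
      have "cadj u * (D * (A4 * u)) = cadj u * ((D * A4) * u)" by (simp add: mat_assoc)
      thus ?thesis unfolding DA4 v_def by (simp add: mat_assoc cadj_mult)
    qed
    have "cnj q = (cadj (cadj v * (X * (A * v)))) $$ (0,0)" unfolding q_def by (simp del: index_mult_mat(1))
    also have "cadj (cadj v * (X * (A * v))) = cadj v * ((cadj A * X) * v)" by (simp add: cadj_mult X mat_assoc)
    finally have cq: "cnj q = (cadj v * ((cadj A * X) * v)) $$ (0,0)" .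
    have "q - cnj q = (cadj v * ((X * A - cadj A * X) * v)) $$ (0,0)" unfolding cq unfolding q_def
      by (simp add: mat_algebra del: index_mult_mat(1))
    also have "cadj v * ((X * A - cadj A * X) * v) = (2 * \<i>) \<cdot>\<^sub>m (cadj (\<gamma>2 * u) * (\<gamma>2 * u))"
      unfolding lyap \<gamma>2_def v_def by (simp add: mat_algebra cadj_mult)
    finally have "q - cnj q = 2 * \<i> * (cadj (\<gamma>2 * u) * (\<gamma>2 * u)) $$ (0,0)" by (simp del: index_mult_mat(1))
    from arg_cong[OF this, of Im] show ?thesis unfolding e1 q_def[symmetric] by simp
  qed
  obtain as where as: "char_poly A4 = (\<Prod>a\<leftarrow>as. [:-a,1:])" using char_poly_factorized[OF A4] by blast
  \<comment> \<open>For an eigenvector \<open>w\<close> with real eigenvalue the form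
    \<open>cadj w * (D * (A4 * w))\<close> is real, so \<open>diss\<close> gives
    \<open>\<gamma>2 * w = 0\<close>. The orbit of \<open>w\<close> consists of multiples of
    \<open>w\<close>, against observability.\<close>
  have nonreal: "Im a \<noteq> 0" if "a \<in> set as" for a
  proof
    assume im: "Im a = 0"
    have "poly (char_poly A4) a = 0" unfolding as poly_prod_list using that by (auto simp: prod_list_zero_iff)
    then obtain w where w: "w \<in> carrier_mat r 1" "w \<noteq> 0\<^sub>m r 1" "A4 * w = a \<cdot>\<^sub>m w" using obtain_eigencolumn[OF A4] by blast
    have dw[simp]: "dim_row w = r" "dim_col w = 1" using w by auto
    define q where "q = (cadj w * (D * w)) $$ (0,0)"
    have "cnj q = (cadj (cadj w * (D * w))) $$ (0,0)" unfolding q_def by (simp del: index_mult_mat(1))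
    hence "cnj q = q" unfolding q_def by (simp add: cadj_mult hD mat_assoc del: index_mult_mat(1))
    hence "Im q = 0" by (simp add: complex_eq_iff)
    moreover have "(cadj w * (D * (A4 * w))) $$ (0,0) = a * q" unfolding w(3) q_def by (simp add: mat_algebra del: index_mult_mat(1))
    ultimately have "Im ((cadj w * (D * (A4 * w))) $$ (0,0)) = 0" using im by simp
    with diss[OF w(1)] have "Re ((cadj (\<gamma>2 * w) * (\<gamma>2 * w)) $$ (0,0)) = 0" by simp
    hence s0: "(\<Sum>i<p. (cmod ((\<gamma>2 * w) $$ (i,0)))\<^sup>2) = 0" using cadj_mult_self_entry[of "\<gamma>2 * w"] by (simp del: index_mult_mat(1) of_real_sum)
    have \<gamma>w: "\<gamma>2 * w = 0\<^sub>m p 1"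
    proof (rule ccontr)
      assume "\<gamma>2 * w \<noteq> 0\<^sub>m p 1"
      moreover have "\<gamma>2 * w \<in> carrier_mat p 1" by (intro carrier_matI) auto
      ultimately have "(\<Sum>i<p. (cmod ((\<gamma>2 * w) $$ (i,0)))\<^sup>2) > 0" by (intro cadj_self_pos)
      thus False unfolding s0 by simp
    qed
    have "\<gamma>2 * ((*) A4 ^^ k) w = 0\<^sub>m p 1" for k
    proof -
      have "((*) A4 ^^ k) w = a ^ k \<cdot>\<^sub>m w"
      proof (induction k)
        case (Suc k)
        have "A4 * (a ^ k \<cdot>\<^sub>m w) = a ^ k \<cdot>\<^sub>m (A4 * w)" by (simp add: mat_algebra)
        also have "\<dots> = a ^ Suc k \<cdot>\<^sub>m w" unfolding w(3) by (intro eq_matI) (auto simp: mult.left_commute)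
        finally show ?case using Suc by simp
      qed (auto intro!: eq_matI)
      thus ?thesis using \<gamma>w by (simp add: mat_algebra)
    qed
    from obs2[OF w(1) this] show False using w(2) by simp
  qed
  have inertia: "length (filter (\<lambda>a. Im a > 0) as) = length (filter (\<lambda>e. Re e > 0) fs)"
    "length (filter (\<lambda>a. Im a < 0) as) = length (filter (\<lambda>e. Re e < 0) fs)"
  proof -
    have dis: "Im ((cadj u * (list_diag fs * (A4 * u))) $$ (0,0)) \<ge> 0" if "u \<in> carrier_mat r 1" for u
    proof -
      have "Re ((cadj (\<gamma>2 * u) * (\<gamma>2 * u)) $$ (0,0)) \<ge> 0"
        using cadj_mult_self_entry[of "\<gamma>2 * u"] that by (simp del: index_mult_mat(1) of_real_sum add: sum_nonneg)
      thus ?thesis using diss[OF that] unfolding D_def by simp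
    qed
    show "length (filter (\<lambda>a. Im a > 0) as) = length (filter (\<lambda>e. Re e > 0) fs)"
      "length (filter (\<lambda>a. Im a < 0) as) = length (filter (\<lambda>e. Re e < 0) fs)"
      using inertia_of_dissipative_pair[OF A4 as fs(2,3) dis nonreal] by auto
  qed

  define M where "M = M1 + [:\<i>:] \<cdot>\<^sub>m M2"
  have Mc: "M \<in> carrier_mat p p" unfolding M_def using M1 M2 by auto
  have dM[simp]: "dim_row M = p" "dim_col M = p" using Mc by auto
  have \<Phi>M: "\<Phi> = M * Fh" using \<Phi>_eq M_def by simp
  have detM: "det M \<noteq> 0" "det Fh \<noteq> 0" and detprod: "det \<Phi> = det M * det Fh"
    using det\<Phi>(1) det_mult[OF Mc Fh] unfolding \<Phi>M by auto
  define C1 where "C1 = const_mat U1"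
  define C2 where "C2 = const_mat U2"
  define B1 where "B1 = const_mat (cadj U1)"
  define B2 where "B2 = const_mat (cadj U2)"
  have dC[simp]: "dim_row C1 = N" "dim_col C1 = d" "dim_row C2 = N" "dim_col C2 = r" "dim_row B1 = d" "dim_col B1 = N"
    "dim_row B2 = r" "dim_col B2 = N" unfolding C1_def C2_def B1_def B2_def by auto
  have B1C1: "B1 * C1 = 1\<^sub>m d" unfolding B1_def C1_def by (subst const_mat_mult[symmetric]) (auto simp: u11)
  have B2C2: "B2 * C2 = 1\<^sub>m r" unfolding B2_def C2_def by (subst const_mat_mult[symmetric]) (auto simp: u22)
  have B2C1: "B2 * C1 = 0\<^sub>m r d" unfolding B2_def C1_def by (subst const_mat_mult[symmetric]) (auto simp: u21)
  have CB: "C1 * B1 + C2 * B2 = 1\<^sub>m N"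
    using arg_cong[OF uu, of const_mat] unfolding C1_def B1_def C2_def B2_def by (simp add: const_mat_add const_mat_mult)
  have B2z: "B2 * pencil A = pencil A4 * B2" unfolding B2_def by (rule pencil_mult_const_mat[symmetric]) (auto simp: U2A)
  have zC1: "pencil A * C1 = C1 * pencil A1" unfolding C1_def by (rule pencil_mult_const_mat) (auto simp: AU1)
  have g2: "const_mat \<gamma>2 * B2 = const_mat \<gamma>" unfolding B2_def by (subst const_mat_mult[symmetric]) (auto simp: \<gamma>_eq[symmetric])
  have b2: "B2 * const_mat \<beta> = const_mat \<beta>2" unfolding B2_def \<beta>2_def by (subst const_mat_mult) auto
  have split_left': "W = C1 * (B1 * W) + C2 * (B2 * W)" if "dim_row W = N" for W
  proof -
    have "W = (C1 * B1 + C2 * B2) * W" unfolding CB using that by (simp add: left_mult_one_mat')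
    thus ?thesis using that by (simp add: mat_algebra)
  qed
  define \<chi> where "\<chi> = char_poly A4"
  have \<chi>0: "\<chi> \<noteq> 0" unfolding \<chi>_def by (rule char_poly_nonzero[OF A4])
  define J where "J = adj_mat (pencil A4)"
  have zA4: "pencil A4 \<in> carrier_mat r r" using A4 by simp
  have dz4: "det (pencil A4) \<noteq> 0" using det_pencil[OF A4] \<chi>0 \<chi>_def by simp
  have J: "J \<in> carrier_mat r r" "J * pencil A4 = \<chi> \<cdot>\<^sub>m 1\<^sub>m r"
    using adj_mat[OF zA4] det_pencil[OF A4] unfolding J_def \<chi>_def by auto
  have dJ[simp]: "dim_row J = r" "dim_col J = r" using J by auto
  have gJz: "const_mat \<gamma>2 * (J * (pencil A4 * W)) = \<chi> \<cdot>\<^sub>m (const_mat \<gamma>2 * W)" if "dim_row W = r" for W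
  proof -
    have "J * (pencil A4 * W) = (J * pencil A4) * W" using that by (simp add: mat_assoc)
    thus ?thesis unfolding J(2) using that by (simp add: mat_algebra left_mult_one_mat')
  qed
  define \<tau> where "\<tau> = const_mat \<gamma>2 * (J * const_mat \<beta>2)"
  have \<tau>c: "\<tau> \<in> carrier_mat p p" unfolding \<tau>_def by (intro carrier_matI) auto
  have d\<tau>[simp]: "dim_row \<tau> = p" "dim_col \<tau> = p" using \<tau>c by auto
  have \<tau>mult: "\<tau> * W = const_mat \<gamma>2 * (J * (B2 * (const_mat \<beta> * W)))" if "dim_row W = p" for W
    unfolding \<tau>_def b2[symmetric] using that by (simp add: mat_assoc)
  \<comment> \<open>The transfer function survives the compression: \<open>\<tau> / \<chi>\<close>
    is \<open>\<gamma>2 (zI - A4)^-1 \<beta>2\<close>, and the equations for \<open>Y\<close>, after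
    cancellation of \<open>Fh\<close>, identify it with \<open>- M2 M^-1\<close>.\<close>
  have \<tau>M: "\<tau> * M = \<chi> \<cdot>\<^sub>m (- M2)"
  proof (rule right_cancel_mat_eq[OF Fh detM(2), where k = p])
    have "(\<tau> * M) * Fh = \<tau> * \<Phi>" unfolding \<Phi>M by (simp add: mat_assoc)
    also have "\<dots> = const_mat \<gamma>2 * (J * (B2 * (pencil A * Y)))" using \<tau>mult[of \<Phi>] unfolding zY by simp
    also have "B2 * (pencil A * Y) = pencil A4 * (B2 * Y)" using arg_cong[OF B2z, of "\<lambda>Q. Q * Y"] by (simp add: mat_assoc)
    also have "const_mat \<gamma>2 * (J * (pencil A4 * (B2 * Y))) = \<chi> \<cdot>\<^sub>m ((const_mat \<gamma>2 * B2) * Y)" by (simp add: gJz mat_assoc)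
    also have "\<dots> = \<chi> \<cdot>\<^sub>m (- (M2 * Fh))" unfolding g2 gY ..
    also have "\<dots> = (\<chi> \<cdot>\<^sub>m (- M2)) * Fh" by (simp add: mat_algebra)
    finally show "(\<tau> * M) * Fh = (\<chi> \<cdot>\<^sub>m (- M2)) * Fh" .
  qed (auto intro!: carrier_matI)
  have cbM: "const_mat \<beta> * M \<in> carrier_mat N p" by (intro carrier_matI) auto
  \<comment> \<open>The remainder \<open>\<kappa>\<close> will turn out to have its columns in the
    kernel of \<open>X\<close>. Its coordinates \<open>\<kappa>1\<close> there are to
    \<open>A1\<close> and \<open>Fh\<close> what \<open>\<beta>2\<close> is to \<open>A4\<close> and
    \<open>M\<close>, namely the input matrix in \<open>char_poly_dvd_det\<close>.\<close>
  obtain Y' \<kappa> where Y': "Y' \<in> carrier_mat N p" and \<kappa>: "\<kappa> \<in> carrier_mat N p" and bM: "const_mat \<beta> * M = pencil A * Y' + const_mat \<kappa>"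
    using left_remainder_exists[OF A cbM] by blast
  have dY'[simp]: "dim_row Y' = N" "dim_col Y' = p" "dim_row \<kappa> = N" "dim_col \<kappa> = p" using Y' \<kappa> by auto
  define \<kappa>2 where "\<kappa>2 = cadj U2 * \<kappa>"
  have \<kappa>2c: "\<kappa>2 \<in> carrier_mat r p" unfolding \<kappa>2_def by (intro carrier_matI) auto
  have d\<kappa>2[simp]: "dim_row \<kappa>2 = r" "dim_col \<kappa>2 = p" using \<kappa>2c by auto
  have B2\<kappa>: "B2 * const_mat \<kappa> = const_mat \<kappa>2" unfolding B2_def \<kappa>2_def by (subst const_mat_mult) auto
  have B2z': "B2 * (pencil A * W) = pencil A4 * (B2 * W)" if "dim_row W = N" for W
    using arg_cong[OF B2z, of "\<lambda>Q. Q * W"] that by (simp add: mat_assoc)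
  have b2M: "const_mat \<beta>2 * M = pencil A4 * (B2 * Y') + const_mat \<kappa>2"
  proof -
    have "const_mat \<beta>2 * M = B2 * (const_mat \<beta> * M)" unfolding b2[symmetric] by (simp add: mat_assoc)
    thus ?thesis unfolding bM by (simp add: mat_algebra B2z' B2\<kappa>)
  qed
  \<comment> \<open>As \<open>\<tau> * M / \<chi>\<close> is the polynomial matrix
    \<open>- M2\<close>, the strictly proper term \<open>\<gamma>2 (zI - A4)^-1 \<kappa>2\<close> is
    polynomial as well. Hence it is zero, and observability gives the claim.\<close>
  have \<kappa>20: "\<kappa>2 = 0\<^sub>m r p"
  proof (rule obs2[OF \<kappa>2c])
    have "\<tau> * M = const_mat \<gamma>2 * (J * (pencil A4 * (B2 * Y') + const_mat \<kappa>2))"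
      unfolding \<tau>_def b2M[symmetric] by (simp add: mat_assoc)
    also have "\<dots> = \<chi> \<cdot>\<^sub>m (const_mat \<gamma>2 * (B2 * Y')) + const_mat \<gamma>2 * (J * const_mat \<kappa>2)" by (simp add: mat_distrib_left gJz)
    finally have e: "\<chi> \<cdot>\<^sub>m (- M2) = \<chi> \<cdot>\<^sub>m (const_mat \<gamma>2 * (B2 * Y')) + const_mat \<gamma>2 * (J * const_mat \<kappa>2)" unfolding \<tau>M .
    define Z where "Z = const_mat \<gamma>2 * (B2 * Y')"
    define K where "K = const_mat \<gamma>2 * (J * const_mat \<kappa>2)"
    have dZ[simp]: "dim_row Z = p" "dim_col Z = p" "dim_row K = p" "dim_col K = p" unfolding Z_def K_def by auto
    have "K = \<chi> \<cdot>\<^sub>m (- M2 - Z)"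
    proof (rule eq_matI)
      fix i j assume "i < dim_row (\<chi> \<cdot>\<^sub>m (- M2 - Z))" "j < dim_col (\<chi> \<cdot>\<^sub>m (- M2 - Z))"
      hence ij: "i < p" "j < p" by auto
      have "(\<chi> \<cdot>\<^sub>m (- M2)) $$ (i,j) = (\<chi> \<cdot>\<^sub>m Z + K) $$ (i,j)" using e unfolding Z_def K_def by simp
      thus "K $$ (i,j) = (\<chi> \<cdot>\<^sub>m (- M2 - Z)) $$ (i,j)" using ij by (simp add: algebra_simps)
    qed auto
    hence "const_mat \<gamma>2 * (adj_mat (pencil A4) * const_mat \<kappa>2) = char_poly A4 \<cdot>\<^sub>m (- M2 - Z)" unfolding K_def J_def \<chi>_def .
    moreover have g2c: "\<gamma>2 \<in> carrier_mat p r" by (intro carrier_matI) auto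
    moreover have "- M2 - Z \<in> carrier_mat p p" by (intro carrier_matI) auto
    ultimately have "const_mat \<gamma>2 * (adj_mat (pencil A4) * const_mat \<kappa>2) = 0\<^sub>m p p"
      using strictly_proper_multiple_zero(1)[OF A4 _ \<kappa>2c] by blast
    from unobservable_of_resolvent_zero[OF A4 g2c \<kappa>2c this]
    show "\<gamma>2 * ((*) A4 ^^ k) \<kappa>2 = 0\<^sub>m p p" for k .
  qed
  have dvd1: "\<chi> dvd det M" unfolding \<chi>_def
  proof (rule char_poly_dvd_det[OF A4 _ Mc])
    have "pencil A4 * (B2 * Y') \<in> carrier_mat r p" by (intro carrier_matI) auto
    thus "const_mat \<beta>2 * M = pencil A4 * (B2 * Y')" unfolding b2M \<kappa>20 by simp
    have "pencil A4 * (B2 * (P * C2)) + const_mat \<beta>2 * (R * C2) = (B2 * (pencil A * P + const_mat \<beta> * R)) * C2"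
      unfolding b2[symmetric] by (simp add: mat_algebra B2z')
    also have "\<dots> = 1\<^sub>m r" unfolding unit by (simp add: right_mult_one_mat' B2C2)
    finally show "pencil A4 * (B2 * (P * C2)) + const_mat \<beta>2 * (R * C2) = 1\<^sub>m r" .
  qed (auto intro!: carrier_matI)
  define \<kappa>1 where "\<kappa>1 = cadj U1 * \<kappa>"
  have d\<kappa>1[simp]: "dim_row \<kappa>1 = d" "dim_col \<kappa>1 = p" unfolding \<kappa>1_def by auto
  have \<kappa>_eq: "const_mat \<kappa> = C1 * const_mat \<kappa>1"
  proof -
    have "\<kappa> = U1 * \<kappa>1" using split_left[of \<kappa>] unfolding \<kappa>1_def[symmetric] \<kappa>2_def[symmetric] \<kappa>20 by simp
    thus ?thesis unfolding C1_def by (simp add: const_mat_mult)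
  qed
  have in_C1: "W = C1 * (B1 * W)" if "W \<in> carrier_mat N q" "pencil A4 * (B2 * W) = 0\<^sub>m r q" for W q
  proof -
    have "B2 * W = 0\<^sub>m r q" by (rule left_cancel_mat[OF zA4 dz4 _ that(2)]) (use that in \<open>auto intro!: carrier_matI\<close>)
    thus ?thesis using split_left'[of W] that(1) by simp
  qed
  have B1zC1: "B1 * (pencil A * (C1 * W)) = pencil A1 * W" if "dim_row W = d" for W
  proof -
    have "B1 * (pencil A * (C1 * W)) = B1 * ((pencil A * C1) * W)" using that by (simp add: mat_assoc)
    also have "\<dots> = (B1 * C1) * (pencil A1 * W)" unfolding zC1 using that by (simp add: mat_assoc)
    finally show ?thesis unfolding B1C1 using that by (simp add: left_mult_one_mat')
  qed
  have B1C1': "B1 * (C1 * W) = W" if "dim_row W = d" for W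
  proof -
    have "B1 * (C1 * W) = (B1 * C1) * W" using that by (simp add: mat_assoc)
    thus ?thesis unfolding B1C1 using that by (simp add: left_mult_one_mat')
  qed
  have B2C1': "B2 * (C1 * W) = 0\<^sub>m r q" if "W \<in> carrier_mat d q" for W q
  proof -
    have "B2 * (C1 * W) = (B2 * C1) * W" using that by (simp add: mat_assoc)
    thus ?thesis unfolding B2C1 using that by simp
  qed
  have dvd2: "char_poly A1 dvd det Fh"
  proof -
    \<comment> \<open>\<open>Y' * Fh\<close> solves the equation of \<open>Y\<close> up to the
      remainder, so \<open>pencil A * Z\<close> is \<open>\<kappa> Fh\<close>, with columns in the
      kernel of \<open>X\<close>. This forces \<open>Z\<close> into the kernel as well, where
      \<open>pencil A\<close> acts as \<open>pencil A1\<close>.\<close>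
    define Z where "Z = Y - Y' * Fh"
    have dZ[simp]: "dim_row Z = N" "dim_col Z = p" unfolding Z_def by auto
    have zZ: "pencil A * Z = C1 * (const_mat \<kappa>1 * Fh)"
    proof -
      have "pencil A * Y = (const_mat \<beta> * M) * Fh" unfolding zY \<Phi>M by (simp add: mat_assoc)
      also have "\<dots> = pencil A * (Y' * Fh) + C1 * (const_mat \<kappa>1 * Fh)" unfolding bM \<kappa>_eq by (simp add: mat_algebra)
      finally have e: "pencil A * Y = pencil A * (Y' * Fh) + C1 * (const_mat \<kappa>1 * Fh)" .
      show ?thesis unfolding Z_def by (simp add: mat_diff_distrib_left e) (intro eq_matI; simp del: index_mult_mat(1))
    qed
    have "pencil A4 * (B2 * Z) = B2 * (pencil A * Z)" by (simp add: B2z')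
    also have "\<dots> = 0\<^sub>m r p" unfolding zZ by (rule B2C1') (auto intro!: carrier_matI)
    finally have ZC: "Z = C1 * (B1 * Z)" by (intro in_C1[where q = p]) (auto intro!: carrier_matI)
    have "const_mat \<kappa>1 * Fh = B1 * (C1 * (const_mat \<kappa>1 * Fh))" by (simp add: B1C1')
    also have "\<dots> = B1 * (pencil A * (C1 * (B1 * Z)))" unfolding zZ[symmetric] using ZC by simp
    finally have kFh: "const_mat \<kappa>1 * Fh = pencil A1 * (B1 * Z)" by (simp add: B1zC1)
    define P1 where "P1 = P * C1"
    define R1 where "R1 = R * C1"
    have dP[simp]: "dim_row P1 = N" "dim_col P1 = d" "dim_row R1 = p" "dim_col R1 = d" unfolding P1_def R1_def by auto
    have PR: "pencil A * P1 + const_mat \<beta> * R1 = C1"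
    proof -
      have "pencil A * P1 + const_mat \<beta> * R1 = (pencil A * P + const_mat \<beta> * R) * C1" unfolding P1_def R1_def by (simp add: mat_algebra)
      thus ?thesis unfolding unit by (simp add: left_mult_one_mat')
    qed
    have "B2 * (pencil A * P1 + const_mat \<beta> * R1) = pencil A4 * (B2 * P1) + B2 * (const_mat \<beta> * R1)" by (simp add: mat_distrib_left B2z')
    hence "pencil A4 * (B2 * P1) + B2 * (const_mat \<beta> * R1) = 0\<^sub>m r d" unfolding PR B2C1 ..
    hence s: "pencil A4 * (B2 * P1) = - (B2 * (const_mat \<beta> * R1))" by (rule add_eq_zero_mat) (auto intro!: carrier_matI)
    have bR: "B2 * (const_mat \<beta> * R1) = pencil A4 * (- (B2 * P1))"
      using arg_cong[OF s, of uminus] by simp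
    have \<tau>R: "\<tau> * R1 = \<chi> \<cdot>\<^sub>m (const_mat \<gamma>2 * (- (B2 * P1)))" by (subst \<tau>mult) (auto simp: bR gJz simp del: uminus_mult_right_mat)
    \<comment> \<open>Here the coprimality of \<open>M1\<close> and \<open>M2\<close> is used.
      Writing \<open>R1\<close> as a multiple of \<open>M\<close> allows \<open>\<beta> * R1\<close>
      to be replaced by \<open>\<kappa>\<close> times a polynomial matrix, modulo the image of
      \<open>pencil A\<close>.\<close>
    have "\<exists>r\<in>carrier_mat p d. R1 = M * r"
      by (rule left_fraction_factor[OF M1 M2 U V \<tau>c _ _ M_def detM(1) \<chi>0 bez \<tau>M \<tau>R]) (auto intro!: carrier_matI)
    then obtain \<rho> where \<rho>: "\<rho> \<in> carrier_mat p d" "R1 = M * \<rho>" by blast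
    have d\<rho>[simp]: "dim_row \<rho> = p" "dim_col \<rho> = d" using \<rho> by auto
    define S where "S = P1 + Y' * \<rho>"
    have dS[simp]: "dim_row S = N" "dim_col S = d" unfolding S_def by auto
    have C1_eq: "C1 = pencil A * S + C1 * (const_mat \<kappa>1 * \<rho>)"
    proof -
      have "const_mat \<beta> * R1 = (const_mat \<beta> * M) * \<rho>" unfolding \<rho>(2) by (simp add: mat_assoc)
      also have "\<dots> = pencil A * (Y' * \<rho>) + C1 * (const_mat \<kappa>1 * \<rho>)" unfolding bM \<kappa>_eq by (simp add: mat_algebra)
      finally have "C1 = pencil A * P1 + (pencil A * (Y' * \<rho>) + C1 * (const_mat \<kappa>1 * \<rho>))" using PR by simp
      also have "\<dots> = pencil A * S + C1 * (const_mat \<kappa>1 * \<rho>)" unfolding S_def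
        by (simp add: mat_distrib_left) (intro eq_matI; simp del: index_mult_mat(1))
      finally show ?thesis .
    qed
    have k1\<rho>: "const_mat \<kappa>1 * \<rho> \<in> carrier_mat d d" by (intro carrier_matI) auto
    have "B2 * C1 = B2 * (pencil A * S + C1 * (const_mat \<kappa>1 * \<rho>))" using C1_eq by simp
    also have "\<dots> = pencil A4 * (B2 * S) + B2 * (C1 * (const_mat \<kappa>1 * \<rho>))" by (simp add: mat_distrib_left B2z')
    also have "\<dots> = pencil A4 * (B2 * S)" unfolding B2C1'[OF k1\<rho>] by (intro right_add_zero_mat carrier_matI) auto
    finally have "pencil A4 * (B2 * S) = 0\<^sub>m r d" unfolding B2C1 by simp
    hence SC: "S = C1 * (B1 * S)" by (intro in_C1[where q = d]) (auto intro!: carrier_matI)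
    have "1\<^sub>m d = B1 * (pencil A * S + C1 * (const_mat \<kappa>1 * \<rho>))" using C1_eq B1C1 by simp
    also have "\<dots> = B1 * (pencil A * S) + const_mat \<kappa>1 * \<rho>" by (simp add: mat_distrib_left B1C1')
    also have "B1 * (pencil A * S) = pencil A1 * (B1 * S)" by (subst SC) (simp add: B1zC1)
    finally have bez1: "pencil A1 * (B1 * S) + const_mat \<kappa>1 * \<rho> = 1\<^sub>m d" ..
    show ?thesis by (rule char_poly_dvd_det[OF A1 _ Fh _ _ \<rho>(1) kFh bez1]) (auto intro!: carrier_matI)
  qed
  obtain q1 where q1: "det M = \<chi> * q1" using dvd1 by (auto simp: dvd_def)
  obtain q2 where q2: "det Fh = char_poly A1 * q2" using dvd2 by (auto simp: dvd_def)
  have q10: "q1 \<noteq> 0" using q1 detM by auto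
  have q20: "q2 \<noteq> 0" using q2 detM by auto
  \<comment> \<open>From \<open>dvd2\<close> only the degree is drawn: \<open>det Fh\<close> has
    degree at least \<open>d\<close>, so \<open>det M\<close> has degree at most \<open>r\<close>
    and equals \<open>\<chi>\<close> up to a constant.\<close>
  have "degree (det M) = r + degree q1" unfolding q1 using \<chi>0 q10 degree_monic_char_poly[OF A4] \<chi>_def by (simp add: degree_mult_eq)
  moreover have "degree (det Fh) = d + degree q2" unfolding q2 using char_poly_nonzero[OF A1] q20 degree_monic_char_poly[OF A1] by (simp add: degree_mult_eq)
  moreover have "degree (det \<Phi>) = degree (det M) + degree (det Fh)" unfolding detprod using detM by (simp add: degree_mult_eq)
  ultimately have "degree q1 = 0" using det\<Phi>(2) N by simp
  then obtain c where c: "q1 = [:c:]" by (auto elim: degree_eq_zeroE)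
  have c0: "c \<noteq> 0" using q10 c by simp
  have "roots_in (det M) S = length (filter (\<lambda>a. a \<in> S) as)" for S
  proof -
    have "roots_in (det M) S = roots_in \<chi> S" unfolding q1 c using roots_in_smult[OF c0 \<chi>0, of S] by (simp add: mult.commute)
    thus ?thesis unfolding \<chi>_def as roots_in_linear_factors .
  qed
  hence total: "roots_in (det \<Phi>) S = length (filter (\<lambda>a. a \<in> S) as) + roots_in (det Fh) S" for S
    unfolding detprod using roots_in_mult[OF detM] by simp
  have f: "filter (\<lambda>e. Re e > 0) fs = filter (\<lambda>e. Re e > 0) es" "filter (\<lambda>e. Re e < 0) fs = filter (\<lambda>e. Re e < 0) es"
    unfolding fs(1) filter_filter by (intro filter_cong refl; auto)+
  show "roots_in (det \<Phi>) {z. Im z > 0} = length (filter (\<lambda>e. Re e > 0) es) + roots_in (det Fh) {z. Im z > 0}"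
    "roots_in (det \<Phi>) {z. Im z < 0} = length (filter (\<lambda>e. Re e < 0) es) + roots_in (det Fh) {z. Im z < 0}"
    unfolding total using inertia unfolding f by simp_all
qed

section \<open>The block companion realization\<close>

lemma sum_blocks: "(\<Sum>b<n * p. f b) = (\<Sum>k<n. \<Sum>l<p. f (k * p + l :: nat) :: 'a :: comm_monoid_add)"
proof (induction n)
  case (Suc n)
  have "(\<Sum>b<Suc n * p. f b) = (\<Sum>b<n * p + p. f b)" by (simp add: add.commute)
  also have "\<dots> = (\<Sum>b<n * p. f b) + (\<Sum>l<p. f (n * p + l))" by (rule sum_lessThan_plus)
  finally show ?case using Suc by simp
qed simp

text \<open>The parameters are the Markov parameters of \<open>- D Nn\<^sup>-\<^sup>1\<close>: \<open>recur\<close> and \<open>Dcoeff\<close> express that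
  the product of \<open>\<Sum> t k z\<^sup>-\<^sup>k\<^sup>-\<^sup>1\<close> and \<open>Nn\<close> is \<open>- D\<close>.\<close>

locale hankel_data =
  fixes n p :: nat and t :: "nat \<Rightarrow> complex mat" and \<epsilon> :: complex and Nn D :: "complex poly mat"
  assumes t: "\<And>k. t k \<in> carrier_mat p p" and ht: "\<And>k. cadj (t k) = t k"
    and Nn: "Nn \<in> carrier_mat p p" and D: "D \<in> carrier_mat p p"
    and degN: "\<And>i j. i < p \<Longrightarrow> j < p \<Longrightarrow> degree (Nn $$ (i,j)) \<le> n"
    and lead: "\<And>i j. i < p \<Longrightarrow> j < p \<Longrightarrow> coeff (Nn $$ (i,j)) n = (if i = j then \<epsilon> else 0)" and \<epsilon>: "\<epsilon> \<noteq> 0"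
    and recur: "\<And>l i j. i < p \<Longrightarrow> j < p \<Longrightarrow> (\<Sum>k\<le>n. \<Sum>c<p. t (k + l) $$ (i,c) * coeff (Nn $$ (c,j)) k) = 0"
    and Dcoeff: "\<And>q i j. i < p \<Longrightarrow> j < p \<Longrightarrow>
      coeff (D $$ (i,j)) q = - (\<Sum>k<n. \<Sum>c<p. t k $$ (i,c) * coeff (Nn $$ (c,j)) (q + k + 1))"
begin

definition X where "X = mat (n * p) (n * p) (\<lambda>(a,b). t (a div p + b div p) $$ (a mod p, b mod p))"
text \<open>Block row \<open>k\<close> of the infinite Hankel matrix, cut to \<open>n\<close>
  blocks. It is defined for every \<open>k\<close> because powers of the companion matrix lead past
  the rows of \<open>X\<close>.\<close>

definition \<Gamma> where "\<Gamma> k = mat p (n * p) (\<lambda>(i,b). t (k + b div p) $$ (i, b mod p))"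
definition \<beta> where "\<beta> = mat (n * p) p (\<lambda>(a,l). if a = l then 1 else (0::complex))"
definition S where "S = mat (n * p) (n * p) (\<lambda>(a,b). if a = b + p then 1 else (0::complex))"
definition L where "L = mat (n * p) p (\<lambda>(a,l). inverse \<epsilon> * coeff (Nn $$ (a mod p, l)) (a div p))"
definition G where "G = mat p (n * p) (\<lambda>(l,b). if b = (n - 1) * p + l then 1 else (0::complex))"
text \<open>The block companion matrix: \<open>S\<close> shifts the blocks, \<open>G\<close> selects
  the last block of coordinates, and \<open>L\<close> holds the coefficients of \<open>Nn\<close>
  below degree \<open>n\<close>, divided by the leading scalar \<open>\<epsilon>\<close>.\<close>

definition A0 where "A0 = S - L * G"
definition A where "A = A0 + \<i> \<cdot>\<^sub>m (\<beta> * \<Gamma> 0)"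

lemma dims[simp]: "dim_row X = n * p" "dim_col X = n * p" "dim_row (\<Gamma> k) = p" "dim_col (\<Gamma> k) = n * p"
  "dim_row \<beta> = n * p" "dim_col \<beta> = p" "dim_row S = n * p" "dim_col S = n * p" "dim_row L = n * p" "dim_col L = p"
  "dim_row G = p" "dim_col G = n * p" "dim_row A0 = n * p" "dim_col A0 = n * p" "dim_row A = n * p" "dim_col A = n * p"
  "dim_row Nn = p" "dim_col Nn = p" "dim_row D = p" "dim_col D = p" "dim_row (t k) = p" "dim_col (t k) = p"
  using Nn D t by (auto simp: X_def \<Gamma>_def \<beta>_def S_def L_def G_def A0_def A_def)

lemma ht_index: "i < p \<Longrightarrow> j < p \<Longrightarrow> cnj (t k $$ (j,i)) = t k $$ (i,j)"
  using arg_cong[OF ht[of k], of "\<lambda>M. M $$ (i,j)"] by simp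

lemma idx: assumes "a < n * p" shows "0 < p" "a mod p < p" "a div p < n" "0 < n"
proof -
  show p: "0 < p" using assms by (cases p) auto
  show "a mod p < p" using p by simp
  show "a div p < n" using assms p by (simp add: div_less_iff_less_mult)
  thus "0 < n" by simp
qed

lemma last_idx: "0 < n \<Longrightarrow> l < p \<Longrightarrow> (n - 1) * p + l < n * p"
proof -
  assume "0 < n" "l < p"
  then obtain m where "n = Suc m" by (cases n) auto
  thus ?thesis using \<open>l < p\<close> by simp
qed

lemma S_mult:
  fixes Q :: "complex poly mat"
  assumes "dim_row Q = n * p" "a < n * p" "j < dim_col Q"
  shows "(const_mat S * Q) $$ (a,j) = (if p \<le> a then Q $$ (a - p, j) else 0)"
proof -
  have "(const_mat S * Q) $$ (a,j) = (\<Sum>b<n*p. const_mat S $$ (a,b) * Q $$ (b,j))" using assms by (subst mult_entry) auto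
  also have "\<dots> = (\<Sum>b<n*p. if b = a - p then (if p \<le> a then Q $$ (a - p, j) else 0) else 0)"
    by (rule sum.cong) (use assms idx[OF assms(2)] in \<open>auto simp: S_def one_pCons[symmetric]\<close>)
  finally show ?thesis using assms less_imp_diff_less[OF assms(2), of p] by (simp add: sum.delta)
qed

lemma G_mult:
  fixes Q :: "complex poly mat"
  assumes "dim_row Q = n * p" "0 < n" "l < p" "j < dim_col Q"
  shows "(const_mat G * Q) $$ (l,j) = Q $$ ((n - 1) * p + l, j)"
proof -
  have "(const_mat G * Q) $$ (l,j) = (\<Sum>b<n*p. const_mat G $$ (l,b) * Q $$ (b,j))" using assms by (subst mult_entry) auto
  also have "\<dots> = (\<Sum>b<n*p. if b = (n - 1) * p + l then Q $$ (b, j) else 0)"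
    by (rule sum.cong) (use assms in \<open>auto simp: G_def one_pCons[symmetric]\<close>)
  finally show ?thesis using last_idx[OF assms(2,3)] by (simp add: sum.delta)
qed

lemma \<beta>_mult:
  fixes Q :: "complex poly mat"
  assumes "dim_row Q = p" "a < n * p" "j < dim_col Q"
  shows "(const_mat \<beta> * Q) $$ (a,j) = (if a < p then Q $$ (a,j) else 0)"
proof -
  have "(const_mat \<beta> * Q) $$ (a,j) = (\<Sum>l<p. const_mat \<beta> $$ (a,l) * Q $$ (l,j))" using assms by (subst mult_entry) auto
  also have "\<dots> = (\<Sum>l<p. if l = a then Q $$ (a,j) else 0)"
    by (rule sum.cong) (use assms in \<open>auto simp: \<beta>_def one_pCons[symmetric]\<close>)
  finally show ?thesis by (simp add: sum.delta)
qed

lemma mult_S: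
  assumes "dim_col Q = n * p" "i < dim_row Q" "b < n * p"
  shows "(Q * S) $$ (i,b) = (if b + p < n * p then Q $$ (i, b + p) else 0)"
proof -
  have "(Q * S) $$ (i,b) = (\<Sum>a<n*p. Q $$ (i,a) * S $$ (a,b))" using assms by (subst mult_entry) auto
  also have "\<dots> = (\<Sum>a<n*p. if a = b + p then Q $$ (i, a) else 0)"
    by (rule sum.cong) (use assms in \<open>auto simp: S_def\<close>)
  finally show ?thesis by (simp add: sum.delta)
qed

lemma mult_G:
  assumes "dim_col Q = p" "i < dim_row Q" "b < n * p"
  shows "(Q * G) $$ (i,b) = (if (n - 1) * p \<le> b then Q $$ (i, b - (n - 1) * p) else 0)"
proof -
  have np: "b - (n - 1) * p < p"
    using assms(3) idx[OF assms(3)] by (cases n) auto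
  have "(Q * G) $$ (i,b) = (\<Sum>a<p. Q $$ (i,a) * G $$ (a,b))" using assms by (subst mult_entry) auto
  also have "\<dots> = (\<Sum>a<p. if a = b - (n - 1) * p then (if (n - 1) * p \<le> b then Q $$ (i, a) else 0) else 0)"
    by (rule sum.cong) (use assms in \<open>auto simp: G_def\<close>)
  finally show ?thesis using np by (simp add: sum.delta)
qed

lemma block_idx: "m < n \<Longrightarrow> c < p \<Longrightarrow> m * p + c < n * p"
proof -
  assume mc: "m < n" "c < p"
  have "m * p + c < Suc m * p" using mc by simp
  also have "\<dots> \<le> n * p" using mc by (intro mult_right_mono) auto
  finally show ?thesis .
qed

lemma \<Gamma>_mult:
  fixes Q :: "complex mat"
  assumes "dim_row Q = n * p" "i < p" "j < dim_col Q"
  shows "(\<Gamma> k * Q) $$ (i,j) = (\<Sum>m<n. \<Sum>c<p. t (k + m) $$ (i,c) * Q $$ (m * p + c, j))"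
proof -
  have "(\<Gamma> k * Q) $$ (i,j) = (\<Sum>b<n*p. \<Gamma> k $$ (i,b) * Q $$ (b,j))" using assms by (subst mult_entry) auto
  also have "\<dots> = (\<Sum>m<n. \<Sum>c<p. \<Gamma> k $$ (i,m * p + c) * Q $$ (m * p + c, j))" by (rule sum_blocks)
  also have "\<dots> = (\<Sum>m<n. \<Sum>c<p. t (k + m) $$ (i,c) * Q $$ (m * p + c, j))"
  proof (intro sum.cong refl)
    fix m c assume "m \<in> {..<n}" "c \<in> {..<p}"
    hence mc: "m < n" "c < p" by auto
    hence "m * p + c < n * p" by (rule block_idx)
    thus "\<Gamma> k $$ (i, m * p + c) * Q $$ (m * p + c, j) = t (k + m) $$ (i,c) * Q $$ (m * p + c, j)"
      using assms mc by (simp add: \<Gamma>_def)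
  qed
  finally show ?thesis .
qed

text \<open>The shift moves the blocks by one place, and the last block column must produce
  \<open>t (n + k)\<close>, which \<open>recur\<close> expresses by the preceding \<open>n\<close>
  parameters because the leading coefficient is a scalar. Iterated, this is
  \<open>\<Gamma> k = \<Gamma> 0 A0^k\<close>.\<close>

lemma \<Gamma>_A0: "\<Gamma> k * A0 = \<Gamma> (Suc k)"
proof (rule eq_matI)
  fix i b assume "i < dim_row (\<Gamma> (Suc k))" "b < dim_col (\<Gamma> (Suc k))"
  hence ib: "i < p" "b < n * p" by auto
  note ix = idx[OF ib(2)]
  have e: "(\<Gamma> k * A0) $$ (i,b) = (\<Gamma> k * S) $$ (i,b) - ((\<Gamma> k * L) * G) $$ (i,b)"
    using ib unfolding A0_def by (simp add: mat_algebra del: index_mult_mat(1))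
  show "(\<Gamma> k * A0) $$ (i,b) = \<Gamma> (Suc k) $$ (i,b)"
  proof (cases "(n - 1) * p \<le> b")
    case False
    hence lt: "b + p < n * p" using ix by (cases n) auto
    have "(b + p) div p = Suc (b div p)" using ix by simp
    thus ?thesis unfolding e using ib lt False by (simp add: mult_S mult_G del: index_mult_mat(1)) (simp add: \<Gamma>_def)
  next
    case True
    hence nlt: "\<not> b + p < n * p" using ix by (cases n) auto
    define l where "l = b - (n - 1) * p"
    have bl: "b = (n - 1) * p + l" using True l_def by simp
    have lp: "l < p" using ib(2) ix unfolding l_def by (cases n) auto
    have bd: "b div p = n - 1" "b mod p = l" unfolding bl using lp by auto
    have r: "(\<Sum>m\<le>n. \<Sum>c<p. t (m + k) $$ (i,c) * coeff (Nn $$ (c,l)) m) = 0" using recur[OF ib(1) lp] .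
    have last: "(\<Sum>c<p. t (n + k) $$ (i,c) * coeff (Nn $$ (c,l)) n) = t (n + k) $$ (i,l) * \<epsilon>"
    proof -
      have "(\<Sum>c<p. t (n + k) $$ (i,c) * coeff (Nn $$ (c,l)) n) = (\<Sum>c<p. if c = l then t (n + k) $$ (i,l) * \<epsilon> else 0)"
        by (rule sum.cong) (use lp lead in auto)
      thus ?thesis using lp by (simp add: sum.delta)
    qed
    have r': "(\<Sum>m<n. \<Sum>c<p. t (m + k) $$ (i,c) * coeff (Nn $$ (c,l)) m) = - (t (n + k) $$ (i,l) * \<epsilon>)"
    proof -
      have "{..n} = insert n {..<n}" by auto
      thus ?thesis using r unfolding last[symmetric] by (simp add: eq_neg_iff_add_eq_0 add.commute)
    qed
    have "(\<Gamma> k * L) $$ (i,l) = (\<Sum>m<n. \<Sum>c<p. t (k + m) $$ (i,c) * L $$ (m * p + c, l))"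
      using ib lp by (subst \<Gamma>_mult) auto
    also have "\<dots> = (\<Sum>m<n. \<Sum>c<p. inverse \<epsilon> * (t (m + k) $$ (i,c) * coeff (Nn $$ (c,l)) m))"
      by (intro sum.cong refl) (use lp in \<open>auto simp: L_def block_idx add.commute[of k]\<close>)
    also have "\<dots> = inverse \<epsilon> * (\<Sum>m<n. \<Sum>c<p. t (m + k) $$ (i,c) * coeff (Nn $$ (c,l)) m)"
      by (simp add: sum_distrib_left)
    also have "\<dots> = - t (n + k) $$ (i,l)" unfolding r' using \<epsilon> by simp
    finally have GL: "(\<Gamma> k * L) $$ (i,l) = - t (n + k) $$ (i,l)" .
    have "((\<Gamma> k * L) * G) $$ (i,b) = (\<Gamma> k * L) $$ (i,l)"
      using mult_G[of "\<Gamma> k * L" i b] ib True unfolding l_def by (simp del: index_mult_mat(1))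
    moreover have "(\<Gamma> k * S) $$ (i,b) = 0" using ib nlt by (simp add: mult_S del: index_mult_mat(1))
    ultimately have "(\<Gamma> k * A0) $$ (i,b) = t (n + k) $$ (i,l)" unfolding e GL by simp
    also have "n + k = Suc k + b div p" using bd ix by simp
    finally show ?thesis using ib bd by (simp add: \<Gamma>_def)
  qed
qed auto

lemma X_mult: "dim_row Q = n * p \<Longrightarrow> a < n * p \<Longrightarrow> j < dim_col Q \<Longrightarrow> (X * Q) $$ (a,j) = (\<Gamma> (a div p) * Q) $$ (a mod p, j)"
  using idx[of a] by (subst (1 2) mult_entry) (auto simp: X_def \<Gamma>_def intro!: sum.cong)

lemma X_herm: "cadj X = X"
  by (rule eq_matI) (use idx in \<open>auto simp: X_def ht_index add.commute\<close>)

lemma X\<beta>: "X * \<beta> = cadj (\<Gamma> 0)"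
proof (rule eq_matI)
  fix a l assume "a < dim_row (cadj (\<Gamma> 0))" "l < dim_col (cadj (\<Gamma> 0))"
  hence al: "a < n * p" "l < p" by auto
  note ix = idx[OF al(1)]
  have lnp: "l < n * p" using block_idx[of 0 l] ix al by simp
  have "(X * \<beta>) $$ (a,l) = (\<Sum>b<n*p. X $$ (a,b) * \<beta> $$ (b,l))" using al by (subst mult_entry) auto
  also have "\<dots> = (\<Sum>b<n*p. if b = l then X $$ (a,l) else 0)"
    by (rule sum.cong) (use al in \<open>auto simp: \<beta>_def\<close>)
  also have "\<dots> = X $$ (a,l)" using lnp by (simp add: sum.delta)
  finally show "(X * \<beta>) $$ (a,l) = cadj (\<Gamma> 0) $$ (a,l)" using al ix lnp ht_index[of "a mod p" l] by (simp add: X_def \<Gamma>_def)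
qed auto

text \<open>By \<open>\<Gamma>_A0\<close> the product \<open>X * A0\<close> is the Hankel matrix of
  the shifted sequence, hence Hermitian, and cancels in the difference. The imaginary term counts
  twice, because \<open>X * \<beta>\<close> is the adjoint of \<open>\<Gamma> 0\<close>.\<close>

lemma lyapunov: "X * A - cadj A * X = (2 * \<i>) \<cdot>\<^sub>m (cadj (\<Gamma> 0) * \<Gamma> 0)"
proof -
  have XA0: "(X * A0) $$ (a,b) = t (Suc (a div p) + b div p) $$ (a mod p, b mod p)" if "a < n * p" "b < n * p" for a b
    using that idx[of a] by (simp add: X_mult \<Gamma>_A0 del: index_mult_mat(1)) (simp add: \<Gamma>_def)
  have hXA0: "cadj (X * A0) = X * A0"
  proof (rule eq_matI)
    fix a b assume "a < dim_row (X * A0)" "b < dim_col (X * A0)"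
    hence ab: "a < n * p" "b < n * p" by auto
    show "cadj (X * A0) $$ (a,b) = (X * A0) $$ (a,b)"
      using ab idx[of a] idx[of b] by (simp add: XA0 ht_index add.commute del: index_mult_mat(1))
  qed auto
  have XA: "X * A = X * A0 + \<i> \<cdot>\<^sub>m (cadj (\<Gamma> 0) * \<Gamma> 0)"
    unfolding A_def X\<beta>[symmetric] by (simp add: mat_algebra)
  have "cadj A * X = cadj (X * A)" by (simp add: cadj_mult X_herm)
  also have "\<dots> = X * A0 - \<i> \<cdot>\<^sub>m (cadj (\<Gamma> 0) * \<Gamma> 0)"
    unfolding XA by (subst cadj_add) (auto simp: hXA0 cadj_smult cadj_mult intro!: eq_matI simp del: index_mult_mat(1))
  finally show ?thesis unfolding XA by (intro eq_matI) (auto simp del: index_mult_mat(1))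
qed

lemma A_carrier: "A \<in> carrier_mat (n * p) (n * p)" "A0 \<in> carrier_mat (n * p) (n * p)"
  by (auto intro!: carrier_matI)

text \<open>Along the orbit of \<open>u\<close> the perturbation of \<open>A0\<close> vanishes, so
  \<open>A\<close> acts there as \<open>A0\<close> and
  \<open>\<Gamma> k * u = \<Gamma> 0 A0^k u = 0\<close> for all \<open>k\<close>. The leading
  \<open>n\<close> of these products are the block rows of \<open>X * u\<close>.\<close>

lemma observable:
  assumes u: "u \<in> carrier_mat (n * p) q" and 0: "\<And>k. \<Gamma> 0 * ((*) A ^^ k) u = 0\<^sub>m p q"
  shows "X * u = 0\<^sub>m (n * p) q"
proof -
  have c: "((*) A ^^ j) u \<in> carrier_mat (n * p) q" for j by (rule funpow_mult_carrier[OF A_carrier(1) u])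
  have step: "A * ((*) A ^^ j) u = A0 * ((*) A ^^ j) u" for j
  proof -
    have "A * v = A0 * v + \<i> \<cdot>\<^sub>m (\<beta> * (\<Gamma> 0 * v))" if "dim_row v = n * p" for v
      unfolding A_def using that by (simp add: mat_algebra)
    from this[of "((*) A ^^ j) u"]
    have "A * ((*) A ^^ j) u = A0 * ((*) A ^^ j) u + \<i> \<cdot>\<^sub>m (\<beta> * (\<Gamma> 0 * ((*) A ^^ j) u))"
      using c[of j] by simp
    thus ?thesis unfolding 0 using c[of j] by (auto intro!: eq_matI simp del: index_mult_mat(1))
  qed
  have z: "\<Gamma> k * ((*) A ^^ j) u = 0\<^sub>m p q" for k j
  proof (induction k arbitrary: j)
    case (Suc k)
    have "\<Gamma> (Suc k) * ((*) A ^^ j) u = \<Gamma> k * (A0 * ((*) A ^^ j) u)"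
      unfolding \<Gamma>_A0[symmetric] using c[of j] by (simp add: mat_assoc)
    also have "\<dots> = \<Gamma> k * ((*) A ^^ Suc j) u" unfolding step[symmetric] by simp
    finally show ?case unfolding Suc .
  qed (rule 0)
  show ?thesis
  proof (rule eq_matI)
    fix a j assume "a < dim_row (0\<^sub>m (n * p) q :: complex mat)" "j < dim_col (0\<^sub>m (n * p) q :: complex mat)"
    hence aj: "a < n * p" "j < q" by auto
    have "(X * u) $$ (a,j) = (\<Gamma> (a div p) * u) $$ (a mod p, j)" using aj u by (intro X_mult) auto
    also have "\<Gamma> (a div p) * u = 0\<^sub>m p q" using z[of "a div p" 0] by simp
    finally show "(X * u) $$ (a,j) = 0\<^sub>m (n * p) q $$ (a,j)" using aj idx[of a] by simp
  qed (use u in auto)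
qed

text \<open>Block \<open>k\<close> is the polynomial part of \<open>Nn / z^(k+1)\<close>, a Horner
  quotient. \<open>Y\<close> stands for \<open>(zI - A0)^-1 \<beta> Nn\<close>, which is thereby
  seen to be polynomial.\<close>

definition Y where "Y = mat (n * p) p (\<lambda>(a,l). poly_shift (Suc (a div p)) (Nn $$ (a mod p, l)))"

lemma Y_dims[simp]: "dim_row Y = n * p" "dim_col Y = p" by (auto simp: Y_def)

lemma shift_step: "[:0,1:] * (poly_shift (Suc k) q :: complex poly) = poly_shift k q - [:coeff q k:]"
  by (rule poly_eqI) (auto simp: coeff_poly_shift coeff_pCons split: nat.split)

lemma pencil_entry:
  fixes Q :: "complex poly mat"
  assumes "dim_row Q = n * p" "a < n * p" "j < dim_col Q"
  shows "(pencil A0 * Q) $$ (a,j) = [:0,1:] * Q $$ (a,j) - (if p \<le> a then Q $$ (a - p, j) else 0)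
     + (\<Sum>c<p. [:inverse \<epsilon> * coeff (Nn $$ (a mod p, c)) (a div p):] * Q $$ ((n - 1) * p + c, j))"
proof -
  have "pencil A0 * Q = [:0,1:] \<cdot>\<^sub>m Q - const_mat S * Q + const_mat L * (const_mat G * Q)"
    unfolding pencil_def using assms(1) unfolding A0_def
    by (simp add: const_mat_minus const_mat_mult mat_algebra left_mult_one_mat') (intro eq_matI; simp del: index_mult_mat(1))
  moreover have "(const_mat L * (const_mat G * Q)) $$ (a,j) = (\<Sum>c<p. const_mat L $$ (a,c) * (const_mat G * Q) $$ (c,j))"
    using assms by (subst mult_entry) auto
  moreover have "\<dots> = (\<Sum>c<p. [:inverse \<epsilon> * coeff (Nn $$ (a mod p, c)) (a div p):] * Q $$ ((n - 1) * p + c, j))"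
    by (intro sum.cong refl) (use assms idx[OF assms(2)] in \<open>auto simp: G_mult L_def simp del: index_mult_mat(1)\<close>)
  ultimately show ?thesis using assms by (simp add: S_mult del: index_mult_mat(1))
qed

text \<open>By \<open>shift_step\<close> consecutive blocks telescope. The constants left over are
  cancelled by the last block column, as the last block of \<open>Y\<close> is
  \<open>\<epsilon>\<close> times the identity; in block row 0 there is no preceding block, and
  \<open>Nn\<close> remains.\<close>

lemma pencil_A0_Y: "pencil A0 * Y = const_mat \<beta> * Nn"
proof (rule eq_matI)
  fix a j assume "a < dim_row (const_mat \<beta> * Nn)" "j < dim_col (const_mat \<beta> * Nn)"
  hence aj: "a < n * p" "j < p" by auto
  note ix = idx[OF aj(1)]
  define q where "q = Nn $$ (a mod p, j)"
  define k where "k = a div p"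
  have top: "Y $$ ((n - 1) * p + c, j) = (if c = j then [:\<epsilon>:] else 0)" if c: "c < p" for c
  proof -
    have "((n - 1) * p + c) div p = n - 1" "((n - 1) * p + c) mod p = c" using c by auto
    hence "Y $$ ((n - 1) * p + c, j) = poly_shift n (Nn $$ (c,j))" using aj c ix last_idx[of c] by (simp add: Y_def)
    also have "\<dots> = [:coeff (Nn $$ (c,j)) n:]"
    proof (rule poly_eqI)
      fix i
      show "coeff (poly_shift n (Nn $$ (c,j))) i = coeff [:coeff (Nn $$ (c,j)) n:] i"
        using degN[OF c aj(2)] by (cases i) (auto simp: coeff_poly_shift coeff_eq_0)
    qed
    finally show ?thesis using lead[OF c aj(2)] by auto
  qed
  have "(\<Sum>c<p. [:inverse \<epsilon> * coeff (Nn $$ (a mod p, c)) (a div p):] * Y $$ ((n - 1) * p + c, j))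
     = (\<Sum>c<p. if c = j then [:coeff q k:] else 0)"
    by (rule sum.cong) (use \<epsilon> top in \<open>auto simp: q_def k_def\<close>)
  hence s: "(\<Sum>c<p. [:inverse \<epsilon> * coeff (Nn $$ (a mod p, c)) (a div p):] * Y $$ ((n - 1) * p + c, j)) = [:coeff q k:]"
    using aj by (simp add: sum.delta)
  have Ya: "Y $$ (a,j) = poly_shift (Suc k) q" using aj by (simp add: Y_def q_def k_def)
  have "(pencil A0 * Y) $$ (a,j) = [:0,1:] * Y $$ (a,j) - (if p \<le> a then Y $$ (a - p, j) else 0) + [:coeff q k:]"
    unfolding s[symmetric] by (rule pencil_entry) (use aj in auto)
  also have "\<dots> = poly_shift k q - (if p \<le> a then Y $$ (a - p, j) else 0)"
    unfolding Ya shift_step by simp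
  also have "\<dots> = (if a < p then Nn $$ (a,j) else 0)"
  proof (cases "a < p")
    case True
    hence "k = 0" "q = Nn $$ (a,j)" by (auto simp: k_def q_def)
    moreover have "poly_shift 0 q = q" by (rule poly_eqI) (simp add: coeff_poly_shift)
    ultimately show ?thesis using True by simp
  next
    case False
    have "Suc ((a - p) div p) = k" "(a - p) mod p = a mod p" using False ix unfolding k_def by (auto simp: le_div_geq le_mod_geq)
    hence "Y $$ (a - p, j) = poly_shift k q" using aj False by (simp add: Y_def q_def)
    thus ?thesis using False by simp
  qed
  also have "\<dots> = (const_mat \<beta> * Nn) $$ (a,j)" using aj by (simp add: \<beta>_mult del: index_mult_mat(1))
  finally show "(pencil A0 * Y) $$ (a,j) = (const_mat \<beta> * Nn) $$ (a,j)" .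
qed auto

text \<open>With \<open>pencil_A0_Y\<close> this is the realization identity
  \<open>\<Gamma> 0 (zI - A0)^-1 \<beta> = - D Nn^-1\<close>; comparison of coefficients is
  \<open>Dcoeff\<close>.\<close>

lemma \<Gamma>_Y: "const_mat (\<Gamma> 0) * Y = - D"
proof (rule eq_matI)
  fix i j assume "i < dim_row (- D)" "j < dim_col (- D)"
  hence ij: "i < p" "j < p" by auto
  have "(const_mat (\<Gamma> 0) * Y) $$ (i,j) = (\<Sum>b<n*p. const_mat (\<Gamma> 0) $$ (i,b) * Y $$ (b,j))" using ij by (subst mult_entry) auto
  also have "\<dots> = (\<Sum>k<n. \<Sum>c<p. const_mat (\<Gamma> 0) $$ (i,k * p + c) * Y $$ (k * p + c,j))" by (rule sum_blocks)
  also have "\<dots> = (\<Sum>k<n. \<Sum>c<p. Polynomial.smult (t k $$ (i,c)) (poly_shift (Suc k) (Nn $$ (c,j))))"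
    by (intro sum.cong refl) (use ij block_idx in \<open>auto simp: \<Gamma>_def Y_def\<close>)
  also have "\<dots> = - D $$ (i,j)"
    by (rule poly_eqI) (simp add: coeff_sum coeff_poly_shift Dcoeff[OF ij])
  finally show "(const_mat (\<Gamma> 0) * Y) $$ (i,j) = (- D) $$ (i,j)" using ij by simp
qed auto

text \<open>\<open>P\<close> and \<open>R\<close> certify that \<open>A0\<close> and
  \<open>\<beta>\<close> form a controllable pair. \<open>R\<close> is the block row
  \<open>I, zI, z^2 I, ...\<close>, and block column \<open>b\<close> of \<open>P\<close> is minus
  the quotient by \<open>pencil A0\<close> of \<open>z^b \<beta>\<close> less block column
  \<open>b\<close> of the identity.\<close>

definition P where "P = mat (n * p) (n * p) (\<lambda>(a,b). if a mod p = b mod p \<and> a div p < b div p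
   then - monom (1::complex) (b div p - Suc (a div p)) else 0)"
definition R where "R = mat p (n * p) (\<lambda>(l,b). if b mod p = l then monom (1::complex) (b div p) else 0)"

lemma PR_dims[simp]: "dim_row P = n * p" "dim_col P = n * p" "dim_row R = p" "dim_col R = n * p"
  by (auto simp: P_def R_def)

lemma z_monom: "[:0,1:] * monom (1::complex) k = monom 1 (Suc k)"
  by (simp add: monom_Suc)

lemma pencil_A0_P: "pencil A0 * P + const_mat \<beta> * R = 1\<^sub>m (n * p)"
proof (rule eq_matI)
  fix a b assume "a < dim_row (1\<^sub>m (n * p) :: complex poly mat)" "b < dim_col (1\<^sub>m (n * p) :: complex poly mat)"
  hence ab: "a < n * p" "b < n * p" by auto
  note ia = idx[OF ab(1)] and ib = idx[OF ab(2)]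
  \<comment> \<open>The last block row of \<open>P\<close> is zero, so the coefficients of
    \<open>Nn\<close> do not enter and only the shift acts.\<close>
  have z0: "(\<Sum>c<p. [:inverse \<epsilon> * coeff (Nn $$ (a mod p, c)) (a div p):] * P $$ ((n - 1) * p + c, b)) = 0"
  proof (rule sum.neutral, rule ballI)
    fix c assume "c \<in> {..<p}"
    hence c: "c < p" by simp
    have "\<not> ((n - 1) * p + c) div p < b div p" using c ib by auto
    thus "[:inverse \<epsilon> * coeff (Nn $$ (a mod p, c)) (a div p):] * P $$ ((n - 1) * p + c, b) = 0"
      using ab last_idx[OF ia(4) c] by (simp add: P_def)
  qed
  have "(pencil A0 * P) $$ (a,b) = [:0,1:] * P $$ (a,b) - (if p \<le> a then P $$ (a - p, b) else 0)
     + (\<Sum>c<p. [:inverse \<epsilon> * coeff (Nn $$ (a mod p, c)) (a div p):] * P $$ ((n - 1) * p + c, b))"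
    by (rule pencil_entry) (use ab in auto)
  hence ze: "(pencil A0 * P) $$ (a,b) = [:0,1:] * P $$ (a,b) - (if p \<le> a then P $$ (a - p, b) else 0)"
    unfolding z0 by (simp only: add_0_right)
  hence e: "(pencil A0 * P + const_mat \<beta> * R) $$ (a,b) = [:0,1:] * P $$ (a,b) - (if p \<le> a then P $$ (a - p, b) else 0)
     + (if a < p then R $$ (a,b) else 0)"
    using ab by (simp add: \<beta>_mult del: index_mult_mat(1) mult_pCons_left)
  have eq: "a = b \<longleftrightarrow> a mod p = b mod p \<and> a div p = b div p" by (metis mult_div_mod_eq)
  show "(pencil A0 * P + const_mat \<beta> * R) $$ (a,b) = 1\<^sub>m (n * p) $$ (a,b)"
  proof (cases "a mod p = b mod p")
    case False
    have "p \<le> a \<Longrightarrow> (a - p) mod p \<noteq> b mod p" using False by (simp add: le_mod_geq)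
    moreover have "a < p \<Longrightarrow> b mod p \<noteq> a" using False by auto
    ultimately show ?thesis unfolding e using ab False eq by (auto simp: P_def R_def)
  next
    case True
    have zP: "[:0,1:] * P $$ (a,b) = (if a div p < b div p then - monom 1 (b div p - a div p) else 0)"
      using ab True by (auto simp: P_def z_monom mult_minus_right Suc_diff_Suc simp del: mult_pCons_left)
    show ?thesis
    proof (cases "a < p")
      case lt: True
      hence "a div p = 0" "b mod p = a" using True by auto
      moreover have "R $$ (a,b) = monom 1 (b div p)" using ab lt \<open>b mod p = a\<close> by (simp add: R_def)
      ultimately show ?thesis unfolding e zP using ab lt eq by (auto simp: monom_0 one_pCons)
    next
      case ge: False
      have dm: "a div p = Suc ((a - p) div p)" "(a - p) mod p = b mod p" using ge ia True by (auto simp: le_div_geq le_mod_geq)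
      have "P $$ (a - p, b) = (if a div p \<le> b div p then - monom 1 (b div p - a div p) else 0)"
        using ab ge dm by (auto simp: P_def)
      thus ?thesis unfolding e zP using ab ge eq True by (auto simp: monom_0 one_pCons)
    qed
  qed
qed auto

lemma pencil_A: "dim_row Q = n * p \<Longrightarrow> pencil A * Q = pencil A0 * Q - [:\<i>:] \<cdot>\<^sub>m (const_mat \<beta> * (const_mat (\<Gamma> 0) * Q))"
  unfolding pencil_def A_def
  by (simp add: const_mat_add const_mat_smult const_mat_mult mat_algebra left_mult_one_mat') (intro eq_matI; simp del: index_mult_mat(1))

lemma pencil_A_Y: "pencil A * Y = const_mat \<beta> * (Nn + [:\<i>:] \<cdot>\<^sub>m D)"
  by (simp add: pencil_A pencil_A0_Y \<Gamma>_Y mat_algebra) (intro eq_matI; simp del: index_mult_mat(1))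

text \<open>Feedback preserves controllability: the additional term of \<open>pencil A\<close> has
  the left factor \<open>\<beta>\<close> and moves into \<open>R\<close>.\<close>

lemma pencil_A_P: "pencil A * P + const_mat \<beta> * (R + [:\<i>:] \<cdot>\<^sub>m (const_mat (\<Gamma> 0) * P)) = 1\<^sub>m (n * p)"
  unfolding pencil_A0_P[symmetric]
  by (simp add: pencil_A mat_algebra) (intro eq_matI; simp del: index_mult_mat(1))

lemma root_count:
  assumes Fh: "Fh \<in> carrier_mat p p" and M1: "M1 \<in> carrier_mat p p" and M2: "M2 \<in> carrier_mat p p"
    and U: "U \<in> carrier_mat p p" and V: "V \<in> carrier_mat p p"
    and N_eq: "Nn = M1 * Fh" and D_eq: "D = M2 * Fh" and bez: "U * M1 + V * M2 = 1\<^sub>m p"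
    and det: "det (Nn + [:\<i>:] \<cdot>\<^sub>m D) \<noteq> 0" "degree (det (Nn + [:\<i>:] \<cdot>\<^sub>m D)) \<le> n * p"
    and es: "char_poly X = (\<Prod>a\<leftarrow>es. [:-a,1:])"
  shows "roots_in (det (Nn + [:\<i>:] \<cdot>\<^sub>m D)) {z. Im z > 0} = length (filter (\<lambda>e. Re e > 0) es) + roots_in (det Fh) {z. Im z > 0}"
    "roots_in (det (Nn + [:\<i>:] \<cdot>\<^sub>m D)) {z. Im z < 0} = length (filter (\<lambda>e. Re e < 0) es) + roots_in (det Fh) {z. Im z < 0}"
proof -
  have c: "X \<in> carrier_mat (n * p) (n * p)" "\<beta> \<in> carrier_mat (n * p) p" "\<Gamma> 0 \<in> carrier_mat p (n * p)"
    "Y \<in> carrier_mat (n * p) p" "P \<in> carrier_mat (n * p) (n * p)"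
    "R + [:\<i>:] \<cdot>\<^sub>m (const_mat (\<Gamma> 0) * P) \<in> carrier_mat p (n * p)" "Nn + [:\<i>:] \<cdot>\<^sub>m D \<in> carrier_mat p p"
    by (auto intro!: carrier_matI)
  have [simp]: "dim_row M1 = p" "dim_col M1 = p" "dim_row M2 = p" "dim_col M2 = p" "dim_row Fh = p"
    using M1 M2 Fh by auto
  have gY: "const_mat (\<Gamma> 0) * Y = - (M2 * Fh)" unfolding \<Gamma>_Y D_eq ..
  have \<Phi>_eq: "Nn + [:\<i>:] \<cdot>\<^sub>m D = (M1 + [:\<i>:] \<cdot>\<^sub>m M2) * Fh"
    unfolding N_eq D_eq by (simp add: mat_algebra)
  note rc = realization_root_count[OF A_carrier(1) c(1) X_herm c(2,3) lyapunov observable c(4-7) Fh M1 M2 U V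
    pencil_A_Y gY pencil_A_P \<Phi>_eq bez det es]
  show "roots_in (det (Nn + [:\<i>:] \<cdot>\<^sub>m D)) {z. Im z > 0} = length (filter (\<lambda>e. Re e > 0) es) + roots_in (det Fh) {z. Im z > 0}"
    "roots_in (det (Nn + [:\<i>:] \<cdot>\<^sub>m D)) {z. Im z < 0} = length (filter (\<lambda>e. Re e < 0) es) + roots_in (det Fh) {z. Im z < 0}"
    by (rule rc; assumption)+
qed

end

section \<open>Greatest common right divisors and determinants of polynomial matrices\<close>

text \<open>Polynomials form a principal ideal domain, so a submodule of the \<open>p\<close>-th
  power has \<open>p\<close> generators. The last coordinates form an ideal generated by
  \<open>h p\<close>, and subtracting a multiple of \<open>h\<close> leads to the elements with last
  coordinate zero. Vectors are functions of which only the arguments below \<open>p\<close>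
  count.\<close>

lemma submodule_basis:
  fixes S :: "(nat \<Rightarrow> complex poly) set"
  assumes "(\<lambda>_. 0) \<in> S" "\<And>f g. f \<in> S \<Longrightarrow> g \<in> S \<Longrightarrow> (\<lambda>i. f i + g i) \<in> S" "\<And>c f. f \<in> S \<Longrightarrow> (\<lambda>i. c * f i) \<in> S"
  shows "\<exists>g. (\<forall>j<p. g j \<in> S) \<and> (\<forall>v\<in>S. \<exists>c. \<forall>i<p. v i = (\<Sum>j<p. c j * g j i))"
  using assms
proof (induction p arbitrary: S)
  case 0
  show ?case by simp
next
  case (Suc p)
  define S' where "S' = {v \<in> S. v p = 0}"
  have "\<exists>g. (\<forall>j<p. g j \<in> S') \<and> (\<forall>v\<in>S'. \<exists>c. \<forall>i<p. v i = (\<Sum>j<p. c j * g j i))"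
    by (rule Suc.IH) (use Suc.prems in \<open>auto simp: S'_def\<close>)
  then obtain g where g: "\<And>j. j < p \<Longrightarrow> g j \<in> S'" "\<And>v. v \<in> S' \<Longrightarrow> \<exists>c. \<forall>i<p. v i = (\<Sum>j<p. c j * g j i)" by blast
  \<comment> \<open>A last coordinate of least degree among the nonzero ones divides all others, by
    division with remainder. If all of them vanish, the zero vector is taken.\<close>
  obtain h where h: "h \<in> S" "\<And>v. v \<in> S \<Longrightarrow> h p dvd v p"
  proof (cases "\<forall>v\<in>S. v p = 0")
    case True
    thus thesis using that[of "\<lambda>_. 0"] Suc.prems(1) by simp
  next
    case False
    define Q where "Q = (\<lambda>d. \<exists>v\<in>S. v p \<noteq> 0 \<and> degree (v p) = d)"
    have "\<exists>d. Q d" using False unfolding Q_def by blast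
    hence "Q (LEAST d. Q d)" by (rule LeastI_ex)
    then obtain h where h: "h \<in> S" "h p \<noteq> 0" "degree (h p) = (LEAST d. Q d)" unfolding Q_def by blast
    have "h p dvd v p" if v: "v \<in> S" for v
    proof (rule ccontr)
      assume nd: "\<not> h p dvd v p"
      hence nz: "v p mod h p \<noteq> 0" by (simp add: mod_eq_0_iff_dvd)
      define w where "w = (\<lambda>i. v i + (- (v p div h p)) * h i)"
      have "w \<in> S" unfolding w_def by (rule Suc.prems(2)[OF v Suc.prems(3)[OF h(1)]])
      moreover have wp: "w p = v p mod h p" unfolding w_def by (simp add: minus_div_mult_eq_mod[symmetric])
      ultimately have "Q (degree (v p mod h p))" unfolding Q_def using nz by metis
      hence "(LEAST d. Q d) \<le> degree (v p mod h p)" by (rule Least_le)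
      moreover have "degree (v p mod h p) < degree (h p)" using degree_mod_less[OF h(2), of "v p"] nz by auto
      ultimately show False using h(3) by simp
    qed
    thus thesis using that h(1) by blast
  qed
  define g' where "g' = (\<lambda>j. if j < p then g j else h)"
  show ?case
  proof (intro exI[of _ g'] conjI allI impI ballI)
    fix j assume "j < Suc p"
    thus "g' j \<in> S" using g(1)[of j] h(1) unfolding g'_def S'_def by auto
  next
    fix v assume v: "v \<in> S"
    obtain q where q: "v p = h p * q" using h(2)[OF v] by (auto simp: dvd_def)
    define w where "w = (\<lambda>i. v i + (- q) * h i)"
    have "w \<in> S" unfolding w_def by (rule Suc.prems(2)[OF v Suc.prems(3)[OF h(1)]])
    hence "w \<in> S'" unfolding S'_def using q by (simp add: w_def)
    then obtain c where c: "\<And>i. i < p \<Longrightarrow> w i = (\<Sum>j<p. c j * g j i)" using g(2) by blast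
    define c' where "c' = (\<lambda>j. if j < p then c j else q)"
    have sum: "(\<Sum>j<Suc p. c' j * g' j i) = (\<Sum>j<p. c j * g j i) + q * h i" for i
      unfolding c'_def g'_def by simp
    show "\<exists>c. \<forall>i<Suc p. v i = (\<Sum>j<Suc p. c j * g' j i)"
    proof (intro exI[of _ c'] allI impI)
      fix i assume "i < Suc p"
      show "v i = (\<Sum>j<Suc p. c' j * g' j i)"
      proof (cases "i < p")
        case True
        thus ?thesis unfolding sum c[OF True, symmetric] by (simp add: w_def)
      next
        case False
        hence i: "i = p" using \<open>i < Suc p\<close> by simp
        have "(\<Sum>j<p. c j * g j p) = 0" using g(1) by (intro sum.neutral) (auto simp: S'_def)
        thus ?thesis unfolding sum i using q by simp
      qed
    qed
  qed
qed

text \<open>The rows of \<open>F1\<close> and \<open>F2\<close> span a module with \<open>p\<close>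
  generators, the rows of \<open>G = U F1 + V F2\<close>. As \<open>G\<close> is a common right
  divisor, the maximality of \<open>Fh\<close> gives \<open>Fh = L * G\<close>; then
  \<open>Fh = (L U M1 + L V M2) Fh\<close>, and \<open>Fh\<close> cancels if its determinant is
  nonzero.\<close>

lemma gcrd_bezout:
  assumes F1: "F1 \<in> carrier_mat p p" and F2: "F2 \<in> carrier_mat p p" and gcd: "is_gcrd p Fh F1 F2"
  shows "\<exists>M1\<in>carrier_mat p p. \<exists>M2\<in>carrier_mat p p. F1 = M1 * Fh \<and> F2 = M2 * Fh \<and>
    (det Fh \<noteq> 0 \<longrightarrow> (\<exists>U\<in>carrier_mat p p. \<exists>V\<in>carrier_mat p p. U * M1 + V * M2 = 1\<^sub>m p))"
proof -
  from gcd obtain M1 M2 where Fh: "Fh \<in> carrier_mat p p" and M: "M1 \<in> carrier_mat p p" "M2 \<in> carrier_mat p p"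
    "F1 = M1 * Fh" "F2 = M2 * Fh" unfolding is_gcrd_def right_divisor_def by blast
  have d[simp]: "dim_row F1 = p" "dim_col F1 = p" "dim_row F2 = p" "dim_col F2 = p" using F1 F2 by auto
  define S where "S = {v. \<exists>x y. \<forall>i<p. v i = (\<Sum>a<p. x a * F1 $$ (a,i)) + (\<Sum>a<p. y a * F2 $$ (a,i))}"
  have "\<exists>g. (\<forall>j<p. g j \<in> S) \<and> (\<forall>v\<in>S. \<exists>c. \<forall>i<p. v i = (\<Sum>j<p. c j * g j i))"
  proof (rule submodule_basis)
    show "(\<lambda>_. 0) \<in> S" unfolding S_def by (auto intro!: exI[of _ "\<lambda>_. 0"])
    fix f g c assume "f \<in> S"
    then obtain x y where xy: "\<And>i. i < p \<Longrightarrow> f i = (\<Sum>a<p. x a * F1 $$ (a,i)) + (\<Sum>a<p. y a * F2 $$ (a,i))"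
      unfolding S_def by blast
    show "(\<lambda>i. c * f i) \<in> S" unfolding S_def
      by (intro CollectI exI[of _ "\<lambda>a. c * x a"] exI[of _ "\<lambda>a. c * y a"]) (auto simp: xy sum_distrib_left algebra_simps)
    assume "g \<in> S"
    then obtain x' y' where xy': "\<And>i. i < p \<Longrightarrow> g i = (\<Sum>a<p. x' a * F1 $$ (a,i)) + (\<Sum>a<p. y' a * F2 $$ (a,i))"
      unfolding S_def by blast
    show "(\<lambda>i. f i + g i) \<in> S" unfolding S_def
      by (intro CollectI exI[of _ "\<lambda>a. x a + x' a"] exI[of _ "\<lambda>a. y a + y' a"]) (auto simp: xy xy' sum.distrib algebra_simps)
  qed
  then obtain g where g: "\<And>j. j < p \<Longrightarrow> g j \<in> S" "\<And>v. v \<in> S \<Longrightarrow> \<exists>c. \<forall>i<p. v i = (\<Sum>j<p. c j * g j i)" by blast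
  have "\<forall>j. \<exists>w. j < p \<longrightarrow> (\<forall>i<p. g j i = (\<Sum>a<p. fst w a * F1 $$ (a,i)) + (\<Sum>a<p. snd w a * F2 $$ (a,i)))"
  proof
    fix j
    show "\<exists>w. j < p \<longrightarrow> (\<forall>i<p. g j i = (\<Sum>a<p. fst w a * F1 $$ (a,i)) + (\<Sum>a<p. snd w a * F2 $$ (a,i)))"
    proof (cases "j < p")
      case True
      from g(1)[OF True] obtain x y where "\<forall>i<p. g j i = (\<Sum>a<p. x a * F1 $$ (a,i)) + (\<Sum>a<p. y a * F2 $$ (a,i))"
        unfolding S_def by blast
      thus ?thesis by (intro exI[of _ "(x, y)"]) simp
    qed simp
  qed
  from choice[OF this] obtain W where W: "\<forall>j. j < p \<longrightarrow> (\<forall>i<p. g j i =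
      (\<Sum>a<p. fst (W j) a * F1 $$ (a,i)) + (\<Sum>a<p. snd (W j) a * F2 $$ (a,i)))" ..
  define x where "x = (\<lambda>j. fst (W j))"
  define y where "y = (\<lambda>j. snd (W j))"
  have xy: "g j i = (\<Sum>a<p. x j a * F1 $$ (a,i)) + (\<Sum>a<p. y j a * F2 $$ (a,i))" if "j < p" "i < p" for j i
    using W that unfolding x_def y_def by blast
  define G where "G = mat p p (\<lambda>(j,i). g j i)"
  define U where "U = mat p p (\<lambda>(j,a). x j a)"
  define V where "V = mat p p (\<lambda>(j,a). y j a)"
  have c: "G \<in> carrier_mat p p" "U \<in> carrier_mat p p" "V \<in> carrier_mat p p" unfolding G_def U_def V_def by auto
  have dG[simp]: "dim_row G = p" "dim_col G = p" "dim_row U = p" "dim_col U = p" "dim_row V = p" "dim_col V = p" using c by auto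
  have G_eq: "G = U * F1 + V * F2"
    by (rule eq_matI) (auto simp: mult_entry xy G_def U_def V_def simp del: index_mult_mat(1))
  have rows: "right_divisor p G Q" if Q: "Q \<in> carrier_mat p p" and mem: "\<And>a. a < p \<Longrightarrow> (\<lambda>i. Q $$ (a,i)) \<in> S" for Q
  proof -
    have "\<forall>a. \<exists>c. a < p \<longrightarrow> (\<forall>i<p. Q $$ (a,i) = (\<Sum>j<p. c j * g j i))" using g(2)[OF mem] by blast
    from choice[OF this] obtain c where c: "\<forall>a. a < p \<longrightarrow> (\<forall>i<p. Q $$ (a,i) = (\<Sum>j<p. c a j * g j i))" ..
    have "Q = mat p p (\<lambda>(a,j). c a j) * G"
      by (rule eq_matI) (use Q in \<open>auto simp: mult_entry c G_def simp del: index_mult_mat(1)\<close>)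
    thus ?thesis unfolding right_divisor_def using \<open>G \<in> carrier_mat p p\<close> by (intro conjI bexI[of _ "mat p p (\<lambda>(a,j). c a j)"]) auto
  qed
  have delta: "(\<Sum>b<p. (if b = a then 1 else 0) * Q $$ (b,i)) = Q $$ (a,i)" if "a < p" for a i and Q :: "complex poly mat"
  proof -
    have "(\<Sum>b<p. (if b = a then 1 else 0) * Q $$ (b,i)) = (\<Sum>b<p. if b = a then Q $$ (b,i) else 0)"
      by (rule sum.cong) auto
    thus ?thesis using that by (simp add: sum.delta)
  qed
  have "right_divisor p G F1"
  proof (rule rows[OF F1])
    fix a assume "a < p"
    thus "(\<lambda>i. F1 $$ (a,i)) \<in> S" unfolding S_def
      by (intro CollectI exI[of _ "\<lambda>b. if b = a then 1 else 0"] exI[of _ "\<lambda>_. 0"]) (simp only: delta, simp)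
  qed
  moreover have "right_divisor p G F2"
  proof (rule rows[OF F2])
    fix a assume "a < p"
    thus "(\<lambda>i. F2 $$ (a,i)) \<in> S" unfolding S_def
      by (intro CollectI exI[of _ "\<lambda>_. 0"] exI[of _ "\<lambda>b. if b = a then 1 else 0"]) (simp only: delta, simp)
  qed
  ultimately have "right_divisor p G Fh" using gcd unfolding is_gcrd_def by blast
  then obtain L where L: "L \<in> carrier_mat p p" "Fh = L * G" unfolding right_divisor_def by blast
  have [simp]: "dim_row L = p" "dim_col L = p" "dim_row M1 = p" "dim_col M1 = p" "dim_row M2 = p" "dim_col M2 = p"
    "dim_row Fh = p" "dim_col Fh = p" using L M Fh by auto
  have "\<exists>U\<in>carrier_mat p p. \<exists>V\<in>carrier_mat p p. U * M1 + V * M2 = 1\<^sub>m p" if "det Fh \<noteq> 0"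
  proof (rule bexI[of _ "L * U"], rule bexI[of _ "L * V"])
    have "((L * U) * M1 + (L * V) * M2) * Fh = L * (U * F1 + V * F2)" unfolding M(3,4) by (simp add: mat_algebra)
    also have "\<dots> = 1\<^sub>m p * Fh" unfolding G_eq[symmetric] L(2)[symmetric] by (simp add: left_mult_one_mat')
    finally have e: "((L * U) * M1 + (L * V) * M2) * Fh = 1\<^sub>m p * Fh" .
    show "(L * U) * M1 + (L * V) * M2 = 1\<^sub>m p"
      by (rule right_cancel_mat_eq[OF Fh that _ _ e, where k = p]) (auto intro!: carrier_matI)
  qed (auto intro!: carrier_matI)
  thus ?thesis using M by blast
qed

section \<open>Leading coefficients of determinants, rotated zeros, permuted indices\<close>

lemma coeff_mult_bound:
  fixes f g :: "complex poly"
  assumes "degree f \<le> a" "degree g \<le> b"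
  shows "coeff (f * g) (a + b) = coeff f a * coeff g b"
proof -
  have "coeff (f * g) (a + b) = (\<Sum>i\<le>a+b. coeff f i * coeff g (a + b - i))" by (rule coeff_mult)
  also have "\<dots> = (\<Sum>i\<le>a+b. if i = a then coeff f a * coeff g b else 0)"
  proof (rule sum.cong)
    fix i
    consider "i < a" | "i = a" | "i > a" by linarith
    thus "coeff f i * coeff g (a + b - i) = (if i = a then coeff f a * coeff g b else 0)"
      using assms by cases (auto simp: coeff_eq_0)
  qed simp
  finally show ?thesis by (simp add: sum.delta)
qed

lemma coeff_prod_bound:
  fixes f :: "nat \<Rightarrow> complex poly"
  assumes "\<And>i. i < k \<Longrightarrow> degree (f i) \<le> n"
  shows "degree (\<Prod>i<k. f i) \<le> n * k \<and> coeff (\<Prod>i<k. f i) (n * k) = (\<Prod>i<k. coeff (f i) n)"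
  using assms
proof (induction k)
  case (Suc k)
  have IH: "degree (\<Prod>i<k. f i) \<le> n * k" "coeff (\<Prod>i<k. f i) (n * k) = (\<Prod>i<k. coeff (f i) n)" using Suc by auto
  have fk: "degree (f k) \<le> n" using Suc.prems by simp
  have "degree ((\<Prod>i<k. f i) * f k) \<le> n * k + n" using degree_mult_le[of "\<Prod>i<k. f i" "f k"] IH(1) fk by linarith
  moreover have "coeff ((\<Prod>i<k. f i) * f k) (n * k + n) = (\<Prod>i<k. coeff (f i) n) * coeff (f k) n"
    using coeff_mult_bound[OF IH(1) fk] IH(2) by simp
  ultimately show ?case by (simp add: add.commute)
qed simp

text \<open>In the Leibniz formula a product of \<open>p\<close> entries of degree at most
  \<open>n\<close> reaches degree \<open>n * p\<close> only through the coefficients of order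
  \<open>n\<close>. For monic \<open>F\<close> this makes \<open>det F\<close> monic of degree
  \<open>n * p\<close>.\<close>

lemma coeff_det:
  fixes Q :: "complex poly mat"
  assumes Q: "Q \<in> carrier_mat p p" and deg: "\<And>i j. i < p \<Longrightarrow> j < p \<Longrightarrow> degree (Q $$ (i,j)) \<le> n"
  shows "coeff (det Q) (n * p) = det (mcoeff Q n)"
proof -
  have M: "mcoeff Q n \<in> carrier_mat p p" using Q unfolding mcoeff_def by auto
  have "coeff (signof \<pi> * (\<Prod>i<p. Q $$ (i, \<pi> i))) (n * p) = signof \<pi> * (\<Prod>i<p. mcoeff Q n $$ (i, \<pi> i))"
    if \<pi>: "\<pi> permutes {0..<p}" for \<pi>
  proof -
    have lt: "\<pi> i < p" if "i < p" for i using permutes_in_image[OF \<pi>, of i] that by auto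
    have "coeff (\<Prod>i<p. Q $$ (i, \<pi> i)) (n * p) = (\<Prod>i<p. coeff (Q $$ (i, \<pi> i)) n)"
      using coeff_prod_bound[of p "\<lambda>i. Q $$ (i, \<pi> i)" n] deg lt by auto
    also have "\<dots> = (\<Prod>i<p. mcoeff Q n $$ (i, \<pi> i))" using lt Q by (intro prod.cong) (auto simp: mcoeff_def)
    finally show ?thesis by (cases "sign \<pi> = 1") (auto simp: sign_def)
  qed
  thus ?thesis unfolding det_def'[OF Q] det_def'[OF M] coeff_sum atLeast0LessThan[symmetric]
    by (intro sum.cong) (auto simp: atLeast0LessThan)
qed

text \<open>A factor \<open>z - a\<close> becomes \<open>\<i> z - a = \<i> (z - (- \<i> a))\<close>,
  so every root is multiplied by \<open>- \<i>\<close> and keeps its multiplicity.\<close>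

lemma roots_in_rotate:
  assumes "q \<noteq> 0"
  shows "roots_in (pcompose q [:0,\<i>:]) S = roots_in q ((\<lambda>z. \<i> * z) ` S)"
proof -
  obtain as where as: "Polynomial.smult (lead_coeff q) (\<Prod>a\<leftarrow>as. [:-a,1:]) = q" "length as = degree q"
    using fundamental_theorem_algebra_factorized[of q] by blast
  have c: "lead_coeff q \<noteq> 0" using assms by simp
  have nz: "(\<Prod>a\<leftarrow>as. [:-a,1:]) \<noteq> (0 :: complex poly)" for as by (auto simp: prod_list_zero_iff)
  have pc: "pcompose (\<Prod>a\<leftarrow>as. [:-a,1:]) [:0,\<i>:] = Polynomial.smult (\<i> ^ length as) (\<Prod>a\<leftarrow>map (\<lambda>a. - \<i> * a) as. [:-a,1:])" for as
  proof (induction as)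
    case (Cons a as)
    have "pcompose [:-a,1:] [:0,\<i>:] = Polynomial.smult \<i> [:- (- \<i> * a), 1:]" by (simp add: pcompose_pCons)
    hence "pcompose (\<Prod>a\<leftarrow>a # as. [:-a,1:]) [:0,\<i>:] =
      Polynomial.smult \<i> [:- (- \<i> * a), 1:] * Polynomial.smult (\<i> ^ length as) (\<Prod>a\<leftarrow>map (\<lambda>a. - \<i> * a) as. [:-a,1:])"
      by (simp only: list.map prod_list.Cons pcompose_mult Cons)
    thus ?case by (simp only: list.map prod_list.Cons length_Cons mult_smult_left mult_smult_right smult_smult power_Suc mult.commute)
  qed (simp add: one_pCons)
  have "pcompose q [:0,\<i>:] = Polynomial.smult (lead_coeff q * \<i> ^ length as) (\<Prod>a\<leftarrow>map (\<lambda>a. - \<i> * a) as. [:-a,1:])"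
    by (subst as(1)[symmetric]) (simp only: pc pcompose_smult smult_smult)
  moreover have "lead_coeff q * \<i> ^ length as \<noteq> 0" using c by simp
  ultimately have "roots_in (pcompose q [:0,\<i>:]) S = length (filter (\<lambda>a. a \<in> S) (map (\<lambda>a. - \<i> * a) as))"
    by (simp only: roots_in_smult[OF _ nz] roots_in_linear_factors not_False_eq_True)
  also have "\<dots> = length (filter (\<lambda>a. a \<in> (\<lambda>z. \<i> * z) ` S) as)"
  proof -
    have "(- \<i> * a \<in> S) = (a \<in> (\<lambda>z. \<i> * z) ` S)" for a
    proof
      assume "- \<i> * a \<in> S"
      thus "a \<in> (\<lambda>z. \<i> * z) ` S" by (intro image_eqI[of _ _ "- \<i> * a"]) auto
    qed auto
    thus ?thesis by (simp add: filter_map o_def)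
  qed
  also have "\<dots> = roots_in q ((\<lambda>z. \<i> * z) ` S)"
    using roots_in_smult[OF c nz[of as], of "(\<lambda>z. \<i> * z) ` S"] unfolding as roots_in_linear_factors ..
  finally show ?thesis .
qed

text \<open>Similarity by a permutation matrix: injectivity of \<open>\<sigma>\<close> makes
  \<open>P * Q\<close> the identity, and for square matrices the other product follows.\<close>

lemma char_poly_reindex:
  fixes X :: "complex mat"
  assumes X: "X \<in> carrier_mat N N" and \<sigma>: "inj_on \<sigma> {..<N}" "\<And>c. c < N \<Longrightarrow> \<sigma> c < N"
  shows "char_poly (mat N N (\<lambda>(c,c'). X $$ (\<sigma> c, \<sigma> c'))) = char_poly X"
proof -
  define P where "P = mat N N (\<lambda>(c,a). if a = \<sigma> c then 1 else (0::complex))"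
  define Q where "Q = mat N N (\<lambda>(a,c). if a = \<sigma> c then 1 else (0::complex))"
  have c: "P \<in> carrier_mat N N" "Q \<in> carrier_mat N N" unfolding P_def Q_def by auto
  have [simp]: "dim_row P = N" "dim_col P = N" "dim_row Q = N" "dim_col Q = N" "dim_row X = N" "dim_col X = N" using c X by auto
  have Pm: "(P * W) $$ (c,j) = W $$ (\<sigma> c, j)" if "c < N" "j < dim_col W" "dim_row W = N" for W c j
  proof -
    have "(P * W) $$ (c,j) = (\<Sum>a<N. P $$ (c,a) * W $$ (a,j))" using that by (subst mult_entry) auto
    also have "\<dots> = (\<Sum>a<N. if a = \<sigma> c then W $$ (a,j) else 0)"
      by (rule sum.cong) (use that in \<open>auto simp: P_def\<close>)
    finally show ?thesis using \<sigma>(2)[OF that(1)] by (simp add: sum.delta)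
  qed
  have Qm: "(W * Q) $$ (i,c) = W $$ (i, \<sigma> c)" if "c < N" "i < dim_row W" "dim_col W = N" for W c i
  proof -
    have "(W * Q) $$ (i,c) = (\<Sum>a<N. W $$ (i,a) * Q $$ (a,c))" using that by (subst mult_entry) auto
    also have "\<dots> = (\<Sum>a<N. if a = \<sigma> c then W $$ (i,a) else 0)"
      by (rule sum.cong) (use that in \<open>auto simp: Q_def\<close>)
    finally show ?thesis using \<sigma>(2)[OF that(1)] by (simp add: sum.delta)
  qed
  have PQ: "P * Q = 1\<^sub>m N"
    by (rule eq_matI) (use \<sigma> in \<open>auto simp: Pm Q_def inj_on_eq_iff simp del: index_mult_mat(1)\<close>)
  have QP: "Q * P = 1\<^sub>m N" using mat_mult_left_right_inverse[OF c PQ] .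
  have "similar_mat (mat N N (\<lambda>(c,c'). X $$ (\<sigma> c, \<sigma> c'))) X"
  proof (rule similar_matI)
    show "mat N N (\<lambda>(c,c'). X $$ (\<sigma> c, \<sigma> c')) = P * X * Q"
      by (rule eq_matI) (use \<sigma> in \<open>auto simp: Pm Qm simp del: index_mult_mat(1)\<close>)
  qed (use c X PQ QP in auto)
  thus ?thesis by (rule char_poly_similar)
qed

section \<open>Laurent expansions\<close>

text \<open>Once the lower coefficients are known to vanish, division by \<open>u ^ N\<close> leaves
  a series that tends to \<open>c N\<close> at 0 and is zero elsewhere. The point 0 is excluded
  because \<open>u\<close> will be the inverse of \<open>z\<close>.\<close>

lemma powser_zero_coeffs:
  fixes c :: "nat \<Rightarrow> complex"
  assumes r: "r > 0" and z: "\<And>u. u \<noteq> 0 \<Longrightarrow> cmod u < r \<Longrightarrow> (\<lambda>n. c n * u ^ n) sums 0"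
  shows "c N = 0"
proof (induction N rule: less_induct)
  case (less N)
  have "(\<lambda>n. c (n + N) * u ^ n) sums 0" if u: "u \<noteq> 0" "cmod u < r" for u
  proof -
    have "(\<Sum>i<N. c i * u ^ i) = 0" using less by (intro sum.neutral) auto
    hence "(\<lambda>n. c (n + N) * u ^ (n + N)) sums 0"
      using z[OF u] sums_iff_shift[of "\<lambda>n. c n * u ^ n" N 0] by simp
    from sums_mult[OF this, of "inverse (u ^ N)"] show ?thesis using u(1) by (simp add: power_add field_simps)
  qed
  hence "((\<lambda>_::complex. 0) \<longlongrightarrow> c (0 + N)) (at 0)"
    using powser_limit_0_strong[OF r, of "\<lambda>n. c (n + N)" "\<lambda>_. 0"] by (simp add: dist_norm)
  hence "c (0 + N) = 0" by (rule LIM_unique) (rule tendsto_const)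
  thus ?case by simp
qed

text \<open>In terms of \<open>u = 1 / z\<close> and multiplied by \<open>u ^ B\<close>, both sides
  of the product formula are power series, with coefficients \<open>C\<close> and \<open>D\<close>.
  At \<open>u ^ (B + 1 + l)\<close> the right side has none, being polynomial in \<open>z\<close>,
  which gives the recurrence; at \<open>u ^ (B - d)\<close> stands the coefficient of
  \<open>r\<close>.\<close>

lemma laurent_product_coeffs:
  fixes a :: "nat \<Rightarrow> nat \<Rightarrow> complex" and q :: "nat \<Rightarrow> complex poly"
  assumes w: "\<And>z c. R < cmod z \<Longrightarrow> c < p \<Longrightarrow> (\<lambda>k. a c k * inverse (z ^ Suc k)) sums w c z"
    and prod: "\<And>z. R < cmod z \<Longrightarrow> (\<Sum>c<p. w c z * poly (q c) z) = poly r z"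
    and deg: "\<And>c. c < p \<Longrightarrow> degree (q c) \<le> n"
  shows "(\<Sum>m\<le>n. \<Sum>c<p. a c (m + l) * coeff (q c) m) = 0"
    "coeff r d = (\<Sum>k<n. \<Sum>c<p. a c k * coeff (q c) (d + k + 1))"
proof -
  \<comment> \<open>Large enough to cover \<open>n\<close> and the degree of \<open>r\<close>, so
    that no negative power of \<open>u\<close> occurs on either side.\<close>
  define B where "B = n + degree r"
  define C where "C = (\<lambda>N. \<Sum>c<p. \<Sum>m\<le>n. coeff (q c) m * (if B + 1 - m \<le> N then a c (N - (B + 1 - m)) else 0))"
  define D where "D = (\<lambda>N. if N \<le> B then coeff r (B - N) else 0)"
  define \<rho> where "\<rho> = 1 / (\<bar>R\<bar> + 1)"
  have \<rho>: "\<rho> > 0" unfolding \<rho>_def by simp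
  have ser: "(\<lambda>N. (C N - D N) * u ^ N) sums 0" if u: "u \<noteq> 0" "cmod u < \<rho>" for u
  proof -
    define z where "z = inverse u"
    have z0: "z \<noteq> 0" and uz: "u = inverse z" using u z_def by auto
    have Rz: "R < cmod z"
    proof -
      have "\<bar>R\<bar> + 1 < 1 / cmod u" using u unfolding \<rho>_def by (simp add: field_simps)
      thus ?thesis unfolding z_def by (simp add: norm_inverse divide_inverse)
    qed
    have one: "(\<lambda>N. (if B + 1 - m \<le> N then a c (N - (B + 1 - m)) else 0) * u ^ N) sums (w c z * u ^ (B - m))"
      if cm: "c < p" "m \<le> n" for c m
    proof -
      have mB: "m \<le> B" using cm unfolding B_def by simp
      have "(\<lambda>k. a c k * inverse (z ^ Suc k) * u ^ (B - m)) sums (w c z * u ^ (B - m))"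
        by (rule sums_mult2[OF w[OF Rz cm(1)]])
      moreover have "a c k * inverse (z ^ Suc k) * u ^ (B - m) = a c k * u ^ (k + (B + 1 - m))" for k
      proof -
        have "k + (B + 1 - m) = Suc k + (B - m)" using mB by simp
        thus ?thesis unfolding uz by (simp only: power_add power_inverse mult.assoc)
      qed
      ultimately have s: "(\<lambda>k. a c k * u ^ (k + (B + 1 - m))) sums (w c z * u ^ (B - m))" by (simp only:)
      have "(\<lambda>N. (\<lambda>N. (if B + 1 - m \<le> N then a c (N - (B + 1 - m)) else 0) * u ^ N) (N + (B + 1 - m))) sums (w c z * u ^ (B - m))"
        using s by simp
      thus ?thesis
        by (subst (asm) sums_iff_shift) simp
    qed
    have "(\<lambda>N. \<Sum>c<p. \<Sum>m\<le>n. coeff (q c) m * ((if B + 1 - m \<le> N then a c (N - (B + 1 - m)) else 0) * u ^ N))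
       sums (\<Sum>c<p. \<Sum>m\<le>n. coeff (q c) m * (w c z * u ^ (B - m)))"
      by (intro sums_sum sums_mult one) auto
    also have "(\<lambda>N. \<Sum>c<p. \<Sum>m\<le>n. coeff (q c) m * ((if B + 1 - m \<le> N then a c (N - (B + 1 - m)) else 0) * u ^ N)) = (\<lambda>N. C N * u ^ N)"
      unfolding C_def by (simp add: sum_distrib_right mult.assoc)
    also have "(\<Sum>c<p. \<Sum>m\<le>n. coeff (q c) m * (w c z * u ^ (B - m))) = (\<Sum>c<p. w c z * poly (q c) z) * u ^ B"
    proof -
      have "(\<Sum>m\<le>n. coeff (q c) m * (w c z * u ^ (B - m))) = w c z * poly (q c) z * u ^ B" if c: "c < p" for c
      proof -
        have pq: "poly (q c) z = (\<Sum>m\<le>n. coeff (q c) m * z ^ m)"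
          unfolding poly_altdef using deg[OF c]
          by (intro sum.mono_neutral_left) (auto simp: coeff_eq_0)
        have zu: "z ^ m * u ^ B = u ^ (B - m)" if "m \<le> n" for m
        proof -
          have "u ^ B = u ^ (B - m) * u ^ m" using that unfolding B_def by (simp add: power_add[symmetric])
          thus ?thesis unfolding uz using z0 by (simp add: power_inverse)
        qed
        have "w c z * poly (q c) z * u ^ B = (\<Sum>m\<le>n. coeff (q c) m * (w c z * (z ^ m * u ^ B)))"
          unfolding pq by (simp add: sum_distrib_left sum_distrib_right ac_simps)
        also have "\<dots> = (\<Sum>m\<le>n. coeff (q c) m * (w c z * u ^ (B - m)))"
          by (intro sum.cong refl) (simp add: zu)
        finally show ?thesis ..
      qed
      thus ?thesis by (simp add: sum_distrib_right)
    qed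
    also have "\<dots> = poly r z * u ^ B" unfolding prod[OF Rz] ..
    finally have s1: "(\<lambda>N. C N * u ^ N) sums (poly r z * u ^ B)" .
    have "(\<lambda>N. D N * u ^ N) sums (\<Sum>N\<le>B. D N * u ^ N)"
      by (rule sums_finite) (auto simp: D_def)
    also have "(\<Sum>N\<le>B. D N * u ^ N) = (\<Sum>d\<le>B. coeff r d * u ^ (B - d))"
      by (rule sum.reindex_bij_witness[of _ "\<lambda>d. B - d" "\<lambda>d. B - d"]) (auto simp: D_def)
    also have "\<dots> = poly r z * u ^ B"
    proof -
      have "poly r z = (\<Sum>d\<le>B. coeff r d * z ^ d)"
        unfolding poly_altdef by (intro sum.mono_neutral_left) (auto simp: coeff_eq_0 B_def)
      moreover have "z ^ m * u ^ B = u ^ (B - m)" if "m \<le> B" for m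
      proof -
        have "u ^ B = u ^ (B - m) * u ^ m" using that by (simp add: power_add[symmetric])
        thus ?thesis unfolding uz using z0 by (simp add: power_inverse)
      qed
      ultimately show ?thesis by (simp add: sum_distrib_right mult.assoc)
    qed
    finally have s2: "(\<lambda>N. D N * u ^ N) sums (poly r z * u ^ B)" .
    from sums_diff[OF s1 s2] show ?thesis by (simp add: algebra_simps)
  qed
  have CD: "C N = D N" for N using powser_zero_coeffs[OF \<rho>, of "\<lambda>N. C N - D N" N] ser by simp
  have Csum: "C N = (\<Sum>m\<le>n. \<Sum>c<p. coeff (q c) m * (if B + 1 - m \<le> N then a c (N - (B + 1 - m)) else 0))" for N
    unfolding C_def by (rule sum.swap)
  have "(\<Sum>m\<le>n. \<Sum>c<p. a c (m + l) * coeff (q c) m) = C (B + 1 + l)"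
    unfolding Csum by (intro sum.cong refl) (auto simp: B_def mult.commute intro!: arg_cong2[where f = "(*)"] arg_cong[where f = "a _"])
  also have "\<dots> = 0" unfolding CD D_def by simp
  finally show "(\<Sum>m\<le>n. \<Sum>c<p. a c (m + l) * coeff (q c) m) = 0" .
  show "coeff r d = (\<Sum>k<n. \<Sum>c<p. a c k * coeff (q c) (d + k + 1))"
  proof (cases "d \<le> B")
    case True
    have "coeff r d = C (B - d)" unfolding CD D_def using True by simp
    also have "\<dots> = (\<Sum>m\<in>{d+1..n}. \<Sum>c<p. a c (m - (d + 1)) * coeff (q c) m)"
      unfolding Csum
    proof (rule sum.mono_neutral_cong_right)
      show "\<forall>m\<in>{..n} - {d + 1..n}. (\<Sum>c<p. coeff (q c) m * (if B + 1 - m \<le> B - d then a c (B - d - (B + 1 - m)) else 0)) = 0"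
        using True by (auto intro!: sum.neutral simp: B_def)
      fix m assume m: "m \<in> {d + 1..n}"
      have "B + 1 - m \<le> B - d" "B - d - (B + 1 - m) = m - (d + 1)" using m True unfolding B_def by auto
      thus "(\<Sum>c<p. coeff (q c) m * (if B + 1 - m \<le> B - d then a c (B - d - (B + 1 - m)) else 0)) = (\<Sum>c<p. a c (m - (d + 1)) * coeff (q c) m)"
        by (simp add: mult.commute)
    qed auto
    also have "\<dots> = (\<Sum>k<n - d. \<Sum>c<p. a c k * coeff (q c) (d + k + 1))"
      by (rule sum.reindex_bij_witness[of _ "\<lambda>k. d + k + 1" "\<lambda>m. m - (d + 1)"]) (auto simp: Suc_diff_le)
    also have "\<dots> = (\<Sum>k<n. \<Sum>c<p. a c k * coeff (q c) (d + k + 1))"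
    proof (rule sum.mono_neutral_left)
      show "\<forall>k\<in>{..<n} - {..<n - d}. (\<Sum>c<p. a c k * coeff (q c) (d + k + 1)) = 0"
      proof (intro ballI sum.neutral)
        fix k c assume "k \<in> {..<n} - {..<n - d}" "c \<in> {..<p}"
        thus "a c k * coeff (q c) (d + k + 1) = 0" using deg[of c] by (auto simp: coeff_eq_0)
      qed
    qed auto
    finally show ?thesis .
  next
    case False
    hence "coeff r d = 0" unfolding B_def by (simp add: coeff_eq_0)
    moreover have "coeff (q c) (d + k + 1) = 0" if "c < p" for c k
      using deg[OF that] False unfolding B_def by (simp add: coeff_eq_0)
    ultimately show ?thesis by simp
  qed
qed

section \<open>Even and odd parts\<close>

lemma coeff_even_part: "coeff (even_part_poly q) j = coeff q (2 * j)"
proof -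
  have "coeff (even_part_poly q) j = (\<Sum>i\<le>degree q. if i = j then coeff q (2 * j) else 0)"
    unfolding even_part_poly_def coeff_sum by (rule sum.cong) auto
  thus ?thesis by (auto simp: sum.delta coeff_eq_0)
qed

lemma coeff_odd_part: "coeff (odd_part_poly q) j = coeff q (2 * j + 1)"
proof -
  have "coeff (odd_part_poly q) j = (\<Sum>i\<le>degree q. if i = j then coeff q (2 * j + 1) else 0)"
    unfolding odd_part_poly_def coeff_sum by (rule sum.cong) auto
  thus ?thesis by (auto simp: sum.delta coeff_eq_0)
qed

lemma coeff_pcompose_neg_square:
  "coeff (pcompose (q :: complex poly) [:0,0,-1:]) i = (if even i then (-1) ^ (i div 2) * coeff q (i div 2) else 0)"
proof (induction q arbitrary: i)
  case (pCons a q)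
  consider "i = 0" | "i = 1" | j where "i = Suc (Suc j)" by (metis One_nat_def not0_implies_Suc)
  thus ?case
  proof cases
    case (3 j)
    have "coeff (pcompose (pCons a q) [:0,0,-1:]) i = - coeff (pcompose q [:0,0,-1:]) j"
      unfolding 3 by (simp add: pcompose_pCons coeff_pCons)
    thus ?thesis unfolding pCons.IH 3 by simp
  qed (auto simp: pcompose_pCons coeff_pCons)
qed simp

lemma coeff_even_negsq: 
  assumes "i < dim_row F" "j < dim_col F"
  shows "coeff (even_negsq F $$ (i,j)) k = (if even k then (-1) ^ (k div 2) * coeff (F $$ (i,j)) k else 0)"
  using assms by (auto simp: even_negsq_def mp_even_def coeff_pcompose_neg_square coeff_even_part)

lemma coeff_odd_negsq: 
  assumes "i < dim_row F" "j < dim_col F"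
  shows "coeff (odd_negsq F $$ (i,j)) k = (if odd k then (-1) ^ (k div 2) * coeff (F $$ (i,j)) k else 0)"
  using assms by (cases k) (auto simp: odd_negsq_def mp_odd_def coeff_pcompose_neg_square coeff_odd_part coeff_pCons)

lemma dim_negsq[simp]: "dim_row (even_negsq F) = dim_row F" "dim_col (even_negsq F) = dim_col F"
  "dim_row (odd_negsq F) = dim_row F" "dim_col (odd_negsq F) = dim_col F"
  by (auto simp: even_negsq_def odd_negsq_def mp_even_def mp_odd_def)

lemma coeff_pcompose_rotate: "coeff (pcompose (q :: complex poly) [:0,\<i>:]) k = \<i> ^ k * coeff q k"
  by (induction q arbitrary: k) (auto simp: pcompose_pCons coeff_pCons split: nat.split)

lemma negsq_sum: "even_negsq F + [:\<i>:] \<cdot>\<^sub>m odd_negsq F = map_mat (\<lambda>q. pcompose q [:0,\<i>:]) F"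
proof (rule eq_matI)
  fix i j assume "i < dim_row (map_mat (\<lambda>q. pcompose q [:0,\<i>:]) F)" "j < dim_col (map_mat (\<lambda>q. pcompose q [:0,\<i>:]) F)"
  hence ij: "i < dim_row F" "j < dim_col F" by auto
  show "(even_negsq F + [:\<i>:] \<cdot>\<^sub>m odd_negsq F) $$ (i,j) = map_mat (\<lambda>q. pcompose q [:0,\<i>:]) F $$ (i,j)"
  proof (rule poly_eqI)
    fix k
    have "\<i> ^ k = (if even k then (-1) ^ (k div 2) else \<i> * (-1) ^ (k div 2))"
    proof (cases "even k")
      case True
      then obtain l where "k = 2 * l" by blast
      thus ?thesis by (simp add: power_mult)
    next
      case False
      then obtain l where "k = 2 * l + 1" by (auto elim: oddE)
      thus ?thesis by (simp add: power_mult)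
    qed
    thus "coeff ((even_negsq F + [:\<i>:] \<cdot>\<^sub>m odd_negsq F) $$ (i,j)) k = coeff (map_mat (\<lambda>q. pcompose q [:0,\<i>:]) F $$ (i,j)) k"
      using ij by (simp add: coeff_even_negsq coeff_odd_negsq coeff_pcompose_rotate)
  qed
qed auto

lemma det_rotate: "det (map_mat (\<lambda>q. pcompose q [:0,\<i>:]) F) = pcompose (det F) [:0,\<i>:]"
proof -
  have "comm_ring_hom (\<lambda>q :: complex poly. pcompose q [:0,\<i>:])"
    by unfold_locales (auto simp: pcompose_add pcompose_mult pcompose_1)
  from comm_ring_hom.hom_det[OF this] show ?thesis .
qed

lemma minv_mult:
  assumes A: "A \<in> carrier_mat p p" and "det A \<noteq> 0"
  shows "minv A * A = 1\<^sub>m p"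
proof -
  have "minv A * A = (1 / det A) \<cdot>\<^sub>m (adj_mat A * A)" unfolding minv_def using adj_mat(1)[OF A] A by (simp add: mat_smult_left)
  also have "\<dots> = 1\<^sub>m p" unfolding adj_mat(3)[OF A] using assms by (intro eq_matI) auto
  finally show ?thesis .
qed

lemma sums_interleave:
  fixes f :: "nat \<Rightarrow> complex"
  assumes "(\<lambda>k. f k * g (2 * k)) sums w"
  shows "(\<lambda>k. (if even k then f (k div 2) else 0) * g k) sums w"
proof -
  have "(\<lambda>k. (\<lambda>k. (if even k then f (k div 2) else 0) * g k) (2 * k)) sums w" using assms by simp
  thus ?thesis
    by (subst (asm) sums_mono_reindex) (auto simp: strict_mono_def elim!: evenE)
qed

text \<open>Here \<open>leading_part n F + \<i> subleading_part n F\<close> is \<open>F(\<i>z)\<close> up to a unit factor, and only the first summand has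
  degree \<open>n\<close>. In either parity the Laurent coefficients of the quotient of the two parts are the
  Markov parameters of \<open>F\<close> interleaved with zeros, which makes the two cases of the theorem uniform.\<close>

definition leading_part :: "nat \<Rightarrow> complex poly mat \<Rightarrow> complex poly mat" where
  "leading_part n F = (if even n then even_negsq F else odd_negsq F)"
definition subleading_part :: "nat \<Rightarrow> complex poly mat \<Rightarrow> complex poly mat" where
  "subleading_part n F = (if even n then odd_negsq F else - even_negsq F)"
definition interleave :: "nat \<Rightarrow> (nat \<Rightarrow> complex mat) \<Rightarrow> nat \<Rightarrow> complex mat" where
  "interleave p s k = (if even k then s (k div 2) else 0\<^sub>m p p)"

text \<open>The computation common to both parities at a fixed \<open>z\<close>. The factor
  \<open>\<alpha>\<close> turns the terms of the given expansion into odd powers of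
  \<open>1 / z\<close>, and \<open>\<nu>\<close> is the scalar by which the value of
  \<open>Q\<close> differs from \<open>B\<close>; the sums are
  \<open>w = \<alpha> A B^-1\<close>.\<close>

lemma interleaved_quotient:
  assumes s: "\<And>k. s k \<in> carrier_mat p p" and A: "A \<in> carrier_mat p p" and B: "B \<in> carrier_mat p p" "det B \<noteq> 0"
    and ser: "\<And>i j. i < p \<Longrightarrow> j < p \<Longrightarrow> (\<lambda>k. h k * s k $$ (i,j)) sums ((A * minv B) $$ (i,j))"
    and h: "\<And>k. \<alpha> * h k = inverse (z ^ Suc (2 * k))"
    and Q: "\<And>i j. i < p \<Longrightarrow> j < p \<Longrightarrow> poly (Q $$ (i,j)) z = \<nu> * B $$ (i,j)"
    and R: "\<And>i j. i < p \<Longrightarrow> j < p \<Longrightarrow> poly (r i j) z = \<alpha> * \<nu> * A $$ (i,j)"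
  shows "\<exists>w. (\<forall>i<p. \<forall>c<p. (\<lambda>k. interleave p s k $$ (i,c) * inverse (z ^ Suc k)) sums w i c) \<and>
     (\<forall>i<p. \<forall>j<p. (\<Sum>c<p. w i c * poly (Q $$ (c,j)) z) = poly (r i j) z)"
proof (intro exI[of _ "\<lambda>i c. \<alpha> * (A * minv B) $$ (i,c)"] conjI allI impI)
  have mc: "minv B \<in> carrier_mat p p" unfolding minv_def using adj_mat(1)[OF B(1)] by simp
  fix i j assume ij: "i < p" "j < p"
  have "(\<lambda>k. \<alpha> * (h k * s k $$ (i,j))) sums (\<alpha> * (A * minv B) $$ (i,j))"
    by (rule sums_mult[OF ser[OF ij]])
  moreover have "\<alpha> * (h k * s k $$ (i,j)) = s k $$ (i,j) * inverse (z ^ Suc (2 * k))" for k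
    unfolding h[symmetric] by (simp only: ac_simps)
  ultimately have "(\<lambda>k. s k $$ (i,j) * inverse (z ^ Suc (2 * k))) sums (\<alpha> * (A * minv B) $$ (i,j))" by (simp only:)
  from sums_interleave[of "\<lambda>k. s k $$ (i,j)" "\<lambda>k. inverse (z ^ Suc k)", OF this]
  have "(\<lambda>k. (if even k then s (k div 2) $$ (i,j) else 0) * inverse (z ^ Suc k)) sums (\<alpha> * (A * minv B) $$ (i,j))" .
  moreover have "(if even k then s (k div 2) $$ (i,j) else 0) = interleave p s k $$ (i,j)" for k
    using ij by (simp add: interleave_def)
  ultimately show "(\<lambda>k. interleave p s k $$ (i,j) * inverse (z ^ Suc k)) sums (\<alpha> * (A * minv B) $$ (i,j))" by (simp only:)
  have "(\<Sum>c<p. \<alpha> * (A * minv B) $$ (i,c) * poly (Q $$ (c,j)) z) = \<alpha> * \<nu> * (\<Sum>c<p. (A * minv B) $$ (i,c) * B $$ (c,j))"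
    unfolding sum_distrib_left by (rule sum.cong) (use ij Q in \<open>auto simp del: index_mult_mat(1)\<close>)
  also have "(\<Sum>c<p. (A * minv B) $$ (i,c) * B $$ (c,j)) = (A * minv B * B) $$ (i,j)"
    using ij A B mc by (subst (2) mult_entry) auto
  also have "A * minv B * B = A" using A B mc by (simp add: mat_assoc minv_mult)
  finally show "(\<Sum>c<p. \<alpha> * (A * minv B) $$ (i,c) * poly (Q $$ (c,j)) z) = poly (r i j) z"
    using R[OF ij] by simp
qed

lemma markov_right_laurent:
  assumes F: "F \<in> carrier_mat p p" and mk: "markov_right p n F s"
  shows "\<exists>R. \<forall>z. R < cmod z \<longrightarrow> (\<exists>w. (\<forall>i<p. \<forall>c<p. (\<lambda>k. interleave p s k $$ (i,c) * inverse (z ^ Suc k)) sums w i c) \<and>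
     (\<forall>i<p. \<forall>j<p. (\<Sum>c<p. w i c * poly (leading_part n F $$ (c,j)) z) = poly (- subleading_part n F $$ (i,j)) z))"
proof -
  have dims[simp]: "dim_row F = p" "dim_col F = p" using F by auto
  have c: "mpeval (mp_even F) x \<in> carrier_mat p p" "mpeval (mp_odd F) x \<in> carrier_mat p p" for x
    unfolding mpeval_def mp_even_def mp_odd_def using F by auto
  have val: "poly (even_negsq F $$ (i,j)) z = mpeval (mp_even F) (- (z\<^sup>2)) $$ (i,j)"
    "poly (odd_negsq F $$ (i,j)) z = z * mpeval (mp_odd F) (- (z\<^sup>2)) $$ (i,j)" if "i < p" "j < p" for i j z
    using that by (simp_all add: even_negsq_def odd_negsq_def mp_even_def mp_odd_def mpeval_def poly_pcompose power2_eq_square)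
  \<comment> \<open>The expansion is used at \<open>- (z\<^sup>2)\<close>. For modulus above 1
    squaring does not decrease the modulus, so the threshold \<open>max 1 R\<close>
    suffices.\<close>
  have large: "R < cmod (- (z\<^sup>2))" if "max 1 R < cmod z" for R z
  proof -
    have "cmod z \<le> cmod z * cmod z" using that by (simp add: mult_le_cancel_left1)
    thus ?thesis using that by (simp add: power2_eq_square norm_mult)
  qed
  show ?thesis
  proof (cases "even n")
    case True
    have "markov1_right p F s" using mk True unfolding markov_right_def by simp
    from this[unfolded markov1_right_def] obtain R where s: "\<forall>k. s k \<in> carrier_mat p p"
      and all: "\<forall>x. R < cmod x \<longrightarrow> det (mpeval (mp_even F) x) \<noteq> 0 \<and>
      (\<forall>i<p. \<forall>j<p. (\<lambda>k. (-1)^k * inverse (x ^ Suc k) * s k $$ (i,j)) sums ((mpeval (mp_odd F) x * minv (mpeval (mp_even F) x)) $$ (i,j)))"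
      by (elim conjE exE) (rule that)
    show ?thesis
    proof (intro exI[of _ "max 1 R"] allI impI)
      fix z :: complex assume z: "max 1 R < cmod z"
      hence z0: "z \<noteq> 0" by auto
      \<comment> \<open>Here \<open>\<alpha> = - z\<close> and \<open>\<nu> = 1\<close>. The signs
        \<open>(-1)^k\<close> cancel against the powers of \<open>- (z\<^sup>2)\<close> except for
        one minus sign, the origin of the negated \<open>subleading_part\<close>.\<close>
      have h: "- z * ((-1)^k * inverse ((- (z\<^sup>2)) ^ Suc k)) = inverse (z ^ Suc (2 * k))" for k
      proof -
        have "z ^ Suc (2 * k) * z = z ^ (2 * Suc k)" by (simp add: ac_simps)
        also have "\<dots> = (z\<^sup>2) ^ Suc k" by (rule power_mult)
        finally have "(- (z\<^sup>2)) ^ Suc k = (-1) ^ Suc k * (z ^ Suc (2 * k) * z)"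
          unfolding power_minus[of "z\<^sup>2"] by (simp only:)
        moreover have "((-1) ^ k * inverse ((-1) ^ Suc k) :: complex) = -1" by (cases "even k") auto
        moreover have "- z * ((-1)^k * inverse ((-1) ^ Suc k * (Z * z))) = ((-1) ^ k * inverse ((-1) ^ Suc k)) * (z * inverse z) * (- inverse Z)" for Z
          unfolding inverse_mult_distrib by (simp only: ac_simps mult_minus_left mult_minus_right)
        ultimately show ?thesis by (simp only: right_inverse[OF z0] mult_1_right mult_1_left minus_mult_minus mult_minus1 minus_minus)
      qed
      have d: "det (mpeval (mp_even F) (- (z\<^sup>2))) \<noteq> 0" using all large[OF z] by blast
      have ser: "(\<lambda>k. (-1)^k * inverse ((- (z\<^sup>2)) ^ Suc k) * s k $$ (i,j)) sums
          ((mpeval (mp_odd F) (- (z\<^sup>2)) * minv (mpeval (mp_even F) (- (z\<^sup>2)))) $$ (i,j))" if "i < p" "j < p" for i j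
        using all large[OF z] that by blast
      show "\<exists>w. (\<forall>i<p. \<forall>c<p. (\<lambda>k. interleave p s k $$ (i,c) * inverse (z ^ Suc k)) sums w i c) \<and>
        (\<forall>i<p. \<forall>j<p. (\<Sum>c<p. w i c * poly (leading_part n F $$ (c,j)) z) = poly (- subleading_part n F $$ (i,j)) z)"
        by (rule interleaved_quotient[where r = "\<lambda>i j. - subleading_part n F $$ (i,j)" and \<nu> = 1, OF s[rule_format] c(2,1) d ser h])
          (use True val z0 in \<open>simp_all add: leading_part_def subleading_part_def\<close>)
    qed
  next
    case False
    have "markov2_right p F s" using mk False unfolding markov_right_def by simp
    from this[unfolded markov2_right_def] obtain R where s: "\<forall>k. s k \<in> carrier_mat p p"
      and all: "\<forall>x. R < cmod x \<longrightarrow> det (mpeval (mp_odd F) x) \<noteq> 0 \<and>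
      (\<forall>i<p. \<forall>j<p. (\<lambda>k. (-1)^k * inverse (x ^ k) * s k $$ (i,j)) sums ((mpeval (mp_even F) x * minv (mpeval (mp_odd F) x)) $$ (i,j)))"
      by (elim conjE exE) (rule that)
    show ?thesis
    proof (intro exI[of _ "max 1 R"] allI impI)
      fix z :: complex assume z: "max 1 R < cmod z"
      hence z0: "z \<noteq> 0" by auto
      \<comment> \<open>Here \<open>\<alpha> = inverse z\<close> and \<open>\<nu> = z\<close>, since
        the leading part carries an additional factor \<open>z\<close>.\<close>
      have h: "inverse z * ((-1)^k * inverse ((- (z\<^sup>2)) ^ k)) = inverse (z ^ Suc (2 * k))" for k
      proof -
        have "(- (z\<^sup>2)) ^ k = (-1) ^ k * z ^ (2 * k)" unfolding power_minus[of "z\<^sup>2"] power_mult ..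
        moreover have "((-1) ^ k * inverse ((-1) ^ k) :: complex) = 1" by (cases "even k") auto
        moreover have "inverse z * ((-1)^k * inverse ((-1) ^ k * Z)) = ((-1) ^ k * inverse ((-1) ^ k)) * inverse (z * Z)" for Z
          unfolding inverse_mult_distrib by (simp only: ac_simps)
        ultimately show ?thesis by (simp only: mult_1_left power_Suc)
      qed
      have d: "det (mpeval (mp_odd F) (- (z\<^sup>2))) \<noteq> 0" using all large[OF z] by blast
      have ser: "(\<lambda>k. (-1)^k * inverse ((- (z\<^sup>2)) ^ k) * s k $$ (i,j)) sums
          ((mpeval (mp_even F) (- (z\<^sup>2)) * minv (mpeval (mp_odd F) (- (z\<^sup>2)))) $$ (i,j))" if "i < p" "j < p" for i j
        using all large[OF z] that by blast
      show "\<exists>w. (\<forall>i<p. \<forall>c<p. (\<lambda>k. interleave p s k $$ (i,c) * inverse (z ^ Suc k)) sums w i c) \<and>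
        (\<forall>i<p. \<forall>j<p. (\<Sum>c<p. w i c * poly (leading_part n F $$ (c,j)) z) = poly (- subleading_part n F $$ (i,j)) z)"
        by (rule interleaved_quotient[where r = "\<lambda>i j. - subleading_part n F $$ (i,j)" and \<nu> = z, OF s[rule_format] c(1,2) d ser h])
          (use False val z0 in \<open>simp_all add: leading_part_def subleading_part_def\<close>)
    qed
  qed
qed

lemma hankel_data_markov:
  assumes F: "monic_mpoly p n F" and hs: "\<forall>k. hermitian_mat p (s k)" and mk: "markov_right p n F s"
  shows "hankel_data n p (interleave p s) ((-1) ^ (n div 2)) (leading_part n F) (subleading_part n F)"
proof -
  have Fc: "F \<in> carrier_mat p p" and deg: "\<And>i j. i < p \<Longrightarrow> j < p \<Longrightarrow> degree (F $$ (i,j)) \<le> n" and lc: "mcoeff F n = 1\<^sub>m p"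
    using F unfolding monic_mpoly_def by auto
  have dims[simp]: "dim_row F = p" "dim_col F = p" using Fc by auto
  have s: "s k \<in> carrier_mat p p" "\<And>i j. i < p \<Longrightarrow> j < p \<Longrightarrow> s k $$ (i,j) = cnj (s k $$ (j,i))" for k
    using hs unfolding hermitian_mat_def by blast+
  have coeffN: "coeff (leading_part n F $$ (i,j)) k = (if even k = even n then (-1) ^ (k div 2) * coeff (F $$ (i,j)) k else 0)"
    if "i < p" "j < p" for i j k using that by (auto simp: leading_part_def coeff_even_negsq coeff_odd_negsq)
  have dN: "degree (leading_part n F $$ (i,j)) \<le> n" if "i < p" "j < p" for i j
    using that deg[OF that] by (intro degree_le) (auto simp: coeffN coeff_eq_0)
  obtain R where R: "\<And>z. R < cmod z \<Longrightarrow> (\<exists>w. (\<forall>i<p. \<forall>c<p. (\<lambda>k. interleave p s k $$ (i,c) * inverse (z ^ Suc k)) sums w i c) \<and>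
     (\<forall>i<p. \<forall>j<p. (\<Sum>c<p. w i c * poly (leading_part n F $$ (c,j)) z) = poly (- subleading_part n F $$ (i,j)) z))"
    using markov_right_laurent[OF Fc mk] by blast
  \<comment> \<open>The sums \<open>w\<close> are obtained for each \<open>z\<close> separately. The
    infinite sum replaces them by one function of \<open>z\<close>, as
    \<open>laurent_product_coeffs\<close> requires.\<close>
  have series: "(\<lambda>k. interleave p s k $$ (i,c) * inverse (z ^ Suc k)) sums (\<Sum>k. interleave p s k $$ (i,c) * inverse (z ^ Suc k))"
    if zR: "R < cmod z" and that: "i < p" "c < p" for z i c
  proof -
    obtain w where "\<forall>i<p. \<forall>c<p. (\<lambda>k. interleave p s k $$ (i,c) * inverse (z ^ Suc k)) sums w i c" using R[OF zR] by blast
    hence "(\<lambda>k. interleave p s k $$ (i,c) * inverse (z ^ Suc k)) sums w i c" using \<open>i < p\<close> \<open>c < p\<close> by blast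
    thus ?thesis by (intro summable_sums sums_summable)
  qed
  have prod: "(\<Sum>c<p. (\<Sum>k. interleave p s k $$ (i,c) * inverse (z ^ Suc k)) * poly (leading_part n F $$ (c,j)) z) = poly (- subleading_part n F $$ (i,j)) z"
    if z: "R < cmod z" and ij: "i < p" "j < p" for z i j
  proof -
    obtain w where w: "\<forall>i<p. \<forall>c<p. (\<lambda>k. interleave p s k $$ (i,c) * inverse (z ^ Suc k)) sums w i c"
      "\<forall>i<p. \<forall>j<p. (\<Sum>c<p. w i c * poly (leading_part n F $$ (c,j)) z) = poly (- subleading_part n F $$ (i,j)) z" using R[OF z] by blast
    have "(\<Sum>k. interleave p s k $$ (i,c) * inverse (z ^ Suc k)) = w i c" if "c < p" for c
    proof -
      have "(\<lambda>k. interleave p s k $$ (i,c) * inverse (z ^ Suc k)) sums w i c" using w(1) ij(1) that by blast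
      thus ?thesis by (rule sums_unique[symmetric])
    qed
    hence "(\<Sum>c<p. (\<Sum>k. interleave p s k $$ (i,c) * inverse (z ^ Suc k)) * poly (leading_part n F $$ (c,j)) z) = (\<Sum>c<p. w i c * poly (leading_part n F $$ (c,j)) z)"
      by (intro sum.cong) auto
    thus ?thesis using w(2) ij by simp
  qed
  show ?thesis
  proof
    show "interleave p s k \<in> carrier_mat p p" for k using s unfolding interleave_def by auto
    show "cadj (interleave p s k) = interleave p s k" for k
    proof (rule eq_matI)
      fix i j assume "i < dim_row (interleave p s k)" "j < dim_col (interleave p s k)"
      hence "i < p" "j < p" using s(1)[of "k div 2"] unfolding interleave_def by (auto split: if_splits)
      thus "cadj (interleave p s k) $$ (i,j) = interleave p s k $$ (i,j)"
        using s(1)[of "k div 2"] s(2)[of i j "k div 2"] unfolding interleave_def by auto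
    qed (use s(1)[of "k div 2"] in \<open>auto simp: interleave_def\<close>)
    show "leading_part n F \<in> carrier_mat p p" "subleading_part n F \<in> carrier_mat p p" by (auto simp: leading_part_def subleading_part_def intro!: carrier_matI)
    show "((-1) ^ (n div 2) :: complex) \<noteq> 0" by simp
  next
    fix i j assume ij: "i < p" "j < p"
    show "degree (leading_part n F $$ (i,j)) \<le> n" by (rule dN[OF ij])
    have "coeff (F $$ (i,j)) n = (if i = j then 1 else 0)"
      using arg_cong[OF lc, of "\<lambda>M. M $$ (i,j)"] ij by (simp add: mcoeff_def)
    thus "coeff (leading_part n F $$ (i,j)) n = (if i = j then (-1) ^ (n div 2) else 0)" using ij by (simp add: coeffN)
    note lp = laurent_product_coeffs[where a = "\<lambda>c k. interleave p s k $$ (i,c)" and q = "\<lambda>c. leading_part n F $$ (c,j)" and p = p and R = R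
      and w = "\<lambda>c z. \<Sum>k. interleave p s k $$ (i,c) * inverse (z ^ Suc k)" and r = "- subleading_part n F $$ (i,j)" and n = n,
      OF series[OF _ ij(1)] prod[OF _ ij] dN[OF _ ij(2)]]
    show "(\<Sum>k\<le>n. \<Sum>c<p. interleave p s (k + l) $$ (i,c) * coeff (leading_part n F $$ (c,j)) k) = 0" for l
      by (rule lp(1))
    show "coeff (subleading_part n F $$ (i,j)) q = - (\<Sum>k<n. \<Sum>c<p. interleave p s k $$ (i,c) * coeff (leading_part n F $$ (c,j)) (q + k + 1))" for q
      using lp(2)[of q] by (simp add: neg_eq_iff_add_eq_0 eq_neg_iff_add_eq_0)
  qed
qed

section \<open>The inertia formulas\<close>

lemma char_poly_interleaved_hankel:
  assumes s: "\<And>k. s k \<in> carrier_mat p p"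
  shows "char_poly (mat (n * p) (n * p) (\<lambda>(a,b). interleave p s (a div p + b div p) $$ (a mod p, b mod p))) =
    char_poly (hankel p s 0 (int ((n + 1) div 2) - 1)) * char_poly (hankel p s 1 (int (n div 2) - 1))"
proof -
  define X where "X = mat (n * p) (n * p) (\<lambda>(a,b). interleave p s (a div p + b div p) $$ (a mod p, b mod p))"
  \<comment> \<open>\<open>e\<close> and \<open>f\<close> count the even and the odd block indices
    below \<open>n\<close>. For \<open>n \<le> 1\<close> there is no odd one and \<open>H1\<close>
    is the empty matrix.\<close>
  define e where "e = (n + 1) div 2"
  define f where "f = n div 2"
  have ef: "n = e + f" "2 * e \<le> n + 1" "2 * f \<le> n" unfolding e_def f_def by auto
  define H0 where "H0 = hankel p s 0 (int e - 1)"
  define H1 where "H1 = hankel p s 1 (int f - 1)"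
  have H: "H0 \<in> carrier_mat (e * p) (e * p)" "H1 \<in> carrier_mat (f * p) (f * p)" unfolding H0_def H1_def hankel_def by auto
  \<comment> \<open>Lists the even block indices before the odd ones and keeps the position inside
    each block.\<close>
  define \<sigma> where "\<sigma> c = (if c < e * p then 2 * (c div p) * p + c mod p else (2 * ((c - e * p) div p) + 1) * p + (c - e * p) mod p)" for c
  have \<sigma>dm: "\<sigma> c div p = (if c < e * p then 2 * (c div p) else 2 * ((c - e * p) div p) + 1)"
    "\<sigma> c mod p = (if c < e * p then c mod p else (c - e * p) mod p)" if "0 < p" for c
  proof -
    have "(a * p + r) div p = a" "(a * p + r) mod p = r" if "r < p" for a r using that by auto
    moreover have "x mod p < p" for x using \<open>0 < p\<close> by simp
    ultimately show "\<sigma> c div p = (if c < e * p then 2 * (c div p) else 2 * ((c - e * p) div p) + 1)"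
      "\<sigma> c mod p = (if c < e * p then c mod p else (c - e * p) mod p)"
      unfolding \<sigma>_def by (simp_all only: split: if_split) blast+
  qed
  have bound: "(if c < e * p then 2 * (c div p) else 2 * ((c - e * p) div p) + 1) < n" if c: "c < n * p" for c
  proof -
    have p: "0 < p" using c by (cases p) auto
    show ?thesis
    proof (cases "c < e * p")
      case True
      hence "c div p < e" using p by (simp add: div_less_iff_less_mult)
      thus ?thesis using True ef by simp
    next
      case False
      hence "c - e * p < f * p" using c unfolding ef(1) by (simp add: add_mult_distrib)
      hence "(c - e * p) div p < f" using p by (simp add: div_less_iff_less_mult)
      thus ?thesis using False ef by simp
    qed
  qed
  have \<sigma>lt: "\<sigma> c < n * p" if c: "c < n * p" for c
  proof -
    have p: "0 < p" using c by (cases p) auto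
    have "\<sigma> c div p < n" using bound[OF c] \<sigma>dm[OF p, of c] by simp
    thus ?thesis using p by (simp add: div_less_iff_less_mult)
  qed
  have inj: "inj_on \<sigma> {..<n * p}"
  proof (rule inj_onI)
    fix c c' assume "c \<in> {..<n * p}" "c' \<in> {..<n * p}" and eq: "\<sigma> c = \<sigma> c'"
    hence p: "0 < p" by (cases p) auto
    have d: "(if c < e * p then 2 * (c div p) else 2 * ((c - e * p) div p) + 1) = (if c' < e * p then 2 * (c' div p) else 2 * ((c' - e * p) div p) + 1)"
      "(if c < e * p then c mod p else (c - e * p) mod p) = (if c' < e * p then c' mod p else (c' - e * p) mod p)"
      using \<sigma>dm[OF p, of c] \<sigma>dm[OF p, of c'] eq by simp_all
    have same: "c < e * p \<longleftrightarrow> c' < e * p"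
    proof (rule ccontr)
      assume "\<not> ?thesis"
      thus False using arg_cong[OF d(1), of even] by (auto split: if_splits)
    qed
    show "c = c'"
    proof (cases "c < e * p")
      case True
      hence "c div p = c' div p" "c mod p = c' mod p" using d same by auto
      thus ?thesis by (metis mult_div_mod_eq)
    next
      case False
      hence "(c - e * p) div p = (c' - e * p) div p" "(c - e * p) mod p = (c' - e * p) mod p" using d same by auto
      hence "c - e * p = c' - e * p" by (metis mult_div_mod_eq)
      thus ?thesis using False same by simp
    qed
  qed
  have Xc: "X \<in> carrier_mat (n * p) (n * p)" unfolding X_def by simp
  have blk: "mat (n * p) (n * p) (\<lambda>(c,c'). X $$ (\<sigma> c, \<sigma> c')) = four_block_mat H0 (0\<^sub>m (e * p) (f * p)) (0\<^sub>m (f * p) (e * p)) H1"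
  proof (rule eq_matI)
    fix c c' assume "c < dim_row (four_block_mat H0 (0\<^sub>m (e * p) (f * p)) (0\<^sub>m (f * p) (e * p)) H1)"
      "c' < dim_col (four_block_mat H0 (0\<^sub>m (e * p) (f * p)) (0\<^sub>m (f * p) (e * p)) H1)"
    hence cc: "c < n * p" "c' < n * p" using H by (auto simp: ef(1) add_mult_distrib)
    have p: "0 < p" using cc by (cases p) auto
    have X: "X $$ (\<sigma> c, \<sigma> c') = interleave p s (\<sigma> c div p + \<sigma> c' div p) $$ (\<sigma> c mod p, \<sigma> c' mod p)"
      using \<sigma>lt[OF cc(1)] \<sigma>lt[OF cc(2)] by (simp add: X_def)
    have l: "c - e * p < f * p" if "\<not> c < e * p" using that cc unfolding ef(1) by (simp add: add_mult_distrib)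
    have l': "c' - e * p < f * p" if "\<not> c' < e * p" using that cc unfolding ef(1) by (simp add: add_mult_distrib)
    have mp: "x mod p < p" for x using p by simp
    \<comment> \<open>Two odd block indices add up to \<open>2 * (1 + i + j)\<close>, whence the
      offset 1 of \<open>H1\<close>.\<close>
    have ev: "(2 * i + 1 + (2 * j + 1)) div 2 = 1 + i + j" for i j :: nat by simp
    show "mat (n * p) (n * p) (\<lambda>(c,c'). X $$ (\<sigma> c, \<sigma> c')) $$ (c,c') = four_block_mat H0 (0\<^sub>m (e * p) (f * p)) (0\<^sub>m (f * p) (e * p)) H1 $$ (c,c')"
    proof (cases "c < e * p"; cases "c' < e * p")
      assume a: "c < e * p" "c' < e * p"
      have "X $$ (\<sigma> c, \<sigma> c') = s (c div p + c' div p) $$ (c mod p, c' mod p)"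
        unfolding X \<sigma>dm[OF p] using a by (simp add: interleave_def)
      also have "\<dots> = H0 $$ (c,c')" using a by (simp add: H0_def hankel_def)
      finally show ?thesis using a cc H by simp
    next
      assume a: "\<not> c < e * p" "\<not> c' < e * p"
      have "X $$ (\<sigma> c, \<sigma> c') = s (1 + (c - e * p) div p + (c' - e * p) div p) $$ ((c - e * p) mod p, (c' - e * p) mod p)"
        unfolding X \<sigma>dm[OF p] using a by (simp add: interleave_def)
      also have "\<dots> = H1 $$ (c - e * p, c' - e * p)" using a l l' by (simp add: H1_def hankel_def)
      finally show ?thesis using a cc H l l' by simp
    next
      assume a: "c < e * p" "\<not> c' < e * p"
      have "X $$ (\<sigma> c, \<sigma> c') = 0" unfolding X \<sigma>dm[OF p] using a mp by (simp add: interleave_def)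
      thus ?thesis using a cc H l' by simp
    next
      assume a: "\<not> c < e * p" "c' < e * p"
      have "X $$ (\<sigma> c, \<sigma> c') = 0" unfolding X \<sigma>dm[OF p] using a mp by (simp add: interleave_def)
      thus ?thesis using a cc H l by simp
    qed
  qed (use H in \<open>auto simp: ef(1) add_mult_distrib\<close>)
  have "char_poly X = char_poly (four_block_mat H0 (0\<^sub>m (e * p) (f * p)) (0\<^sub>m (f * p) (e * p)) H1)"
    using char_poly_reindex[OF Xc inj \<sigma>lt] unfolding blk by simp
  also have "\<dots> = char_poly H0 * char_poly H1"
  proof -
    have "\<exists>es. char_poly H0 = (\<Prod>a\<leftarrow>es. [:-a,1:])" "\<exists>es. char_poly H1 = (\<Prod>a\<leftarrow>es. [:-a,1:])"
      using char_poly_factorized[OF H(1)] char_poly_factorized[OF H(2)] by auto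
    thus ?thesis by (rule char_poly_0_block[OF refl _ _ H(1) _ H(2)]) simp
  qed
  finally show ?thesis unfolding X_def H0_def H1_def e_def f_def .
qed

lemma roots_in_char_poly_partition:
  assumes "H \<in> carrier_mat k k"
  shows "inertia_pos H + inertia_neg H + inertia_zero H = k"
proof -
  have "inertia_pos H + inertia_neg H + inertia_zero H = degree (char_poly H)"
    unfolding inertia_pos_def inertia_neg_def inertia_zero_def
    by (rule roots_in_partition) (use char_poly_nonzero[OF assms] in \<open>auto simp: neq_iff\<close>)
  thus ?thesis using degree_monic_char_poly[OF assms] by simp
qed

lemma right_markov_root_count:
  assumes F: "monic_mpoly p n F" and hs: "\<forall>k. hermitian_mat p (s k)" and mk: "markov_right p n F s"
    and gcd: "is_gcrd p Fh (even_negsq F) (odd_negsq F)"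
  defines "H0 \<equiv> hankel p s 0 (int ((n + 1) div 2) - 1)" and "H1 \<equiv> hankel p s 1 (int (n div 2) - 1)"
  shows "gamma_left F = inertia_pos H0 + inertia_pos H1 + gamma_upper Fh"
    "gamma_right F = inertia_neg H0 + inertia_neg H1 + gamma_lower Fh"
    "int (gamma_imag F) = int (inertia_zero H0) + int (inertia_zero H1) - int (gamma_upper Fh) - int (gamma_lower Fh)"
proof -
  have Fc: "F \<in> carrier_mat p p" and deg: "\<And>i j. i < p \<Longrightarrow> j < p \<Longrightarrow> degree (F $$ (i,j)) \<le> n" and lc: "mcoeff F n = 1\<^sub>m p"
    using F unfolding monic_mpoly_def by auto
  have dims[simp]: "dim_row F = p" "dim_col F = p" using Fc by auto
  have s: "s k \<in> carrier_mat p p" for k using hs unfolding hermitian_mat_def by blast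
  interpret hankel_data n p "interleave p s" "(-1) ^ (n div 2)" "leading_part n F" "subleading_part n F" by (rule hankel_data_markov[OF F hs mk])
  have cdF: "coeff (det F) (n * p) = 1" using coeff_det[OF Fc deg] unfolding lc by simp
  hence dF: "det F \<noteq> 0" by auto
  have degdF: "degree (det F) = n * p"
  proof (rule antisym)
    show "degree (det F) \<le> n * p" by (rule degree_det_le[OF deg Fc])
    show "n * p \<le> degree (det F)" by (rule le_degree) (use cdF in simp)
  qed
  have negsq: "even_negsq F \<in> carrier_mat p p" "odd_negsq F \<in> carrier_mat p p" by (auto intro!: carrier_matI)
  define \<Phi> where "\<Phi> = leading_part n F + [:\<i>:] \<cdot>\<^sub>m subleading_part n F"
  \<comment> \<open>For odd \<open>n\<close> the matrix \<open>\<Phi>\<close> is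
    \<open>- \<i>\<close> times the rotated \<open>F\<close>; the determinant of order
    \<open>p\<close> takes the \<open>p\<close>-th power of that unit.\<close>
  define c where "c = (if even n then 1 else (- \<i>) ^ p)"
  have c0: "c \<noteq> 0" unfolding c_def by auto
  have det\<Phi>: "det \<Phi> = Polynomial.smult c (pcompose (det F) [:0,\<i>:])"
  proof (cases "even n")
    case True
    hence "\<Phi> = map_mat (\<lambda>q. pcompose q [:0,\<i>:]) F" unfolding \<Phi>_def leading_part_def subleading_part_def by (simp add: negsq_sum)
    thus ?thesis using True by (simp add: det_rotate c_def)
  next
    case False
    have "\<Phi> = [:- \<i>:] \<cdot>\<^sub>m (even_negsq F + [:\<i>:] \<cdot>\<^sub>m odd_negsq F)"
      unfolding \<Phi>_def leading_part_def subleading_part_def using False by (intro eq_matI) (auto simp: smult_add_right)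
    hence "\<Phi> = [:- \<i>:] \<cdot>\<^sub>m map_mat (\<lambda>q. pcompose q [:0,\<i>:]) F" by (simp only: negsq_sum)
    hence "det \<Phi> = [:- \<i>:] ^ p * pcompose (det F) [:0,\<i>:]" by (simp add: det_rotate)
    also have "[:- \<i>:] ^ p = [:c:]" using False by (simp add: c_def poly_const_pow)
    finally show ?thesis by simp
  qed
  have pc0: "pcompose (det F) [:0,\<i>:] \<noteq> 0" using dF by (simp add: pcompose_eq_0_iff)
  have d\<Phi>: "det \<Phi> \<noteq> 0" "degree (det \<Phi>) \<le> n * p"
    unfolding det\<Phi> using c0 pc0 degdF by (auto simp: degree_pcompose)
  have rot: "roots_in (det \<Phi>) S = roots_in (det F) ((\<lambda>z. \<i> * z) ` S)" for S
    unfolding det\<Phi> using roots_in_smult[OF c0 pc0] roots_in_rotate[OF dF] by simp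
  have im: "(\<lambda>z. \<i> * z) ` {z. Im z > 0} = {z. Re z < 0}" "(\<lambda>z. \<i> * z) ` {z. Im z < 0} = {z. Re z > 0}"
  proof -
    have "z \<in> (\<lambda>z. \<i> * z) ` S \<longleftrightarrow> - \<i> * z \<in> S" for z S
    proof
      assume "- \<i> * z \<in> S"
      thus "z \<in> (\<lambda>z. \<i> * z) ` S" by (intro image_eqI[of _ _ "- \<i> * z"]) auto
    qed auto
    thus "(\<lambda>z. \<i> * z) ` {z. Im z > 0} = {z. Re z < 0}" "(\<lambda>z. \<i> * z) ` {z. Im z < 0} = {z. Re z > 0}" by auto
  qed
  have Fh: "Fh \<in> carrier_mat p p" using gcd unfolding is_gcrd_def right_divisor_def by blast
  obtain K1 K2 where K: "K1 \<in> carrier_mat p p" "K2 \<in> carrier_mat p p" "even_negsq F = K1 * Fh" "odd_negsq F = K2 * Fh"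
    and bez: "det Fh \<noteq> 0 \<Longrightarrow> \<exists>U\<in>carrier_mat p p. \<exists>V\<in>carrier_mat p p. U * K1 + V * K2 = 1\<^sub>m p"
    using gcrd_bezout[OF negsq gcd] by blast
  define M1 where "M1 = (if even n then K1 else K2)"
  define M2 where "M2 = (if even n then K2 else - K1)"
  have M: "M1 \<in> carrier_mat p p" "M2 \<in> carrier_mat p p" unfolding M1_def M2_def using K by auto
  have [simp]: "dim_row K1 = p" "dim_col K1 = p" "dim_row K2 = p" "dim_col K2 = p" "dim_row Fh = p" "dim_col Fh = p"
    "dim_row M1 = p" "dim_col M1 = p" "dim_row M2 = p" "dim_col M2 = p" using K Fh M by auto
  have NM: "leading_part n F = M1 * Fh" and DM: "subleading_part n F = M2 * Fh" unfolding leading_part_def subleading_part_def M1_def M2_def using K by auto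
  have "\<Phi> = (M1 + [:\<i>:] \<cdot>\<^sub>m M2) * Fh" unfolding \<Phi>_def NM DM by (simp add: mat_algebra)
  hence "det \<Phi> = det (M1 + [:\<i>:] \<cdot>\<^sub>m M2) * det Fh" using M Fh by (simp add: det_mult[of _ p])
  hence "det Fh \<noteq> 0" using d\<Phi>(1) by auto
  then obtain U V where UV: "U \<in> carrier_mat p p" "V \<in> carrier_mat p p" "U * K1 + V * K2 = 1\<^sub>m p" using bez by blast
  have [simp]: "dim_row U = p" "dim_col U = p" "dim_row V = p" "dim_col V = p" using UV by auto
  have "\<exists>U\<in>carrier_mat p p. \<exists>V\<in>carrier_mat p p. U * M1 + V * M2 = 1\<^sub>m p"
  proof (cases "even n")
    case True
    thus ?thesis using UV unfolding M1_def M2_def by auto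
  next
    case False
    have "V * K2 + (- U) * (- K1) = U * K1 + V * K2" by (intro eq_matI) (auto simp del: index_mult_mat(1))
    hence "V * M1 + (- U) * M2 = 1\<^sub>m p" using UV(3) False unfolding M1_def M2_def by (simp only: if_False)
    thus ?thesis using UV(1,2) uminus_carrier_mat by blast
  qed
  then obtain U' V' where UV': "U' \<in> carrier_mat p p" "V' \<in> carrier_mat p p" "U' * M1 + V' * M2 = 1\<^sub>m p" by blast
  have H: "H0 \<in> carrier_mat (((n + 1) div 2) * p) (((n + 1) div 2) * p)" "H1 \<in> carrier_mat ((n div 2) * p) ((n div 2) * p)"
    unfolding H0_def H1_def hankel_def by auto
  obtain es0 where es0: "char_poly H0 = (\<Prod>a\<leftarrow>es0. [:-a,1:])" using char_poly_factorized[OF H(1)] by blast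
  obtain es1 where es1: "char_poly H1 = (\<Prod>a\<leftarrow>es1. [:-a,1:])" using char_poly_factorized[OF H(2)] by blast
  have "char_poly X = (\<Prod>a\<leftarrow>es0 @ es1. [:-a,1:])"
    using char_poly_interleaved_hankel[where s = s and p = p and n = n, OF s]
    unfolding X_def H0_def[symmetric] H1_def[symmetric] es0 es1 by simp
  note rc = root_count[OF Fh M UV'(1,2) NM DM UV'(3) d\<Phi>[unfolded \<Phi>_def] this, folded \<Phi>_def]
  have p: "inertia_pos H0 + inertia_pos H1 = length (filter (\<lambda>e. Re e > 0) (es0 @ es1))"
    "inertia_neg H0 + inertia_neg H1 = length (filter (\<lambda>e. Re e < 0) (es0 @ es1))"
    unfolding inertia_pos_def inertia_neg_def es0 es1 roots_in_linear_factors by simp_all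
  show L: "gamma_left F = inertia_pos H0 + inertia_pos H1 + gamma_upper Fh"
    using rc(1) unfolding p gamma_left_def gamma_upper_def rot im by simp
  show R: "gamma_right F = inertia_neg H0 + inertia_neg H1 + gamma_lower Fh"
    using rc(2) unfolding p gamma_right_def gamma_lower_def rot im by simp
  \<comment> \<open>The zeros on the imaginary axis are the rest of \<open>n * p\<close>, and the
    zero eigenvalues are the rest of the orders of \<open>H0\<close> and \<open>H1\<close>, whose
    sum is \<open>n * p\<close> too.\<close>
  have "gamma_right F + gamma_left F + gamma_imag F = n * p"
    unfolding gamma_right_def gamma_left_def gamma_imag_def degdF[symmetric]
    by (rule roots_in_partition[OF dF]) (auto simp: neq_iff)
  moreover have "n * p = ((n + 1) div 2) * p + (n div 2) * p"
  proof -
    have "(n + 1) div 2 + n div 2 = n" by presburger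
    thus ?thesis by (metis add_mult_distrib)
  qed
  ultimately show "int (gamma_imag F) = int (inertia_zero H0) + int (inertia_zero H1) - int (gamma_upper Fh) - int (gamma_lower Fh)"
    using L R roots_in_char_poly_partition[OF H(1)] roots_in_char_poly_partition[OF H(2)] by linarith
qed

section \<open>Transposition of left expansions and left divisors\<close>

lemma mpeval_transpose: "mpeval (L\<^sup>T) z = (mpeval L z)\<^sup>T"
  unfolding mpeval_def by (rule eq_matI) auto

lemma mp_parts_transpose: "mp_even (F\<^sup>T) = (mp_even F)\<^sup>T" "mp_odd (F\<^sup>T) = (mp_odd F)\<^sup>T"
  unfolding mp_even_def mp_odd_def by (auto intro!: eq_matI)

lemma negsq_transpose: "even_negsq (F\<^sup>T) = (even_negsq F)\<^sup>T" "odd_negsq (F\<^sup>T) = (odd_negsq F)\<^sup>T"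
  unfolding even_negsq_def odd_negsq_def mp_parts_transpose by (auto intro!: eq_matI)

text \<open>Both sides are left inverses of the transposed matrix, which can be cancelled since its
  determinant is nonzero.\<close>

lemma minv_transpose:
  assumes A: "A \<in> carrier_mat p p" and "det A \<noteq> 0"
  shows "minv (A\<^sup>T) = (minv A)\<^sup>T"
proof -
  have m: "minv A \<in> carrier_mat p p" unfolding minv_def using adj_mat(1)[OF A] by simp
  have At: "A\<^sup>T \<in> carrier_mat p p" using A by simp
  have m': "minv (A\<^sup>T) \<in> carrier_mat p p" unfolding minv_def using adj_mat(1)[OF At] by simp
  have "(A * minv A) = 1\<^sub>m p" by (rule mat_mult_left_right_inverse[OF m A minv_mult[OF assms]])
  hence "(minv A)\<^sup>T * A\<^sup>T = 1\<^sub>m p" using transpose_mult[OF A m] by (metis transpose_one)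
  moreover have "minv (A\<^sup>T) * A\<^sup>T = 1\<^sub>m p" by (rule minv_mult[OF At]) (use det_transpose[OF A] assms in simp)
  ultimately show ?thesis
    by (intro right_cancel_mat_eq[OF At, of "minv (A\<^sup>T)" p]) (use m m' det_transpose[OF A] assms in auto)
qed

lemma transposed_series:
  assumes s: "\<And>k. s k \<in> carrier_mat p p" and A: "A \<in> carrier_mat p p" and B: "B \<in> carrier_mat p p"
    and "det A \<noteq> 0" "i < p" "j < p" and ser: "(\<lambda>k. h k * s k $$ (j,i)) sums ((minv A * B) $$ (j,i))"
  shows "(\<lambda>k. h k * (s k)\<^sup>T $$ (i,j)) sums ((B\<^sup>T * minv (A\<^sup>T)) $$ (i,j))"
proof -
  have m: "minv A \<in> carrier_mat p p" unfolding minv_def using adj_mat(1)[OF A] by simp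
  have "B\<^sup>T * minv (A\<^sup>T) = (minv A * B)\<^sup>T" unfolding minv_transpose[OF A assms(4)] using transpose_mult[OF m B] by simp
  hence "(B\<^sup>T * minv (A\<^sup>T)) $$ (i,j) = (minv A * B) $$ (j,i)" using assms(5,6) m B by (simp del: index_mult_mat(1))
  moreover have "(s k)\<^sup>T $$ (i,j) = s k $$ (j,i)" for k using carrier_matD[OF s[of k]] assms(5,6) by simp
  ultimately show ?thesis using ser by (simp only:)
qed

lemma markov_left_transpose:
  assumes F: "F \<in> carrier_mat p p" and mk: "markov_left p n F s"
  shows "markov_right p n (F\<^sup>T) (\<lambda>k. (s k)\<^sup>T)"
proof -
  have c: "mpeval (mp_even F) z \<in> carrier_mat p p" "mpeval (mp_odd F) z \<in> carrier_mat p p" for z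
    using F unfolding mpeval_def mp_even_def mp_odd_def by auto
  show ?thesis
  proof (cases "even n")
    case True
    have "markov1_left p F s" using mk True unfolding markov_left_def by simp
    from this[unfolded markov1_left_def] obtain R where s: "\<forall>k. s k \<in> carrier_mat p p" and R: "\<forall>z. R < cmod z \<longrightarrow> det (mpeval (mp_even F) z) \<noteq> 0 \<and>
        (\<forall>i<p. \<forall>j<p. (\<lambda>k. (-1)^k * inverse (z ^ Suc k) * s k $$ (i,j)) sums
           ((minv (mpeval (mp_even F) z) * mpeval (mp_odd F) z) $$ (i,j)))"
      by (elim conjE exE) (rule that)
    have "markov1_right p (F\<^sup>T) (\<lambda>k. (s k)\<^sup>T)"
      unfolding markov1_right_def mp_parts_transpose mpeval_transpose det_transpose[OF c(1)]
    proof (intro conjI allI exI[of _ R] impI)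
      fix z i j assume z: "R < cmod z" and ij: "i < p" "j < p"
      show "(\<lambda>k. (-1)^k * inverse (z ^ Suc k) * (s k)\<^sup>T $$ (i,j)) sums (((mpeval (mp_odd F) z)\<^sup>T * minv ((mpeval (mp_even F) z)\<^sup>T)) $$ (i,j))"
        by (rule transposed_series[OF s[rule_format] c(1,2)]) (use R z s ij in auto)
    qed (use s R in auto)
    thus ?thesis using True unfolding markov_right_def by simp
  next
    case False
    have "markov2_left p F s" using mk False unfolding markov_left_def by simp
    from this[unfolded markov2_left_def] obtain R where s: "\<forall>k. s k \<in> carrier_mat p p" and R: "\<forall>z. R < cmod z \<longrightarrow> det (mpeval (mp_odd F) z) \<noteq> 0 \<and>
        (\<forall>i<p. \<forall>j<p. (\<lambda>k. (-1)^k * inverse (z ^ k) * s k $$ (i,j)) sums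
           ((minv (mpeval (mp_odd F) z) * mpeval (mp_even F) z) $$ (i,j)))"
      by (elim conjE exE) (rule that)
    have "markov2_right p (F\<^sup>T) (\<lambda>k. (s k)\<^sup>T)"
      unfolding markov2_right_def mp_parts_transpose mpeval_transpose det_transpose[OF c(2)]
    proof (intro conjI allI exI[of _ R] impI)
      fix z i j assume z: "R < cmod z" and ij: "i < p" "j < p"
      show "(\<lambda>k. (-1)^k * inverse (z ^ k) * (s k)\<^sup>T $$ (i,j)) sums (((mpeval (mp_even F) z)\<^sup>T * minv ((mpeval (mp_odd F) z)\<^sup>T)) $$ (i,j))"
        by (rule transposed_series[OF s[rule_format] c(2,1)]) (use R z s ij in auto)
    qed (use s R in auto)
    thus ?thesis using False unfolding markov_right_def by simp
  qed
qed

lemma left_divisor_transpose: "left_divisor p L F \<longleftrightarrow> right_divisor p (L\<^sup>T) (F\<^sup>T)"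
proof
  assume "left_divisor p L F"
  then obtain M where "L \<in> carrier_mat p p" "M \<in> carrier_mat p p" "F = L * M" unfolding left_divisor_def by blast
  thus "right_divisor p (L\<^sup>T) (F\<^sup>T)" unfolding right_divisor_def by (intro conjI bexI[of _ "M\<^sup>T"]) (auto simp: transpose_mult)
next
  assume "right_divisor p (L\<^sup>T) (F\<^sup>T)"
  then obtain M where M: "L \<in> carrier_mat p p" "M \<in> carrier_mat p p" "F\<^sup>T = M * L\<^sup>T" unfolding right_divisor_def by auto
  have "F = (M * L\<^sup>T)\<^sup>T" unfolding M(3)[symmetric] by simp
  also have "\<dots> = L * M\<^sup>T" using M(1,2) by (subst transpose_mult[of _ p p _ p]) auto
  finally show "left_divisor p L F" unfolding left_divisor_def using M by (intro conjI bexI[of _ "M\<^sup>T"]) auto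
qed

lemma gcld_transpose: "is_gcld p G F1 F2 \<Longrightarrow> is_gcrd p (G\<^sup>T) (F1\<^sup>T) (F2\<^sup>T)"
  unfolding is_gcld_def is_gcrd_def left_divisor_transpose by (metis transpose_transpose)

lemma left_markov_root_count:
  assumes F: "monic_mpoly p n F" and hs: "\<forall>k. hermitian_mat p (s k)" and mk: "markov_left p n F s"
    and gcd: "is_gcld p Fh (even_negsq F) (odd_negsq F)"
  defines "H0 \<equiv> hankel p s 0 (int ((n + 1) div 2) - 1)" and "H1 \<equiv> hankel p s 1 (int (n div 2) - 1)"
  shows "gamma_left F = inertia_pos H0 + inertia_pos H1 + gamma_upper Fh"
    "gamma_right F = inertia_neg H0 + inertia_neg H1 + gamma_lower Fh"
    "int (gamma_imag F) = int (inertia_zero H0) + int (inertia_zero H1) - int (gamma_upper Fh) - int (gamma_lower Fh)"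
proof -
  have Fc: "F \<in> carrier_mat p p" using F unfolding monic_mpoly_def by auto
  have Fhc: "Fh \<in> carrier_mat p p" using gcd unfolding is_gcld_def left_divisor_def by blast
  have s: "s k \<in> carrier_mat p p" for k using hs unfolding hermitian_mat_def by blast
  have F': "monic_mpoly p n (F\<^sup>T)"
  proof -
    have "mcoeff (F\<^sup>T) n = (mcoeff F n)\<^sup>T" unfolding mcoeff_def by (rule eq_matI) auto
    thus ?thesis using F unfolding monic_mpoly_def by auto
  qed
  have hs': "\<forall>k. hermitian_mat p ((s k)\<^sup>T)"
  proof
    fix k
    have h: "s k $$ (j,i) = cnj (s k $$ (i,j))" if "i < p" "j < p" for i j
      using hs that unfolding hermitian_mat_def by blast
    have t: "(s k)\<^sup>T $$ (i,j) = s k $$ (j,i)" if "i < p" "j < p" for i j using s[of k] that by auto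
    show "hermitian_mat p ((s k)\<^sup>T)" unfolding hermitian_mat_def
    proof (intro conjI allI impI)
      fix i j assume ij: "i < p" "j < p"
      show "(s k)\<^sup>T $$ (i,j) = cnj ((s k)\<^sup>T $$ (j,i))" unfolding t[OF ij] t[OF ij(2,1)] by (rule h[OF ij])
    qed (use s[of k] in simp)
  qed
  have gcd': "is_gcrd p (Fh\<^sup>T) (even_negsq (F\<^sup>T)) (odd_negsq (F\<^sup>T))" unfolding negsq_transpose by (rule gcld_transpose[OF gcd])
  \<comment> \<open>Block \<open>(a, b)\<close> depends only on the sum of its indices, so
    transposing every block amounts to transposing the whole matrix, which keeps the characteristic
    polynomial.\<close>
  have hk: "hankel p (\<lambda>k. (s k)\<^sup>T) j k = (hankel p s j k)\<^sup>T" for j k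
  proof (rule eq_matI)
    fix a b assume "a < dim_row ((hankel p s j k)\<^sup>T)" "b < dim_col ((hankel p s j k)\<^sup>T)"
    hence ab: "a < nat (k + 1) * p" "b < nat (k + 1) * p" by (auto simp: hankel_def)
    hence "0 < p" by (cases p) auto
    thus "hankel p (\<lambda>k. (s k)\<^sup>T) j k $$ (a,b) = (hankel p s j k)\<^sup>T $$ (a,b)"
      using ab s[of "j + a div p + b div p"] by (simp add: hankel_def ac_simps)
  qed (auto simp: hankel_def)
  have cp: "char_poly ((hankel p s j k)\<^sup>T) = char_poly (hankel p s j k)" for j k
    by (rule char_poly_transpose_mat[of _ "nat (k + 1) * p"]) (simp add: hankel_def)
  have i: "inertia_pos ((hankel p s j k)\<^sup>T) = inertia_pos (hankel p s j k)"
    "inertia_neg ((hankel p s j k)\<^sup>T) = inertia_neg (hankel p s j k)"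
    "inertia_zero ((hankel p s j k)\<^sup>T) = inertia_zero (hankel p s j k)" for j k
    unfolding inertia_pos_def inertia_neg_def inertia_zero_def cp by auto
  have g: "gamma_left (F\<^sup>T) = gamma_left F" "gamma_right (F\<^sup>T) = gamma_right F" "gamma_imag (F\<^sup>T) = gamma_imag F"
    "gamma_upper (Fh\<^sup>T) = gamma_upper Fh" "gamma_lower (Fh\<^sup>T) = gamma_lower Fh"
    unfolding gamma_left_def gamma_right_def gamma_imag_def gamma_upper_def gamma_lower_def
      det_transpose[OF Fc] det_transpose[OF Fhc] by auto
  note r = right_markov_root_count[OF F' hs' markov_left_transpose[OF Fc mk] gcd', unfolded hk i g, folded H0_def H1_def]
  show "gamma_left F = inertia_pos H0 + inertia_pos H1 + gamma_upper Fh"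
    "gamma_right F = inertia_neg H0 + inertia_neg H1 + gamma_lower Fh"
    "int (gamma_imag F) = int (inertia_zero H0) + int (inertia_zero H1) - int (gamma_upper Fh) - int (gamma_lower Fh)"
    by (rule r)+
qed

theorem theorem3p5:
  fixes p n m :: nat and F Fh :: "complex poly mat" and s :: "nat \<Rightarrow> complex mat"
  assumes "monic_mpoly p n F"
    and "\<forall>k. hermitian_mat p (s k)"
    and "(markov_right p n F s \<and> is_gcrd p Fh (even_negsq F) (odd_negsq F)) \<or>
         (markov_left p n F s \<and> is_gcld p Fh (even_negsq F) (odd_negsq F))"
  shows "(n = 2 * m \<longrightarrow>
            gamma_left F = inertia_pos (hankel p s 0 (int m - 1)) + inertia_pos (hankel p s 1 (int m - 1)) + gamma_upper Fh \<and>
            gamma_right F = inertia_neg (hankel p s 0 (int m - 1)) + inertia_neg (hankel p s 1 (int m - 1)) + gamma_lower Fh \<and>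
            int (gamma_imag F) = int (inertia_zero (hankel p s 0 (int m - 1))) + int (inertia_zero (hankel p s 1 (int m - 1)))
                                 - int (gamma_upper Fh) - int (gamma_lower Fh))
       \<and> (n = 2 * m + 1 \<longrightarrow>
            gamma_left F = inertia_pos (hankel p s 0 (int m)) + inertia_pos (hankel p s 1 (int m - 1)) + gamma_upper Fh \<and>
            gamma_right F = inertia_neg (hankel p s 0 (int m)) + inertia_neg (hankel p s 1 (int m - 1)) + gamma_lower Fh \<and>
            int (gamma_imag F) = int (inertia_zero (hankel p s 0 (int m))) + int (inertia_zero (hankel p s 1 (int m - 1)))
                                 - int (gamma_upper Fh) - int (gamma_lower Fh))"
proof -
  let ?H0 = "hankel p s 0 (int ((n + 1) div 2) - 1)" and ?H1 = "hankel p s 1 (int (n div 2) - 1)"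
  have "gamma_left F = inertia_pos ?H0 + inertia_pos ?H1 + gamma_upper Fh \<and>
    gamma_right F = inertia_neg ?H0 + inertia_neg ?H1 + gamma_lower Fh \<and>
    int (gamma_imag F) = int (inertia_zero ?H0) + int (inertia_zero ?H1) - int (gamma_upper Fh) - int (gamma_lower Fh)"
    using assms(3) right_markov_root_count[OF assms(1,2)] left_markov_root_count[OF assms(1,2)] by blast
  moreover have "n = 2 * m \<Longrightarrow> int ((n + 1) div 2) - 1 = int m - 1 \<and> int (n div 2) - 1 = int m - 1" by simp
  moreover have "n = 2 * m + 1 \<Longrightarrow> int ((n + 1) div 2) - 1 = int m \<and> int (n div 2) - 1 = int m - 1" by simp
  ultimately show ?thesis by metis
qed

end
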